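(* Let $K$ be an algebraically closed field of characteristic $0$ and $V,W$ finite-dimensional $K$-vector spaces. In the algebra $\bigwedge V^*\otimes\bigwedge W$ put $Y(V,W)=\bigcup_{t\ge0}Y_t(V,W)$ and $X(V,W)=\bigcup_{t\ge0}X_t(V,W)$. Then $X(V,W)$ is the smallest subset of $\bigwedge V^*\otimes\bigwedge W$ that contains $Y(V,W)$ and is stable under all maps $z\mapsto(\alpha\otimes y)\cdot z$ with $\alpha\in V^*$, $y\in W$ (i.e. $X(V,W)$ is the closure of $Y(V,W)$ under the iterated multiplication by elements $\alpha\otimes y$). Moreover, let $t\ge0$ and $x\in X_t(V,W)$ with $\operatorname{rank}x>1$, and let $0\le s\le t$. Then there exist $x'\in Y_s(V,W)$, $\alpha_1,\dots,\alpha_{t-s}\in V^*$ and $y_1,\dots,y_{t-s}\in W$ with $$x=\bigl((\alpha_1\wedge\dots\wedge\alpha_{t-s})\otimes(y_1\wedge\dots\wedge y_{t-s})\bigr)\cdot x'$$ if and only if $s=\operatorname{sr}(x)-1$. If $\operatorname{rank}x=1$, then such a representation exists with $s=\operatorname{sr}(x)-1=0$.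
   Context: Let $m=\dim V\le n=\dim W$. For $t\ge0$ let $\Lambda_t:\operatorname{Hom}_K(V,W)\to\operatorname{Hom}_K(\bigwedge^tV,\bigwedge^tW)$, $\Lambda_t(\phi)=\bigwedge^t\phi$ (with $\bigwedge^0\phi=\mathrm{id}_K$). $Y_t(V,W)$ denotes the image of $\Lambda_t$ and $X_t(V,W)$ its Zariski closure in the affine space $\operatorname{Hom}_K(\bigwedge^tV,\bigwedge^tW)$. Each $\alpha\in V^*$ acts on $\bigwedge V$ by the contraction $x_1\wedge\dots\wedge x_u\lrcorner\alpha=\sum_{i=1}^u(-1)^{i-1}\alpha(x_i)\,x_1\wedge\dots\wedge\widehat{x_i}\wedge\dots\wedge x_u$, and this makes $\bigwedge V$ a right module over $\bigwedge V^*$ via $x\lrcorner(\alpha\wedge\beta)=(x\lrcorner\alpha)\lrcorner\beta$. Via this, $\operatorname{Hom}_K(\bigwedge^iV,\bigwedge^iW)$ is identified with $\bigwedge^iV^*\otimes\bigwedge^iW$, the element $\beta\otimes z$ corresponding to the map $x\mapsto(x\lrcorner\beta)\,z$. The multiplication in $\bigwedge V^*\otimes\bigwedge W$ is $(a\otimes b)(c\otimes d)=(a\wedge c)\otimes(b\wedge d)$. For $\psi\in\operatorname{Hom}_K(\bigwedge^tV,\bigwedge^tW)$, $\operatorname{rank}\psi$ is its rank as a linear map, and the small rank $\operatorname{sr}(\psi)$ is the maximum of the ranks of the restrictions of $\psi$ to the subspaces $\bigwedge^tU\subseteq\bigwedge^tV$, where $U$ ranges over all subspaces of $V$ of dimension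 $\le t+1$. *)

theory Defs
  imports "HOL-Computational_Algebra.Polynomial" "HOL-Library.Function_Algebras"
begin

text \<open>Coordinates.  V = K^m with basis e_0..e_{m-1}, W = K^n with basis f_0..f_{n-1}.
  A vector of V (resp. of V^*, W) is a function nat => K supported on {..<m}
  (resp. {..<m}, {..<n}); coordinates of V^* are w.r.t. the dual basis.
  An element of an exterior algebra is a function nat set => K giving the
  coefficient of e_I = e_{i_1} wedge ... wedge e_{i_k} (i_1 < ... < i_k);
  an element of  Lambda V^* (x) Lambda W  is a function nat set => nat set => K
  (coefficient of e_I^* (x) f_J).\<close>

type_synonym 'a ext1 = "nat set \<Rightarrow> 'a"
type_synonym 'a ext2 = "nat set \<Rightarrow> nat set \<Rightarrow> 'a"

definition fscale :: "'a::times \<Rightarrow> ('b \<Rightarrow> 'a) \<Rightarrow> ('b \<Rightarrow> 'a)" where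
  "fscale c f = (\<lambda>x. c * f x)"

definition vecs :: "nat \<Rightarrow> (nat \<Rightarrow> 'a::zero) set" where
  "vecs k = {v. \<forall>i. v i \<noteq> 0 \<longrightarrow> i < k}"

definition tensor_space :: "nat \<Rightarrow> nat \<Rightarrow> ('a::zero) ext2 set" where
  "tensor_space m n = {z. \<forall>I J. z I J \<noteq> 0 \<longrightarrow> I \<subseteq> {..<m} \<and> J \<subseteq> {..<n}}"

text \<open>sign of the shuffle that sorts e_A wedge e_B (A, B disjoint)\<close>
definition shuffle_sign :: "nat set \<Rightarrow> nat set \<Rightarrow> 'a::comm_ring_1" where
  "shuffle_sign A B = (-1) ^ card {(a,b). a \<in> A \<and> b \<in> B \<and> b < a}"

definition wedge :: "'a::comm_ring_1 ext1 \<Rightarrow> 'a ext1 \<Rightarrow> 'a ext1" where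
  "wedge u v = (\<lambda>I. \<Sum>I1\<in>Pow I. shuffle_sign I1 (I - I1) * u I1 * v (I - I1))"

definition ext_one :: "'a::{zero,one} ext1" where
  "ext_one = (\<lambda>I. if I = {} then 1 else 0)"

definition ext_vec :: "(nat \<Rightarrow> 'a::zero) \<Rightarrow> 'a ext1" where
  "ext_vec v = (\<lambda>I. if is_singleton I then v (the_elem I) else 0)"

definition wedge_list :: "(nat \<Rightarrow> 'a::comm_ring_1) list \<Rightarrow> 'a ext1" where
  "wedge_list vs = foldr (\<lambda>v acc. wedge (ext_vec v) acc) vs ext_one"

definition tensor :: "'a::times ext1 \<Rightarrow> 'a ext1 \<Rightarrow> 'a ext2" where
  "tensor a b = (\<lambda>I J. a I * b J)"

text \<open>multiplication (a (x) b)(c (x) d) = (a wedge c) (x) (b wedge d)\<close>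
definition mult2 :: "'a::comm_ring_1 ext2 \<Rightarrow> 'a ext2 \<Rightarrow> 'a ext2" where
  "mult2 x y = (\<lambda>I J. \<Sum>I1\<in>Pow I. \<Sum>J1\<in>Pow J.
      shuffle_sign I1 (I - I1) * shuffle_sign J1 (J - J1) * x I1 J1 * y (I - I1) (J - J1))"

text \<open>Hom_K(V,W): matrices A with A j i the j-th coordinate of phi(e_i)\<close>
definition homs :: "nat \<Rightarrow> nat \<Rightarrow> (nat \<Rightarrow> nat \<Rightarrow> 'a::zero) set" where
  "homs m n = {A. \<forall>j i. A j i \<noteq> 0 \<longrightarrow> j < n \<and> i < m}"

definition tsub :: "nat \<Rightarrow> nat \<Rightarrow> nat set set" where
  "tsub k t = {I. I \<subseteq> {..<k} \<and> card I = t}"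

text \<open>Lambda_t(phi) in  Lambda^t V^* (x) Lambda^t W: the coefficient of e_I^* (x) f_J is the
  f_J-coefficient of  wedge^t phi (e_I) = phi(e_{i_1}) wedge ... wedge phi(e_{i_t}).\<close>
definition Lambda :: "nat \<Rightarrow> nat \<Rightarrow> (nat \<Rightarrow> nat \<Rightarrow> 'a::comm_ring_1) \<Rightarrow> 'a ext2" where
  "Lambda m t A = (\<lambda>I J. if I \<in> tsub m t
      then wedge_list (map (\<lambda>i. (\<lambda>j. A j i)) (sorted_list_of_set I)) J else 0)"

definition Ycomp :: "nat \<Rightarrow> nat \<Rightarrow> nat \<Rightarrow> 'a::comm_ring_1 ext2 set" where
  "Ycomp m n t = Lambda m t ` homs m n"

text \<open>the affine space Hom(Lambda^t V, Lambda^t W) = Lambda^t V^* (x) Lambda^t W\<close>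
definition hom_space :: "nat \<Rightarrow> nat \<Rightarrow> nat \<Rightarrow> ('a::zero) ext2 set" where
  "hom_space m n t = {z. \<forall>I J. z I J \<noteq> 0 \<longrightarrow> I \<in> tsub m t \<and> J \<in> tsub n t}"

inductive polyfun :: "('a::comm_ring_1 ext2 \<Rightarrow> 'a) \<Rightarrow> bool" where
  pconst: "polyfun (\<lambda>z. c)"
| pcoord: "polyfun (\<lambda>z. z I J)"
| padd: "polyfun f \<Longrightarrow> polyfun g \<Longrightarrow> polyfun (\<lambda>z. f z + g z)"
| pmult: "polyfun f \<Longrightarrow> polyfun g \<Longrightarrow> polyfun (\<lambda>z. f z * g z)"

definition zariski_closure :: "'a::comm_ring_1 ext2 set \<Rightarrow> 'a ext2 set \<Rightarrow> 'a ext2 set" where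
  "zariski_closure A S = {x \<in> A. \<forall>f. polyfun f \<longrightarrow> (\<forall>y\<in>S. f y = 0) \<longrightarrow> f x = 0}"

definition Xcomp :: "nat \<Rightarrow> nat \<Rightarrow> nat \<Rightarrow> 'a::comm_ring_1 ext2 set" where
  "Xcomp m n t = zariski_closure (hom_space m n t) (Ycomp m n t)"

definition Yall :: "nat \<Rightarrow> nat \<Rightarrow> 'a::comm_ring_1 ext2 set" where
  "Yall m n = (\<Union>t. Ycomp m n t)"

definition Xall :: "nat \<Rightarrow> nat \<Rightarrow> 'a::comm_ring_1 ext2 set" where
  "Xall m n = (\<Union>t. Xcomp m n t)"

definition apply_hom :: "nat \<Rightarrow> nat \<Rightarrow> 'a::comm_ring_1 ext2 \<Rightarrow> 'a ext1 \<Rightarrow> 'a ext1" where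
  "apply_hom m t psi v = (\<lambda>J. \<Sum>I\<in>tsub m t. v I * psi I J)"

definition ext_pow_space :: "nat \<Rightarrow> nat \<Rightarrow> 'a::comm_ring_1 ext1 set" where
  "ext_pow_space m t = {v. \<forall>I. v I \<noteq> 0 \<longrightarrow> I \<in> tsub m t}"

definition hom_rank :: "nat \<Rightarrow> nat \<Rightarrow> 'a::field ext2 \<Rightarrow> nat" where
  "hom_rank m t psi = vector_space.dim fscale (apply_hom m t psi ` ext_pow_space m t)"

definition ext_pow_sub :: "nat \<Rightarrow> (nat \<Rightarrow> 'a::field) set \<Rightarrow> 'a ext1 set" where
  "ext_pow_sub t U = module.span fscale {wedge_list us | us. set us \<subseteq> U \<and> length us = t}"

definition small_rank :: "nat \<Rightarrow> nat \<Rightarrow> 'a::field ext2 \<Rightarrow> nat" where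
  "small_rank m t psi = Max {vector_space.dim fscale (apply_hom m t psi ` ext_pow_sub t U) | U.
      U \<subseteq> vecs m \<and> module.subspace fscale U \<and> vector_space.dim fscale U \<le> t + 1}"

end

theory Submission
  imports Defs "HOL-Computational_Algebra.Fraction_Field"
begin

text \<open>
  The compound \<open>\<Lambda>\<^sub>t \<phi>\<close> of \<open>\<phi> = \<Sum> \<alpha>\<^sub>i \<otimes> y\<^sub>i\<close> is the \<open>t\<close>-th elementary symmetric
  function of the commuting, square-zero elements \<open>\<alpha>\<^sub>i \<otimes> y\<^sub>i\<close>; hence
  \<open>\<Lambda>\<^sub>t\<^sub>+\<^sub>1(\<epsilon>\<^sup>-\<^sup>t \<alpha> \<otimes> y + \<epsilon> \<phi>) = (\<alpha> \<otimes> y) \<Lambda>\<^sub>t \<phi> + \<epsilon>\<^sup>t\<^sup>+\<^sup>1 \<Lambda>\<^sub>t\<^sub>+\<^sub>1 \<phi>\<close>, and letting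
  \<open>\<epsilon>\<close> tend to \<open>0\<close> shows that \<open>X\<close> is stable under multiplication by \<open>\<alpha> \<otimes> y\<close>.

  Conversely, a point \<open>x\<close> of \<open>X\<^sub>t\<close> defines a ring homomorphism to \<open>K\<close> on the subalgebra of
  the field of rational functions in the matrix entries generated by the \<open>t\<close>-minors of the
  generic matrix. As \<open>K\<close> is algebraically closed it extends to a place with values in \<open>K\<close>, so
  \<open>x\<close> is the limit of the generic compound along a valuation. Gaussian elimination with a
  pivot of maximal valuation splits off factors \<open>\<alpha> \<otimes> y\<close> from this limit until a compound of a
  matrix over \<open>K\<close> remains.

  For the ranks, reduce a product \<open>(\<alpha>\<^sub>1 \<otimes> y\<^sub>1)\<dots>(\<alpha>\<^sub>p \<otimes> y\<^sub>p) \<Lambda>\<^sub>s(\<Sum> \<gamma>\<^sub>k \<otimes> w\<^sub>k)\<close> to the case in which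
  the \<open>\<alpha>\<close>'s and \<open>\<gamma>\<close>'s, and the \<open>y\<close>'s and \<open>w\<close>'s, are linearly independent. On \<open>\<Lambda>\<^sup>t U\<close> with
  \<open>dim U \<le> t + 1\<close> only the wedges containing a complement of \<open>U \<inter> \<Inter> ker \<alpha>\<^sub>i\<close> survive, at most
  \<open>s + 1\<close> of them, and with more than \<open>s \<ge> 1\<close> summands this bound is attained on the span of
  dual vectors.
\<close>

section \<open>Algebra: products of dyads and compound matrices\<close>

subsection \<open>The algebra as a ring type\<close>

text \<open>A limit of compounds need not be the compound of a limit: bounded minors of order t
  allow some entries of the matrix to blow up while others shrink. A place records only which
  elements are finite and what their residues are. This suffices, so no curve through the point of
  the closure has to be found. That splitting off a pivot leaves a single product rests on
  divisibility. In a diagonal form d_1 | d_2 | ... over the valuation ring, the minors of order t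
  generate the ideal of d_1 ... d_t. If c is not finite but c d_1 ... d_t is, then d_1 ... d_t has
  residue 0, hence so do d_t and d_{t+1}, and c times any minor of order t+1 has residue 0. The
  bound on the rank excludes an ambiguity. A compound of order s with exactly s independent summands
  is the product of all of them; the point is then decomposable, and any number of its dyads can be
  moved back into a compound, so s is not determined. With more summands, s >= 1 is visible in the
  ranks on small subspaces.\<close>

lemma shuffle_sign_empty [simp]: "shuffle_sign {} B = 1" "shuffle_sign A {} = 1"
  by (simp_all add: shuffle_sign_def)

lemma inversions_finite:
  "finite A \<Longrightarrow> finite B \<Longrightarrow> finite {(a::nat,b). a \<in> A \<and> b \<in> B \<and> b < a}"
  by (rule finite_subset[of _ "A \<times> B"]) auto

lemma shuffle_sign_Un_left:
  assumes "finite A" "finite B" "finite C" "A \<inter> B = {}"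
  shows "shuffle_sign (A \<union> B) C = shuffle_sign A C * shuffle_sign B C"
proof -
  have eq: "{(a,b). a \<in> A \<union> B \<and> b \<in> C \<and> b < a} =
      {(a,b). a \<in> A \<and> b \<in> C \<and> b < a} \<union> {(a,b). a \<in> B \<and> b \<in> C \<and> b < a}" by auto
  show ?thesis unfolding shuffle_sign_def eq power_add[symmetric]
    by (subst card_Un_disjoint) (use assms inversions_finite in auto)
qed

lemma shuffle_sign_Un_right:
  assumes "finite A" "finite B" "finite C" "B \<inter> C = {}"
  shows "shuffle_sign A (B \<union> C) = shuffle_sign A B * shuffle_sign A C"
proof -
  have eq: "{(a,b). a \<in> A \<and> b \<in> B \<union> C \<and> b < a} =
      {(a,b). a \<in> A \<and> b \<in> B \<and> b < a} \<union> {(a,b). a \<in> A \<and> b \<in> C \<and> b < a}" by auto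
  show ?thesis unfolding shuffle_sign_def eq power_add[symmetric]
    by (subst card_Un_disjoint) (use assms inversions_finite in auto)
qed

lemma shuffle_sign_square [simp]: "shuffle_sign A B * shuffle_sign A B = 1"
  by (simp add: shuffle_sign_def power_add[symmetric])

lemma shuffle_sign_square_left [simp]: "shuffle_sign A B * (shuffle_sign A B * c) = c"
  by (simp add: mult.assoc[symmetric])

lemma shuffle_sign_singletons:
  "i < j \<Longrightarrow> shuffle_sign {i} {j} = 1" "i < j \<Longrightarrow> shuffle_sign {j} {i} = - 1"
proof -
  assume "i < j"
  then have "{(a,b). a \<in> {i} \<and> b \<in> {j} \<and> b < a} = {}" "{(a,b). a \<in> {j} \<and> b \<in> {i} \<and> b < a} = {(j,i)}"
    by auto
  then show "shuffle_sign {i} {j} = 1" "shuffle_sign {j} {i} = - 1"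
    unfolding shuffle_sign_def by (metis card.empty power_0, metis is_singletonI is_singleton_altdef power_one_right)
qed

lemma shuffle_sign_swap_singletons:
  "i \<noteq> j \<Longrightarrow> shuffle_sign {i} {j} = - shuffle_sign {j} {i}"
  by (cases i j rule: linorder_cases) (simp_all add: shuffle_sign_singletons)

lemma shuffle_sign_less:
  assumes "\<And>a b. a \<in> A \<Longrightarrow> b \<in> B \<Longrightarrow> a < b"
  shows "shuffle_sign A B = 1"
proof -
  have "{(a,b). a \<in> A \<and> b \<in> B \<and> b < a} = {}" using assms by (auto dest: less_asym)
  then show ?thesis by (simp only: shuffle_sign_def card.empty power_0)
qed

text \<open>The sign that sorts three consecutive blocks. Both bracketings of a triple product
  produce it, so that associativity reduces to the reindexing \<open>sum_Pow_Pow\<close>.\<close>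

definition sign3 :: "nat set \<Rightarrow> nat set \<Rightarrow> nat set \<Rightarrow> 'a::comm_ring_1" where
  "sign3 A B C = shuffle_sign A B * shuffle_sign A C * shuffle_sign B C"

lemma sign3_left:
  assumes "finite I" "I1 \<subseteq> I" "I2 \<subseteq> I1"
  shows "shuffle_sign I1 (I - I1) * shuffle_sign I2 (I1 - I2) = sign3 I2 (I1 - I2) (I - I1)"
proof -
  have f: "finite I1" "finite I2" using assms finite_subset by metis+
  have "I1 = I2 \<union> (I1 - I2)" using assms by auto
  then have "shuffle_sign I1 (I - I1) = (shuffle_sign I2 (I - I1) * shuffle_sign (I1 - I2) (I - I1) :: 'a)"
    using shuffle_sign_Un_left[of I2 "I1 - I2" "I - I1"] f assms(1) by simp
  then show ?thesis by (simp add: sign3_def mult_ac)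
qed

lemma sign3_right:
  assumes "finite I" "I1 \<subseteq> I" "I2 \<subseteq> I - I1"
  shows "shuffle_sign I1 (I - I1) * shuffle_sign I2 (I - I1 - I2) = sign3 I1 I2 (I - I1 - I2)"
proof -
  have f: "finite I1" "finite I2" using assms finite_subset by (metis finite_Diff)+
  have "I - I1 = I2 \<union> (I - I1 - I2)" using assms by auto
  then have "shuffle_sign I1 (I - I1) = (shuffle_sign I1 I2 * shuffle_sign I1 (I - I1 - I2) :: 'a)"
    using shuffle_sign_Un_right[of I1 I2 "I - I1 - I2"] f assms(1) by simp
  then show ?thesis by (simp add: sign3_def mult_ac)
qed

lemma sum_Pow_Pow:
  assumes "finite I"
  shows "(\<Sum>I1\<in>Pow I. \<Sum>I2\<in>Pow I1. F I2 (I1 - I2) (I - I1)) =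
         (\<Sum>I1\<in>Pow I. \<Sum>I2\<in>Pow (I - I1). F I1 I2 (I - I1 - I2) :: 'b::comm_monoid_add)"
proof -
  have fin: "\<And>A. A \<in> Pow I \<Longrightarrow> finite (Pow A)" using assms finite_subset by blast
  show ?thesis
    by (subst sum.Sigma, use fin assms in auto, subst sum.Sigma, use fin assms in auto,
        rule sum.reindex_bij_witness[of _ "\<lambda>(A, B). (A \<union> B, A)" "\<lambda>(A, B). (B, A - B)"])
       (auto simp: Diff_Diff_Int Un_absorb1 Un_absorb2 Int_absorb1 Int_absorb2
         intro!: arg_cong2[of _ _ _ _ "F _"] arg_cong[of _ _ "F _ _"])
qed

lemma mult2_infinite: "infinite I \<or> infinite J \<Longrightarrow> mult2 x y I J = 0"
proof -
  assume "infinite I \<or> infinite J"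
  then consider "infinite (Pow I)" | "infinite (Pow J)" by (auto simp: finite_Pow_iff)
  then show ?thesis by cases (simp_all add: mult2_def)
qed

lemma mult2_assoc: "mult2 (mult2 x y) z = mult2 x (mult2 y z)"
proof (intro ext)
  fix I J
  show "mult2 (mult2 x y) z I J = mult2 x (mult2 y z) I J"
  proof (cases "finite I \<and> finite J")
    case False then show ?thesis by (auto simp: mult2_infinite)
  next
    case True
    then have fI: "finite I" and fJ: "finite J" by auto
    define G where "G A B C A' B' C' = sign3 A B C * sign3 A' B' C' * (x A A' * y B B' * z C C')" for A B C A' B' C'
    have "mult2 (mult2 x y) z I J =
      (\<Sum>I1\<in>Pow I. \<Sum>J1\<in>Pow J. \<Sum>I2\<in>Pow I1. \<Sum>J2\<in>Pow J1.
         (shuffle_sign I1 (I - I1) * shuffle_sign I2 (I1 - I2)) * (shuffle_sign J1 (J - J1) * shuffle_sign J2 (J1 - J2))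
         * (x I2 J2 * y (I1 - I2) (J1 - J2) * z (I - I1) (J - J1)))"
      unfolding mult2_def sum_distrib_left sum_distrib_right by (simp only: mult_ac)
    also have "\<dots> = (\<Sum>I1\<in>Pow I. \<Sum>J1\<in>Pow J. \<Sum>I2\<in>Pow I1. \<Sum>J2\<in>Pow J1.
         G I2 (I1 - I2) (I - I1) J2 (J1 - J2) (J - J1))"
      unfolding G_def by (intro sum.cong refl) (simp add: sign3_left[OF fI] sign3_left[OF fJ])
    also have "\<dots> = (\<Sum>I1\<in>Pow I. \<Sum>I2\<in>Pow I1. \<Sum>J1\<in>Pow J. \<Sum>J2\<in>Pow J1.
         G I2 (I1 - I2) (I - I1) J2 (J1 - J2) (J - J1))"
      by (rule sum.cong[OF refl], rule sum.swap)
    also have "\<dots> = (\<Sum>I1\<in>Pow I. \<Sum>I2\<in>Pow (I - I1). \<Sum>J1\<in>Pow J. \<Sum>J2\<in>Pow (J - J1).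
         G I1 I2 (I - I1 - I2) J1 J2 (J - J1 - J2))"
      using sum_Pow_Pow[OF fI, of "\<lambda>A B C. \<Sum>J1\<in>Pow J. \<Sum>J2\<in>Pow J1. G A B C J2 (J1 - J2) (J - J1)"]
        sum_Pow_Pow[OF fJ, of "\<lambda>A' B' C'. G _ _ _ A' B' C'"] by simp
    also have "\<dots> = (\<Sum>I1\<in>Pow I. \<Sum>J1\<in>Pow J. \<Sum>I2\<in>Pow (I - I1). \<Sum>J2\<in>Pow (J - J1).
         G I1 I2 (I - I1 - I2) J1 J2 (J - J1 - J2))"
      by (rule sum.cong[OF refl], rule sum.swap)
    also have "\<dots> = (\<Sum>I1\<in>Pow I. \<Sum>J1\<in>Pow J. \<Sum>I2\<in>Pow (I - I1). \<Sum>J2\<in>Pow (J - J1).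
         (shuffle_sign I1 (I - I1) * shuffle_sign I2 (I - I1 - I2)) * (shuffle_sign J1 (J - J1) * shuffle_sign J2 (J - J1 - J2))
         * (x I1 J1 * y I2 J2 * z (I - I1 - I2) (J - J1 - J2)))"
      unfolding G_def by (intro sum.cong refl) (simp add: sign3_right[OF fI] sign3_right[OF fJ])
    also have "\<dots> = mult2 x (mult2 y z) I J"
      unfolding mult2_def sum_distrib_left sum_distrib_right by (simp only: mult_ac)
    finally show ?thesis .
  qed
qed

text \<open>A sum over the subsets of an infinite set is 0, so \<open>mult2\<close> vanishes at
  infinite index sets, and the unit laws hold only for elements that vanish there too. The
  dimensions \<open>m\<close> and \<open>n\<close> stay out of the type and are tracked by support
  conditions.\<close>

typedef (overloaded) 'a bialg = "{z :: 'a::comm_ring_1 ext2. \<forall>I J. z I J \<noteq> 0 \<longrightarrow> finite I \<and> finite J}"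
  by (rule exI[of _ "\<lambda>_ _. 0"]) simp

setup_lifting type_definition_bialg

instantiation bialg :: (comm_ring_1) ring_1
begin

lift_definition zero_bialg :: "'a bialg" is "\<lambda>_ _. 0" by simp
lift_definition one_bialg :: "'a bialg" is "tensor ext_one ext_one"
  by (auto simp: tensor_def ext_one_def split: if_splits)
lift_definition plus_bialg :: "'a bialg \<Rightarrow> 'a bialg \<Rightarrow> 'a bialg" is "\<lambda>x y I J. x I J + y I J"
  by (metis add.right_neutral)
lift_definition minus_bialg :: "'a bialg \<Rightarrow> 'a bialg \<Rightarrow> 'a bialg" is "\<lambda>x y I J. x I J - y I J"
  by (metis diff_zero)
lift_definition uminus_bialg :: "'a bialg \<Rightarrow> 'a bialg" is "\<lambda>x I J. - x I J" by simp
lift_definition times_bialg :: "'a bialg \<Rightarrow> 'a bialg \<Rightarrow> 'a bialg" is mult2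
  using mult2_infinite by metis

instance
proof
  fix a b c :: "'a bialg"
  show "a * b * c = a * (b * c)" by transfer (rule mult2_assoc)
  show "(a + b) * c = a * c + b * c"
    by transfer (simp add: mult2_def algebra_simps sum.distrib fun_eq_iff)
  show "a * (b + c) = a * b + a * c"
    by transfer (simp add: mult2_def algebra_simps sum.distrib fun_eq_iff)
  show "1 * a = a"
  proof (transfer, intro ext)
    fix a :: "'a ext2" and I J assume a: "\<forall>I J. a I J \<noteq> 0 \<longrightarrow> finite I \<and> finite J"
    show "mult2 (tensor ext_one ext_one) a I J = a I J"
    proof (cases "finite I \<and> finite J")
      case False then show ?thesis using a by (auto simp: mult2_infinite)
    next
      case True
      have *: "(\<Sum>I1\<in>Pow I. \<Sum>J1\<in>Pow J. shuffle_sign I1 (I - I1) * shuffle_sign J1 (J - J1)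
         * tensor ext_one ext_one I1 J1 * a (I - I1) (J - J1)) =
        (\<Sum>I1\<in>Pow I. if I1 = {} then (\<Sum>J1\<in>Pow J. if J1 = {} then a I J else 0) else 0)"
        by (intro sum.cong refl) (auto simp: tensor_def ext_one_def intro!: sum.cong)
      show ?thesis using True unfolding mult2_def * by simp
    qed
  qed
  show "a * 1 = a"
  proof (transfer, intro ext)
    fix a :: "'a ext2" and I J assume a: "\<forall>I J. a I J \<noteq> 0 \<longrightarrow> finite I \<and> finite J"
    show "mult2 a (tensor ext_one ext_one) I J = a I J"
    proof (cases "finite I \<and> finite J")
      case False then show ?thesis using a by (auto simp: mult2_infinite)
    next
      case True
      have *: "(\<Sum>I1\<in>Pow I. \<Sum>J1\<in>Pow J. shuffle_sign I1 (I - I1) * shuffle_sign J1 (J - J1)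
         * a I1 J1 * tensor ext_one ext_one (I - I1) (J - J1)) =
        (\<Sum>I1\<in>Pow I. if I1 = I then (\<Sum>J1\<in>Pow J. if J1 = J then a I J else 0) else 0)"
        by (intro sum.cong refl) (auto simp: tensor_def ext_one_def intro!: sum.cong)
      show ?thesis using True unfolding mult2_def * by simp
    qed
  qed
  show "(0::'a bialg) \<noteq> 1"
    by transfer (auto simp: tensor_def ext_one_def fun_eq_iff)
qed (transfer; simp add: fun_eq_iff)+

end

subsection \<open>Generators\<close>

lemma wedge_infinite: "infinite I \<Longrightarrow> wedge u v I = 0"
  by (simp add: wedge_def finite_Pow_iff)

lemma wedge_ext_one_right: "finite I \<Longrightarrow> wedge u ext_one I = u I"
proof -
  assume f: "finite I"
  have "wedge u ext_one I = (\<Sum>I1\<in>Pow I. if I1 = I then u I else 0)"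
    unfolding wedge_def by (intro sum.cong refl) (auto simp: ext_one_def)
  then show ?thesis using f by simp
qed

lemma wedge_ext_one_left: "finite I \<Longrightarrow> wedge ext_one u I = u I"
proof -
  assume f: "finite I"
  have "wedge ext_one u I = (\<Sum>I1\<in>Pow I. if I1 = {} then u I else 0)"
    unfolding wedge_def by (intro sum.cong refl) (auto simp: ext_one_def)
  then show ?thesis using f by simp
qed

lemma tensor_apply: "tensor a b I J = a I * b J"
  by (simp add: tensor_def)

lemma mult2_tensor: "mult2 (tensor a b) (tensor c d) = tensor (wedge a c) (wedge b d)"
  unfolding mult2_def tensor_def wedge_def sum_product by (simp add: fun_eq_iff mult_ac)

lemma ext_vec_infinite: "infinite I \<Longrightarrow> ext_vec v I = 0"
  by (auto simp: ext_vec_def is_singleton_def)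

lemma ext_vec_eq_0: "card I \<noteq> 1 \<Longrightarrow> ext_vec v I = 0"
  by (auto simp: ext_vec_def is_singleton_altdef)

lemma ext_vec_singleton [simp]: "ext_vec v {i} = v i"
  by (simp add: ext_vec_def)

lemma wedge_ext_vec_one [simp]: "wedge (ext_vec v) ext_one = ext_vec v" "wedge ext_one (ext_vec v) = ext_vec v"
  by (metis ext wedge_ext_one_right wedge_infinite ext_vec_infinite)
     (metis ext wedge_ext_one_left wedge_infinite ext_vec_infinite)

lemma ext_one_infinite: "infinite I \<Longrightarrow> ext_one I = 0"
  by (auto simp: ext_one_def)

lemma wedge_list_Nil [simp]: "wedge_list [] = ext_one"
  by (simp add: wedge_list_def)

lemma wedge_list_Cons [simp]: "wedge_list (v # vs) = wedge (ext_vec v) (wedge_list vs)"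
  by (simp add: wedge_list_def)

lemma wedge_list_infinite: "infinite I \<Longrightarrow> wedge_list vs I = 0"
  by (cases vs) (simp_all add: ext_one_infinite wedge_infinite)

lemma wedge_ext_one_wedge_list [simp]:
  "wedge (wedge_list vs) ext_one = wedge_list vs" "wedge ext_one (wedge_list vs) = wedge_list vs"
  by (metis ext wedge_ext_one_right wedge_infinite wedge_list_infinite)
     (metis ext wedge_ext_one_left wedge_infinite wedge_list_infinite)

lemma wedge_ext_one_one [simp]: "wedge ext_one ext_one = ext_one"
  by (metis ext wedge_ext_one_right wedge_infinite ext_one_infinite)

lemma sum_Pow_singletons:
  assumes "finite I" "\<And>I1. card I1 \<noteq> 1 \<Longrightarrow> F I1 = 0"
  shows "(\<Sum>I1\<in>Pow I. F I1) = (\<Sum>i\<in>I. F {i})"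
proof -
  have "(\<Sum>I1\<in>Pow I. F I1) = (\<Sum>I1\<in>(\<lambda>i. {i}) ` I. F I1)"
    by (rule sum.mono_neutral_right) (use assms in \<open>auto simp: card_1_singleton_iff\<close>)
  then show ?thesis by (simp add: sum.reindex)
qed

lemma wedge_ext_vec:
  assumes "finite I"
  shows "wedge (ext_vec v) u I = (\<Sum>i\<in>I. shuffle_sign {i} (I - {i}) * v i * u (I - {i}))"
  unfolding wedge_def by (subst sum_Pow_singletons[OF assms]) (simp_all add: ext_vec_eq_0)

lemma mult2_dyad:
  assumes "finite I" "finite J"
  shows "mult2 (tensor (ext_vec v) (ext_vec y)) z I J =
    (\<Sum>i\<in>I. \<Sum>j\<in>J. shuffle_sign {i} (I - {i}) * shuffle_sign {j} (J - {j}) * (v i * y j) * z (I - {i}) (J - {j}))"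
  unfolding mult2_def
  by (subst sum_Pow_singletons[OF assms(1)], simp add: tensor_def ext_vec_eq_0,
      intro sum.cong refl, subst sum_Pow_singletons[OF assms(2)])
     (simp_all add: tensor_def ext_vec_eq_0)

lemma wedge_ext_vec_ext_vec: "wedge (ext_vec v) (ext_vec w) I = - wedge (ext_vec w) (ext_vec v) (I::nat set)"
  and wedge_ext_vec_self: "wedge (ext_vec v) (ext_vec v) I = 0"
proof -
  have "wedge (ext_vec v) (ext_vec w) I = - wedge (ext_vec w) (ext_vec v) I \<and> wedge (ext_vec v) (ext_vec v) I = 0"
  proof (cases "finite I")
    case False then show ?thesis by (simp add: wedge_infinite)
  next
    case True
    show ?thesis
    proof (cases "card I = 2")
      case False
      have "wedge (ext_vec v) (ext_vec w) I = 0" for v w :: "nat \<Rightarrow> 'a"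
        unfolding wedge_ext_vec[OF True]
      proof (rule sum.neutral, rule ballI)
        fix i assume "i \<in> I"
        then have "card (I - {i}) \<noteq> 1" using False True card_Suc_Diff1[OF True, of i] by simp
        then show "shuffle_sign {i} (I - {i}) * v i * ext_vec w (I - {i}) = 0" by (simp add: ext_vec_eq_0)
      qed
      then show ?thesis by simp
    next
      case 2: True
      then obtain i j where ij: "I = {i, j}" "i \<noteq> j" by (auto simp: card_2_iff)
      have d: "{i,j} - {i} = {j}" "{i,j} - {j} = {i}" using ij by auto
      show ?thesis unfolding wedge_ext_vec[OF True] using ij
        by (simp add: d shuffle_sign_swap_singletons[of i j])
    qed
  qed
  then show "wedge (ext_vec v) (ext_vec w) I = - wedge (ext_vec w) (ext_vec v) I" "wedge (ext_vec v) (ext_vec v) I = 0"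
    by auto
qed

lemma Rep_bialg_infinite: "infinite I \<or> infinite J \<Longrightarrow> Rep_bialg z I J = 0"
  using Rep_bialg[of z] by blast

lemma bialg_eqI: "(\<And>I J. Rep_bialg x I J = Rep_bialg y I J) \<Longrightarrow> x = y"
  by (simp add: Rep_bialg_inject[symmetric] fun_eq_iff)

lift_definition lft :: "(nat \<Rightarrow> 'a::comm_ring_1) \<Rightarrow> 'a bialg" is "\<lambda>v. tensor (ext_vec v) ext_one"
  by (metis tensor_def ext_vec_infinite ext_one_infinite mult_zero_left mult_zero_right)
lift_definition rgt :: "(nat \<Rightarrow> 'a::comm_ring_1) \<Rightarrow> 'a bialg" is "\<lambda>v. tensor ext_one (ext_vec v)"
  by (metis tensor_def ext_vec_infinite ext_one_infinite mult_zero_left mult_zero_right)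
lift_definition scl :: "'a::comm_ring_1 \<Rightarrow> 'a bialg \<Rightarrow> 'a bialg" is "\<lambda>c z I J. c * z I J"
  by (metis mult_zero_right)

definition dyad :: "(nat \<Rightarrow> 'a::comm_ring_1) \<Rightarrow> (nat \<Rightarrow> 'a) \<Rightarrow> 'a bialg" where
  "dyad v y = lft v * rgt y"

lemmas rep_eqs = zero_bialg.rep_eq one_bialg.rep_eq plus_bialg.rep_eq minus_bialg.rep_eq
  uminus_bialg.rep_eq times_bialg.rep_eq lft.rep_eq rgt.rep_eq scl.rep_eq

lemma Rep_dyad: "Rep_bialg (dyad v y) = tensor (ext_vec v) (ext_vec y)"
  unfolding dyad_def by transfer (simp add: mult2_tensor)

lemma rgt_lft: "rgt y * lft v = lft v * rgt y"
  by transfer (simp add: mult2_tensor)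

lemma rgt_lft_left: "rgt y * (lft v * z) = lft v * (rgt y * z)"
  by (simp add: mult.assoc[symmetric] rgt_lft)

lemma lft_square: "lft v * lft v = 0" and rgt_square: "rgt v * rgt v = 0"
  by - (rule bialg_eqI, unfold rep_eqs mult2_tensor tensor_apply, simp add: wedge_ext_vec_self)+

lemma lft_anti: "lft v * lft w = - (lft w * lft v)" and rgt_anti: "rgt v * rgt w = - (rgt w * rgt v)"
  by - (rule bialg_eqI, unfold rep_eqs mult2_tensor tensor_apply, subst wedge_ext_vec_ext_vec, simp)+

lemma scl_mult_left: "scl c x * y = scl c (x * y)"
  and scl_mult_right: "x * scl c y = scl c (x * y)"
  by - (rule bialg_eqI, simp add: rep_eqs mult2_def sum_distrib_left mult_ac)+

lemma scl_add: "scl c (x + y) = scl c x + scl c y"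
  and scl_scl: "scl c (scl d x) = scl (c * d) x"
  and scl_one [simp]: "scl 1 x = x"
  and scl_zero [simp]: "scl c 0 = 0"
  and scl_zero_left [simp]: "scl 0 x = 0"
  and scl_minus_left: "scl (- c) x = - scl c x"
  by - (rule bialg_eqI, simp add: rep_eqs algebra_simps)+

lemma ext_vec_add: "ext_vec (\<lambda>i. v i + w i) I = ext_vec v I + ext_vec w (I::nat set)" for v :: "nat \<Rightarrow> 'a::monoid_add"
  by (simp add: ext_vec_def)
lemma ext_vec_scale: "ext_vec (\<lambda>i. c * v i) I = c * ext_vec v (I::nat set)" for v :: "nat \<Rightarrow> 'a::comm_ring_1"
  by (simp add: ext_vec_def)

lemma lft_add: "lft (\<lambda>i. v i + w i) = lft v + lft w"
  and rgt_add: "rgt (\<lambda>i. v i + w i) = rgt v + rgt w"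
  and lft_scale: "lft (\<lambda>i. c * v i) = scl c (lft v)"
  and rgt_scale: "rgt (\<lambda>i. c * v i) = scl c (rgt v)"
  by - (rule bialg_eqI, simp add: rep_eqs tensor_apply algebra_simps ext_vec_add ext_vec_scale)+

lemma lft_zero [simp]: "lft (\<lambda>i. 0) = 0" and rgt_zero [simp]: "rgt (\<lambda>i. 0) = 0"
  by - (rule bialg_eqI, simp add: rep_eqs tensor_apply ext_vec_def)+

lemma dyad_add_left: "dyad (\<lambda>i. v i + w i) y = dyad v y + dyad w y"
  and dyad_add_right: "dyad v (\<lambda>i. y i + z i) = dyad v y + dyad v z"
  and dyad_scale_left: "dyad (\<lambda>i. c * v i) y = scl c (dyad v y)"
  and dyad_scale_right: "dyad v (\<lambda>i. c * y i) = scl c (dyad v y)"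
  and dyad_zero_left [simp]: "dyad (\<lambda>i. 0) y = 0"
  and dyad_zero_right [simp]: "dyad v (\<lambda>i. 0) = 0"
  by (simp_all add: dyad_def lft_add rgt_add lft_scale rgt_scale scl_mult_left scl_mult_right algebra_simps)

lemma dyad_mult: "dyad v y * dyad w z = lft v * lft w * (rgt y * rgt z)"
  by (simp add: dyad_def mult.assoc rgt_lft_left)

text \<open>The tensor product is the ungraded one: left and right factors pass each other freely,
  and exchanging two dyads costs one sign on each side. The signs cancel.\<close>

lemma dyad_commute: "dyad v y * dyad w z = dyad w z * dyad v y"
  unfolding dyad_mult by (metis lft_anti rgt_anti minus_mult_minus)

lemma dyad_same_left [simp]: "dyad v y * dyad v z = 0" and dyad_same_right [simp]: "dyad v y * dyad w y = 0"
  by (simp_all add: dyad_mult lft_square rgt_square)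

abbreviation lprod :: "(nat \<Rightarrow> 'a::comm_ring_1) list \<Rightarrow> 'a bialg" where
  "lprod vs \<equiv> prod_list (map lft vs)"
abbreviation rprod :: "(nat \<Rightarrow> 'a::comm_ring_1) list \<Rightarrow> 'a bialg" where
  "rprod vs \<equiv> prod_list (map rgt vs)"

lemma Rep_lprod: "Rep_bialg (lprod vs) = tensor (wedge_list vs) ext_one"
  by (induction vs) (simp_all add: one_bialg.rep_eq times_bialg.rep_eq lft.rep_eq mult2_tensor)

lemma Rep_rprod: "Rep_bialg (rprod vs) = tensor ext_one (wedge_list vs)"
  by (induction vs) (simp_all add: one_bialg.rep_eq times_bialg.rep_eq rgt.rep_eq mult2_tensor)

lemma Rep_lprod_rprod: "Rep_bialg (lprod vs * rprod ws) = tensor (wedge_list vs) (wedge_list ws)"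
  by (simp add: times_bialg.rep_eq Rep_lprod Rep_rprod mult2_tensor)

text \<open>\<open>wedge\<close> has no ring type of its own; its associativity is borrowed from
  \<open>bialg\<close> by reading off coefficients at the empty left index set.\<close>

lemma wedge_list_snoc: "wedge_list (vs @ [v]) = wedge (wedge_list vs) (ext_vec v)"
proof -
  have "Rep_bialg (rprod (vs @ [v])) = Rep_bialg (rprod vs * rgt v)" by simp
  then have "tensor ext_one (wedge_list (vs @ [v])) = tensor ext_one (wedge (wedge_list vs) (ext_vec v))"
    unfolding times_bialg.rep_eq Rep_rprod rgt.rep_eq mult2_tensor wedge_ext_one_one .
  then have "tensor ext_one (wedge_list (vs @ [v])) {} J = tensor ext_one (wedge (wedge_list vs) (ext_vec v)) {} J" for J
    by simp
  then show ?thesis by (simp add: tensor_def ext_one_def fun_eq_iff)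
qed

lemma rprod_lft: "rprod ys * lft v = lft v * rprod ys"
proof (induction ys)
  case (Cons y ys)
  have "rprod (y # ys) * lft v = rgt y * (rprod ys * lft v)" by (simp add: mult.assoc)
  then show ?case using Cons.IH rgt_lft_left by (simp add: mult.assoc)
qed simp

text \<open>Passing from the list of dyads to the split product produces no sign because
  each \<open>lft\<close> commutes with each \<open>rgt\<close>.\<close>

lemma prod_dyads:
  "length vs = length ys \<Longrightarrow> prod_list (map2 dyad vs ys) = lprod vs * rprod ys"
proof (induction vs ys rule: list_induct2)
  case (Cons v vs y ys)
  then have "prod_list (map2 dyad (v # vs) (y # ys)) = lft v * (rgt y * (lprod vs * rprod ys))"
    by (simp add: dyad_def mult.assoc)
  also have "rgt y * (lprod vs * rprod ys) = lprod vs * (rgt y * rprod ys)"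
    by (induction vs) (simp_all add: mult.assoc rgt_lft_left)
  finally show ?case by (simp add: mult.assoc)
qed simp

subsection \<open>Compound matrices as elementary symmetric functions of dyads\<close>

definition basis_vec :: "nat \<Rightarrow> nat \<Rightarrow> 'a::zero_neq_one" where
  "basis_vec k = (\<lambda>i. if i = k then 1 else 0)"

lift_definition Lam :: "nat \<Rightarrow> nat \<Rightarrow> (nat \<Rightarrow> nat \<Rightarrow> 'a::comm_ring_1) \<Rightarrow> 'a bialg" is Lambda
  by (auto simp: Lambda_def tsub_def wedge_list_infinite finite_subset split: if_splits)
     (metis wedge_list_infinite)

text \<open>The ring is not commutative, so the recursion fixes an order of the factors; symmetry is
  available only for commuting entries such as dyads.\<close>

fun esym :: "nat \<Rightarrow> 'r::ring_1 list \<Rightarrow> 'r" where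
  "esym 0 bs = 1"
| "esym (Suc t) [] = 0"
| "esym (Suc t) (b # bs) = esym (Suc t) bs + b * esym t bs"

lemma tsub_0 [simp]: "tsub m 0 = {{}}"
  by (auto simp: tsub_def dest: finite_subset[OF _ finite_lessThan])

lemma tsub_less [simp]:
  assumes "m < t" shows "tsub m t = {}"
proof -
  have "I \<notin> tsub m t" for I
    using card_mono[of "{..<m}" I] assms by (auto simp: tsub_def)
  then show ?thesis by blast
qed

lemma Lam_0 [simp]: "Lam m 0 A = 1"
  by transfer (auto simp: Lambda_def tensor_def ext_one_def fun_eq_iff)

lemma Lam_none [simp]: "Lam 0 (Suc t) A = 0"
  by transfer (simp add: Lambda_def)

lemma sorted_list_of_set_snoc:
  assumes "I \<subseteq> {..<m::nat}"
  shows "sorted_list_of_set (insert m I) = sorted_list_of_set I @ [m]"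
proof -
  have "finite I" by (rule finite_subset[OF assms]) simp
  moreover have "m \<notin> I" using assms by auto
  moreover have "sorted_wrt (<) (sorted_list_of_set I @ [m])"
    using assms \<open>finite I\<close> by (auto simp: sorted_wrt_append)
  ultimately show ?thesis
    using sorted_list_of_set_unique[of "insert m I" "sorted_list_of_set I @ [m]"]
    by (simp add: card_insert_if)
qed

text \<open>An index set either avoids \<open>m\<close> or has it as its largest element. In the
  latter case the column of \<open>m\<close> is the last wedge factor, so it splits off on the right
  without a sign.\<close>

lemma Lam_Suc: "Lam (Suc m) (Suc t) A = Lam m (Suc t) A + Lam m t A * dyad (basis_vec m) (\<lambda>j. A j m)"
proof -
  have "Rep_bialg (Lam (Suc m) (Suc t) A) I J =
        Rep_bialg (Lam m (Suc t) A + Lam m t A * dyad (basis_vec m) (\<lambda>j. A j m)) I J" for I J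
  proof (cases "finite I \<and> finite J")
    case False
    then show ?thesis by (metis Rep_bialg_infinite)
  next
    case True
    let ?c = "\<lambda>i j. A j i"
    have s: "ext_vec (basis_vec m) B = 0" if "B \<noteq> {m}" for B :: "nat set"
      using that by (auto simp: ext_vec_def basis_vec_def is_singleton_def)
    have "Rep_bialg (Lam m t A * dyad (basis_vec m) (?c m)) I J =
       (\<Sum>I1\<in>Pow I. if m \<in> I \<and> I1 = I - {m} then \<Sum>J1\<in>Pow J. shuffle_sign (I - {m}) {m} * shuffle_sign J1 (J - J1)
          * Lambda m t A (I - {m}) J1 * ext_vec (?c m) (J - J1) else 0)"
      unfolding times_bialg.rep_eq mult2_def Rep_dyad Lam.rep_eq
    proof (intro sum.cong refl)
      fix I1 assume "I1 \<in> Pow I"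
      then have "(m \<in> I \<and> I1 = I - {m}) \<longleftrightarrow> I - I1 = {m}" by blast
      moreover have "ext_vec (basis_vec m) {m} = (1::'a)" by (simp add: basis_vec_def)
      ultimately show "(\<Sum>J1\<in>Pow J. shuffle_sign I1 (I - I1) * shuffle_sign J1 (J - J1) * Lambda m t A I1 J1 *
          tensor (ext_vec (basis_vec m)) (ext_vec (?c m)) (I - I1) (J - J1)) =
         (if m \<in> I \<and> I1 = I - {m} then \<Sum>J1\<in>Pow J. shuffle_sign (I - {m}) {m} * shuffle_sign J1 (J - J1)
          * Lambda m t A (I - {m}) J1 * ext_vec (?c m) (J - J1) else 0)"
        by (auto simp: tensor_def s)
    qed
    also have "\<dots> = (if m \<in> I then shuffle_sign (I - {m}) {m} * (\<Sum>J1\<in>Pow J. shuffle_sign J1 (J - J1)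
          * Lambda m t A (I - {m}) J1 * ext_vec (?c m) (J - J1)) else 0)"
      using True by (cases "m \<in> I") (auto simp: sum_distrib_left mult_ac)
    also have "\<dots> = (if m \<in> I \<and> I - {m} \<in> tsub m t then wedge (wedge_list (map ?c (sorted_list_of_set (I - {m})))) (ext_vec (?c m)) J else 0)"
    proof -
      have "shuffle_sign (I - {m}) {m} = (1 :: 'a)" if "I - {m} \<in> tsub m t"
        using that by (intro shuffle_sign_less) (auto simp: tsub_def)
      then show ?thesis by (auto simp: wedge_def Lambda_def)
    qed
    also have "\<dots> = (if m \<in> I \<and> I - {m} \<in> tsub m t then wedge_list (map ?c (sorted_list_of_set I)) J else 0)"
      using sorted_list_of_set_snoc[of "I - {m}" m] by (auto simp: tsub_def wedge_list_snoc insert_absorb)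
    finally have 1: "Rep_bialg (Lam m t A * dyad (basis_vec m) (?c m)) I J = \<dots>" .
    have 2: "I \<in> tsub (Suc m) (Suc t) \<longleftrightarrow> I \<in> tsub m (Suc t) \<or> (m \<in> I \<and> I - {m} \<in> tsub m t)"
    proof (cases "m \<in> I")
      case mI: True
      then have "card I = Suc (card (I - {m}))" using True card.remove[of I m] by blast
      moreover have "I \<subseteq> {..<Suc m} \<longleftrightarrow> I - {m} \<subseteq> {..<m}" by (auto simp: lessThan_Suc)
      ultimately show ?thesis using mI by (auto simp: tsub_def)
    next
      case False
      then have "I \<subseteq> {..<Suc m} \<longleftrightarrow> I \<subseteq> {..<m}" by (auto simp: lessThan_Suc)
      then show ?thesis using False by (simp add: tsub_def)
    qed
    have 3: "\<not> (I \<in> tsub m (Suc t) \<and> m \<in> I)" by (auto simp: tsub_def)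
    show ?thesis unfolding plus_bialg.rep_eq 1 using 2 3 by (auto simp: Lam.rep_eq Lambda_def)
  qed
  then show ?thesis by (simp add: Rep_bialg_inject[symmetric] fun_eq_iff)
qed

lemma esym_commute:
  assumes "\<And>b. b \<in> set bs \<Longrightarrow> c * b = b * c"
  shows "c * esym t bs = esym t bs * c"
  using assms
proof (induction t bs rule: esym.induct)
  case (3 t b bs)
  have "c * (b * esym t bs) = b * (c * esym t bs)" using 3(3)[of b] by (simp add: mult.assoc[symmetric])
  also have "\<dots> = b * esym t bs * c" using 3 by (simp add: mult.assoc)
  finally show ?case using 3 by (simp add: algebra_simps)
qed simp_all

text \<open>\<open>Lam_Suc\<close> peels off the last column while \<open>esym\<close> peels off the
  head of the list, whence \<open>rev\<close>.\<close>

lemma Lam_eq_esym: "Lam m t A = esym t (map (\<lambda>i. dyad (basis_vec i) (\<lambda>j. A j i)) (rev [0..<m]))"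
proof (induction m arbitrary: t)
  case 0 then show ?case by (cases t) simp_all
next
  case (Suc m)
  show ?case
  proof (cases t)
    case (Suc t')
    show ?thesis unfolding Suc Lam_Suc Suc.IH
      by (simp, rule esym_commute[symmetric]) (auto simp: dyad_commute)
  qed simp
qed

lemma dyad_Lam: "dyad v y * Lam m t A = Lam m t A * dyad v y"
  unfolding Lam_eq_esym by (rule esym_commute) (auto simp: dyad_commute)

text \<open>The induction adds one column at a time, so \<open>a\<close> is cut off at
  \<open>m\<close>. The new part \<open>d\<close> shares \<open>y\<close> with \<open>b\<close> and
  the basis vector with \<open>c\<close>; hence \<open>b * d\<close> and \<open>d * c\<close>
  vanish, which removes the unwanted mixed terms.\<close>

lemma Lam_rank_one_update_trunc:
  "Lam m (Suc t) (\<lambda>j i. A j i + a i * y j) =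
   Lam m (Suc t) A + dyad (\<lambda>i. if i < m then a i else 0) y * Lam m t A"
proof (induction m arbitrary: t)
  case (Suc m)
  let ?A = "\<lambda>j i. A j i + a i * y j"
  define b c d where "b = dyad (\<lambda>i. if i < m then a i else 0) y"
    and "c = dyad (basis_vec m) (\<lambda>j. A j m)" and "d = dyad (\<lambda>i. a m * basis_vec m i) y"
  have bd: "dyad (\<lambda>i. if i < Suc m then a i else 0) y = b + d"
    unfolding b_def d_def dyad_add_left[symmetric]
    by (intro arg_cong[of _ _ "\<lambda>v. dyad v y"]) (auto simp: basis_vec_def less_Suc_eq)
  have cd: "dyad (basis_vec m) (\<lambda>j. ?A j m) = c + d"
    unfolding c_def d_def by (simp add: dyad_add_right dyad_scale_right dyad_scale_left)
  have z: "b * d = 0" "d * c = 0"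
    by (simp_all add: b_def c_def d_def dyad_scale_left scl_mult_left scl_mult_right)
  have d: "d * Lam m t A = Lam m t A * d" for t by (simp add: d_def dyad_Lam)
  have b: "b * Lam m t A = Lam m t A * b" for t by (simp add: b_def dyad_Lam)
  have IH: "Lam m (Suc t) ?A = Lam m (Suc t) A + b * Lam m t A" for t
    using Suc.IH[of t] by (simp add: b_def)
  show ?case
  proof (cases t)
    case 0
    show ?thesis unfolding bd cd Lam_Suc 0 IH c_def[symmetric] by (simp add: algebra_simps)
  next
    case (Suc t')
    have e: "b * (Lam m t' A * d) = 0" "d * (Lam m t' A * c) = 0"
      using b[of t'] d[of t'] z by (metis mult.assoc mult_zero_right)+
    show ?thesis unfolding bd cd Lam_Suc Suc IH c_def[symmetric]
      using e by (simp add: algebra_simps d)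
  qed
qed simp

lemma Lam_rank_one_update:
  assumes "a \<in> vecs m"
  shows "Lam m (Suc t) (\<lambda>j i. A j i + a i * y j) = Lam m (Suc t) A + dyad a y * Lam m t A"
proof -
  have "(\<lambda>i. if i < m then a i else 0) = a" using assms by (auto simp: vecs_def fun_eq_iff)
  then show ?thesis using Lam_rank_one_update_trunc[of m t A a y] by simp
qed

lemma esym_scale: "esym t (map (scl c) bs) = scl (c ^ t) (esym t bs)"
  by (induction t bs rule: esym.induct) (simp_all add: scl_mult_left scl_mult_right scl_add scl_scl mult_ac)

lemma Lam_scale: "Lam m t (\<lambda>j i. c * A j i) = scl (c ^ t) (Lam m t A)"
  unfolding Lam_eq_esym esym_scale[symmetric]
  by (intro arg_cong[of _ _ "esym t"]) (simp add: dyad_scale_right)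

lemma Lam_zero [simp]: "Lam m (Suc t) (\<lambda>j i. 0) = 0"
  by (induction m) (simp_all add: Lam_Suc)

section \<open>The closure: polynomial functions, elimination and places\<close>

subsection \<open>Polynomial functions\<close>

lemma polyfun_on_line:
  fixes f :: "'a::comm_ring_1 ext2 \<Rightarrow> 'a"
  assumes "polyfun f"
  shows "\<exists>p. \<forall>e. f (\<lambda>I J. a I J + e * b I J) = poly p e"
  using assms
proof induction
  case (pconst c)
  show ?case by (rule exI[of _ "[:c:]"]) simp
next
  case (pcoord I J)
  show ?case by (rule exI[of _ "[:a I J, b I J:]"]) simp
next
  case (padd f g)
  then show ?case by (metis poly_add)
next
  case (pmult f g)
  then show ?case by (metis poly_mult)
qed

lemma poly_infinite_zero:
  fixes p :: "'a::{idom, ring_char_0} poly"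
  assumes "\<And>e. e \<noteq> 0 \<Longrightarrow> poly p e = 0"
  shows "p = 0"
proof (rule ccontr)
  assume "p \<noteq> 0"
  then have "finite {e. poly p e = 0}" by (rule poly_roots_finite)
  moreover have "UNIV \<subseteq> insert 0 {e. poly p e = 0}" using assms by auto
  ultimately show False using infinite_UNIV_char_0 finite_subset by (metis finite_insert)
qed

text \<open>This ring stands in for a polynomial ring in the matrix entries. It has to be an
  integral domain, so that its fraction field can hold the generic matrix.\<close>

typedef (overloaded) 'a pfun = "{f :: 'a::comm_ring_1 ext2 \<Rightarrow> 'a. polyfun f}"
  using pconst by blast

setup_lifting type_definition_pfun

lemma polyfun_uminus: "polyfun f \<Longrightarrow> polyfun (\<lambda>z. - f z)"
  using pmult[OF pconst[of "- 1"]] by simp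

instantiation pfun :: (comm_ring_1) comm_ring_1
begin

lift_definition zero_pfun :: "'a pfun" is "\<lambda>_. 0" by (rule pconst)
lift_definition one_pfun :: "'a pfun" is "\<lambda>_. 1" by (rule pconst)
lift_definition plus_pfun :: "'a pfun \<Rightarrow> 'a pfun \<Rightarrow> 'a pfun" is "\<lambda>f g z. f z + g z" by (rule padd)
lift_definition times_pfun :: "'a pfun \<Rightarrow> 'a pfun \<Rightarrow> 'a pfun" is "\<lambda>f g z. f z * g z" by (rule pmult)
lift_definition uminus_pfun :: "'a pfun \<Rightarrow> 'a pfun" is "\<lambda>f z. - f z" by (rule polyfun_uminus)
lift_definition minus_pfun :: "'a pfun \<Rightarrow> 'a pfun \<Rightarrow> 'a pfun" is "\<lambda>f g z. f z - g z"
  using padd[OF _ polyfun_uminus] by simp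

instance
  by standard (transfer; simp add: algebra_simps fun_eq_iff)+

end

text \<open>Restrict two nonzero polynomial functions to the line through points where they do not vanish.\<close>

instance pfun :: (field_char_0) idom
proof
  fix F G :: "'a pfun"
  assume "F \<noteq> 0" "G \<noteq> 0"
  then show "F * G \<noteq> 0"
  proof (transfer, goal_cases)
    case (1 f g)
    obtain a b where ab: "f a \<noteq> 0" "g b \<noteq> 0" using 1 by (auto simp: fun_eq_iff)
    define l where "l e = (\<lambda>I J. a I J + e * (b I J - a I J))" for e
    obtain p where p: "\<And>e. f (l e) = poly p e"
      using polyfun_on_line[of f a "\<lambda>I J. b I J - a I J"] 1 unfolding l_def by metis
    obtain q where q: "\<And>e. g (l e) = poly q e"
      using polyfun_on_line[of g a "\<lambda>I J. b I J - a I J"] 1 unfolding l_def by metis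
    have "l 0 = a" "l 1 = b" by (simp_all add: l_def)
    then have "p \<noteq> 0" "q \<noteq> 0" using p[of 0] q[of 1] ab by auto
    then have "p * q \<noteq> 0" by simp
    then obtain e where "poly (p * q) e \<noteq> 0" using poly_infinite_zero by blast
    then have "f (l e) * g (l e) \<noteq> 0" by (simp add: p q)
    then show ?case by (auto dest: fun_cong[of _ _ "l e"])
  qed
qed

subsection \<open>Ring homomorphisms on subrings\<close>

text \<open>Three maps are transported through compounds in this way: the residue map of a place,
  evaluation at a matrix, and the embedding into the fraction field. The carrier is a set because
  the first is controlled only on a subring.\<close>

locale ring_hom_on =
  fixes R :: "'r::comm_ring_1 set" and h :: "'r \<Rightarrow> 's::comm_ring_1"
  assumes one_in: "1 \<in> R" and add_in: "x \<in> R \<Longrightarrow> y \<in> R \<Longrightarrow> x + y \<in> R"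
    and mult_in: "x \<in> R \<Longrightarrow> y \<in> R \<Longrightarrow> x * y \<in> R" and uminus_in: "x \<in> R \<Longrightarrow> - x \<in> R"
    and h_one: "h 1 = 1" and h_add: "x \<in> R \<Longrightarrow> y \<in> R \<Longrightarrow> h (x + y) = h x + h y"
    and h_mult: "x \<in> R \<Longrightarrow> y \<in> R \<Longrightarrow> h (x * y) = h x * h y"
begin

lemma zero_in: "0 \<in> R" using add_in[OF one_in uminus_in[OF one_in]] by simp
lemma h_zero: "h 0 = 0" using h_add[OF zero_in zero_in] by simp
lemma h_uminus: "x \<in> R \<Longrightarrow> h (- x) = - h x"
  using h_add[OF _ uminus_in, of x x] h_zero by (simp add: eq_neg_iff_add_eq_0 add.commute)
lemma diff_in: "x \<in> R \<Longrightarrow> y \<in> R \<Longrightarrow> x - y \<in> R" using add_in[OF _ uminus_in, of x y] by simp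
lemma h_diff: "x \<in> R \<Longrightarrow> y \<in> R \<Longrightarrow> h (x - y) = h x - h y"
  using h_add[OF _ uminus_in, of x y] h_uminus by simp

lemma sum_in: "(\<And>i. i \<in> S \<Longrightarrow> f i \<in> R) \<Longrightarrow> sum f S \<in> R"
  by (induction S rule: infinite_finite_induct) (auto simp: zero_in add_in)
lemma h_sum: "(\<And>i. i \<in> S \<Longrightarrow> f i \<in> R) \<Longrightarrow> h (sum f S) = (\<Sum>i\<in>S. h (f i))"
  by (induction S rule: infinite_finite_induct) (auto simp: h_zero h_add sum_in)

lemma sign_in: "shuffle_sign A B \<in> R" and h_sign: "h (shuffle_sign A B) = shuffle_sign A B"
proof -
  have "(- 1) ^ k \<in> R \<and> h ((- 1) ^ k) = (- 1) ^ k" for k :: nat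
    by (induction k) (auto simp: one_in h_one uminus_in h_uminus)
  then show "shuffle_sign A B \<in> R" "h (shuffle_sign A B) = shuffle_sign A B"
    by (auto simp: shuffle_sign_def)
qed

lemmas closed = zero_in one_in add_in mult_in uminus_in diff_in sign_in
lemmas homs = h_zero h_one h_add h_mult h_uminus h_diff h_sign

lemma wedge_in:
  assumes "\<And>I. u I \<in> R" "\<And>I. v I \<in> R"
  shows "wedge u v I \<in> R" "h (wedge u v I) = wedge (\<lambda>I. h (u I)) (\<lambda>I. h (v I)) I"
  using assms by (auto simp: wedge_def h_sum closed homs intro!: sum_in sum.cong)

lemma ext_vec_in: "(\<And>i. v i \<in> R) \<Longrightarrow> ext_vec v I \<in> R" "h (ext_vec v I) = ext_vec (\<lambda>i. h (v i)) I"
  by (auto simp: ext_vec_def closed homs)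

lemma wedge_list_in:
  assumes "\<And>v i. v \<in> set vs \<Longrightarrow> v i \<in> R"
  shows "wedge_list vs I \<in> R \<and> h (wedge_list vs I) = wedge_list (map (\<lambda>v i. h (v i)) vs) I"
  using assms
proof (induction vs arbitrary: I)
  case Nil
  then show ?case by (auto simp: ext_one_def closed homs)
next
  case (Cons v vs)
  then have "\<And>I. wedge_list vs I \<in> R" "\<And>I. h (wedge_list vs I) = wedge_list (map (\<lambda>v i. h (v i)) vs) I"
    "\<And>I. ext_vec v I \<in> R" by (auto intro: ext_vec_in)
  then show ?case using wedge_in[of "ext_vec v" "wedge_list vs" I] by (simp add: ext_vec_in)
qed

lemma Lambda_in:
  assumes "\<And>i j. A j i \<in> R"
  shows "Lambda m t A I J \<in> R" "h (Lambda m t A I J) = Lambda m t (\<lambda>j i. h (A j i)) I J"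
proof -
  let ?vs = "map (\<lambda>i j. A j i) (sorted_list_of_set I)"
  have "map (\<lambda>v i. h (v i)) ?vs = map (\<lambda>i j. h (A j i)) (sorted_list_of_set I)" by simp
  then have "wedge_list ?vs J \<in> R \<and> h (wedge_list ?vs J) = wedge_list (map (\<lambda>i j. h (A j i)) (sorted_list_of_set I)) J"
    using wedge_list_in[of ?vs J] assms by (auto simp: comp_def)
  then show "Lambda m t A I J \<in> R" "h (Lambda m t A I J) = Lambda m t (\<lambda>j i. h (A j i)) I J"
    by (auto simp: Lambda_def closed homs)
qed

lemma dyad_mult_in:
  assumes "\<And>i. a i \<in> R" "\<And>j. y j \<in> R" "\<And>I J. z I J \<in> R"
  shows "mult2 (tensor (ext_vec a) (ext_vec y)) z I J \<in> R"
    "h (mult2 (tensor (ext_vec a) (ext_vec y)) z I J) =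
     mult2 (tensor (ext_vec (\<lambda>i. h (a i))) (ext_vec (\<lambda>j. h (y j)))) (\<lambda>I J. h (z I J)) I J"
proof -
  have "mult2 (tensor (ext_vec a) (ext_vec y)) z I J \<in> R \<and>
    h (mult2 (tensor (ext_vec a) (ext_vec y)) z I J) =
     mult2 (tensor (ext_vec (\<lambda>i. h (a i))) (ext_vec (\<lambda>j. h (y j)))) (\<lambda>I J. h (z I J)) I J"
  proof (cases "finite I \<and> finite J")
    case False then show ?thesis by (auto simp: mult2_infinite closed homs)
  next
    case True
    then show ?thesis using assms by (simp add: mult2_dyad h_sum sum_in closed homs)
  qed
  then show "mult2 (tensor (ext_vec a) (ext_vec y)) z I J \<in> R"
    "h (mult2 (tensor (ext_vec a) (ext_vec y)) z I J) =
     mult2 (tensor (ext_vec (\<lambda>i. h (a i))) (ext_vec (\<lambda>j. h (y j)))) (\<lambda>I J. h (z I J)) I J" by auto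
qed

end

subsection \<open>Laplace expansion and elimination of a pivot\<close>

lemma Lambda_finite: "Lambda m t A I J \<noteq> 0 \<Longrightarrow> finite I \<and> finite J"
  using Lam.rep_eq Rep_bialg_infinite by metis

lemma Lambda_eq_0: "I \<notin> tsub m t \<Longrightarrow> Lambda m t A I J = 0"
  by (simp add: Lambda_def)

text \<open>The least element of \<open>I\<close> supplies the first wedge factor, so only the row
  side contributes signs.\<close>

lemma Lambda_Laplace:
  assumes "I \<in> tsub m (Suc t)" "finite J"
  shows "Lambda m (Suc t) A I J =
    (\<Sum>j\<in>J. shuffle_sign {j} (J - {j}) * A j (Min I) * Lambda m t A (I - {Min I}) (J - {j}))"
proof -
  have I: "finite I" "I \<noteq> {}" "card I = Suc t" "I \<subseteq> {..<m}"
    using assms(1) by (auto simp: tsub_def intro: finite_subset[OF _ finite_lessThan])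
  have "I - {Min I} \<in> tsub m t" using I by (auto simp: tsub_def card_Diff_singleton)
  moreover have "sorted_list_of_set I = Min I # sorted_list_of_set (I - {Min I})"
    using I sorted_list_of_set_nonempty by blast
  ultimately show ?thesis using assms by (simp add: Lambda_def wedge_ext_vec)
qed

lemma wedge_list_support:
  "wedge_list vs J \<noteq> 0 \<Longrightarrow> j \<in> J \<Longrightarrow> \<exists>v\<in>set vs. v j \<noteq> 0"
proof (induction vs arbitrary: J)
  case (Cons v vs)
  have f: "finite J" using Cons.prems(1) wedge_list_infinite by blast
  obtain i where i: "i \<in> J" "v i \<noteq> 0" "wedge_list vs (J - {i}) \<noteq> 0"
    using Cons.prems(1) unfolding wedge_list_Cons wedge_ext_vec[OF f]
    by (metis (no_types, lifting) mult_zero_left mult_zero_right sum.neutral)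
  show ?case
  proof (cases "i = j")
    case False
    then show ?thesis using Cons.IH[OF i(3)] Cons.prems(2) by auto
  qed (use i in auto)
qed (simp add: ext_one_def split: if_splits)

lemma wedge_list_zero: "(\<lambda>_. 0) \<in> set vs \<Longrightarrow> wedge_list vs J = 0"
proof (induction vs arbitrary: J)
  case (Cons v vs)
  then show ?case by (cases "finite J") (auto simp: wedge_infinite wedge_ext_vec)
qed simp

lemma Lambda_zero_column: "(\<And>j. A j i = 0) \<Longrightarrow> i \<in> I \<Longrightarrow> Lambda m t A I J = 0"
proof (cases "I \<in> tsub m t")
  case True
  assume "\<And>j. A j i = 0" and "i \<in> I"
  moreover have "finite I" using True by (auto simp: tsub_def intro: finite_subset[OF _ finite_lessThan])
  ultimately have "(\<lambda>_. 0) \<in> set (map (\<lambda>i j. A j i) (sorted_list_of_set I))" by force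
  then show ?thesis by (simp only: Lambda_def wedge_list_zero if_cancel)
qed (simp add: Lambda_eq_0)

lemma Lambda_zero_row: "(\<And>i. A j i = 0) \<Longrightarrow> j \<in> J \<Longrightarrow> Lambda m t A I J = 0"
  unfolding Lambda_def using wedge_list_support by fastforce

text \<open>One step of Gaussian elimination: the Schur complement of the pivot, padded by a zero
  row and column. Keeping the format makes it a rank-one update, to which
  \<open>Lam_rank_one_update\<close> applies.\<close>

definition reduce :: "nat \<Rightarrow> nat \<Rightarrow> (nat \<Rightarrow> nat \<Rightarrow> 'a::field) \<Rightarrow> nat \<Rightarrow> nat \<Rightarrow> 'a" where
  "reduce j0 i0 A = (\<lambda>j i. A j i - A j0 i * (A j i0 / A j0 i0))"

lemma reduce_zero:
  "A j0 i0 \<noteq> 0 \<Longrightarrow> reduce j0 i0 A j0 i = 0" "A j0 i0 \<noteq> 0 \<Longrightarrow> reduce j0 i0 A j i0 = 0"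
  by (simp_all add: reduce_def)

lemma reduce_homs:
  assumes "A \<in> homs m n" shows "reduce j0 i0 A \<in> homs m n"
proof -
  have z: "\<And>j i. \<not> (j < n \<and> i < m) \<Longrightarrow> A j i = 0" using assms by (auto simp: homs_def)
  have "reduce j0 i0 A j i = 0" if "\<not> (j < n \<and> i < m)" for j i
    using z[of j i] z[of j0 i] z[of j i0] that by (auto simp: reduce_def)
  then show ?thesis by (auto simp: homs_def)
qed

lemma Lam_reduce:
  assumes "A \<in> homs m n"
  shows "Lam m (Suc t) A = Lam m (Suc t) (reduce j0 i0 A)
    + dyad (\<lambda>i. A j0 i) (\<lambda>j. A j i0 / A j0 i0) * Lam m t (reduce j0 i0 A)"
proof -
  have "(\<lambda>i. A j0 i) \<in> vecs m" using assms by (auto simp: homs_def vecs_def)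
  from Lam_rank_one_update[OF this, of t "reduce j0 i0 A" "\<lambda>j. A j i0 / A j0 i0"]
  show ?thesis by (simp add: reduce_def)
qed

text \<open>The pivot times a minor of the Schur complement is, up to sign, a minor of the matrix
  through the pivot. Hence bounds on the minors of order t+1 pass to order t. The first disjunct
  covers index sets that are infinite or meet the pivot row or column.\<close>

lemma Lambda_pivot:
  assumes A: "A \<in> homs m n" and u: "A j0 i0 \<noteq> 0"
  shows "A j0 i0 * Lambda m t (reduce j0 i0 A) I J = 0 \<or>
    A j0 i0 * Lambda m t (reduce j0 i0 A) I J = shuffle_sign {i0} I * shuffle_sign {j0} J *
      Lambda m (Suc t) A (insert i0 I) (insert j0 J)"
proof -
  let ?B = "reduce j0 i0 A" and ?I = "insert i0 I" and ?J = "insert j0 J"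
  let ?y = "\<lambda>j. A j i0 / A j0 i0"
  have z: "Lambda m t' ?B I' J' = 0" if "i0 \<in> I' \<or> j0 \<in> J'" for t' I' J'
    using that
  proof
    assume "i0 \<in> I'"
    then show ?thesis by (intro Lambda_zero_column[of _ i0]) (simp_all add: reduce_zero u)
  next
    assume "j0 \<in> J'"
    then show ?thesis by (intro Lambda_zero_row[of _ j0]) (simp_all add: reduce_zero u)
  qed
  show ?thesis
  proof (cases "i0 \<in> I \<or> j0 \<in> J \<or> infinite I \<or> infinite J")
    case True
    then have "Lambda m t ?B I J = 0" using z[of I J t] Lambda_finite[of m t ?B I J] by blast
    then show ?thesis by simp
  next
    case False
    have f: "finite ?I" "finite ?J" using False by auto
    have "Rep_bialg (Lam m (Suc t) A) ?I ?J = Rep_bialg (dyad (\<lambda>i. A j0 i) ?y * Lam m t ?B) ?I ?J"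
      unfolding Lam_reduce[OF A, of t j0 i0] plus_bialg.rep_eq by (simp add: Lam.rep_eq z)
    also have "\<dots> = (\<Sum>i\<in>?I. \<Sum>j\<in>?J. shuffle_sign {i} (?I - {i}) * shuffle_sign {j} (?J - {j}) *
        (A j0 i * ?y j) * Lambda m t ?B (?I - {i}) (?J - {j}))"
      unfolding times_bialg.rep_eq Rep_dyad Lam.rep_eq by (rule mult2_dyad[OF f])
    \<comment> \<open>Removing any other pair of indices leaves the pivot row or column, where the
      reduced matrix is zero; a single term survives.\<close>
    also have "\<dots> = (\<Sum>i\<in>?I. \<Sum>j\<in>?J. if j = j0 then if i = i0 then
        shuffle_sign {i0} I * shuffle_sign {j0} J * A j0 i0 * Lambda m t ?B I J else 0 else 0)"
    proof (intro sum.cong refl)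
      fix i j
      have "?I - {i0} = I" "?J - {j0} = J" using False by auto
      moreover have "Lambda m t ?B (?I - {i}) (?J - {j}) = 0" if "i \<noteq> i0 \<or> j \<noteq> j0"
        using that by (intro z) auto
      ultimately show "shuffle_sign {i} (?I - {i}) * shuffle_sign {j} (?J - {j}) *
        (A j0 i * ?y j) * Lambda m t ?B (?I - {i}) (?J - {j}) =
        (if j = j0 then if i = i0 then shuffle_sign {i0} I * shuffle_sign {j0} J *
        A j0 i0 * Lambda m t ?B I J else 0 else 0)"
        using u by (cases "i = i0 \<and> j = j0") auto
    qed
    also have "\<dots> = shuffle_sign {i0} I * shuffle_sign {j0} J * A j0 i0 * Lambda m t ?B I J"
      using f by (simp only: sum.delta) simp
    finally have "Lambda m (Suc t) A ?I ?J = shuffle_sign {i0} I * shuffle_sign {j0} J * A j0 i0 * Lambda m t ?B I J"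
      by (simp add: Lam.rep_eq)
    then have "shuffle_sign {i0} I * shuffle_sign {j0} J * Lambda m (Suc t) A ?I ?J =
      (shuffle_sign {i0} I * shuffle_sign {i0} I) * (shuffle_sign {j0} J * shuffle_sign {j0} J) * (A j0 i0 * Lambda m t ?B I J)"
      by (simp only: mult_ac)
    then show ?thesis by simp
  qed
qed

subsection \<open>Limits along a place\<close>

inductive degenerate :: "nat \<Rightarrow> nat \<Rightarrow> nat \<Rightarrow> 'a::comm_ring_1 bialg \<Rightarrow> bool" for m n where
  Lam: "A \<in> homs m n \<Longrightarrow> degenerate m n t (Lam m t A)"
| dyad: "degenerate m n t z \<Longrightarrow> a \<in> vecs m \<Longrightarrow> y \<in> vecs n \<Longrightarrow> degenerate m n (Suc t) (dyad a y * z)"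

text \<open>\<open>R\<close> is the valuation ring and \<open>h\<close> the residue map; \<open>h\<close> is only meaningful on \<open>R\<close>.\<close>

locale place = ring_hom_on R h for R :: "'l::field set" and h :: "'l \<Rightarrow> 'k::field" +
  assumes valuation: "x \<notin> R \<Longrightarrow> inverse x \<in> R \<and> h (inverse x) = 0"
begin

lemma unit_inverse: "x \<in> R \<Longrightarrow> h x \<noteq> 0 \<Longrightarrow> inverse x \<in> R"
  using valuation[of "inverse x"] by auto

lemma divides_total: "x / y \<in> R \<or> y / x \<in> R"
  using valuation[of "x / y"] by (auto simp: inverse_eq_divide)

text \<open>Divisibility orders the elements linearly by \<open>divides_total\<close>. Maximality is
  meant multiplicatively, as for an absolute value: all quotients by \<open>d\<close> are
  finite.\<close>

lemma max_valuation:
  assumes "finite S" "S \<noteq> {}" "0 \<notin> S"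
  shows "\<exists>d\<in>S. \<forall>e\<in>S. e / d \<in> R"
  using assms
proof (induction S rule: finite_ne_induct)
  case (singleton x)
  then show ?case by (simp add: one_in)
next
  case (insert x F)
  then obtain d where d: "d \<in> F" "\<forall>e\<in>F. e / d \<in> R" by auto
  have nz: "d \<noteq> 0" "x \<noteq> 0" using d insert by auto
  show ?case
  proof (cases "x / d \<in> R")
    case True
    then show ?thesis using d by auto
  next
    case False
    then have dx: "d / x \<in> R" using divides_total by blast
    have "e / x \<in> R" if "e \<in> F" for e
      using mult_in[OF d(2)[rule_format, OF that] dx] nz by simp
    then show ?thesis using one_in nz by auto
  qed
qed

lemma pivot_in:
  assumes A: "A \<in> homs m n" and u: "A j0 i0 \<noteq> 0" and c: "\<And>I J. c * Lambda m (Suc t) A I J \<in> R"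
  shows "c * (A j0 i0 * Lambda m t (reduce j0 i0 A) I J) \<in> R"
proof -
  from Lambda_pivot[OF A u, of t I J] show ?thesis
  proof
    assume *: "A j0 i0 * Lambda m t (reduce j0 i0 A) I J = shuffle_sign {i0} I * shuffle_sign {j0} J *
      Lambda m (Suc t) A (insert i0 I) (insert j0 J)"
    have "shuffle_sign {i0} I * shuffle_sign {j0} J * (c * Lambda m (Suc t) A (insert i0 I) (insert j0 J)) \<in> R"
      by (intro closed c)
    then show ?thesis unfolding * by (simp only: mult_ac)
  qed (simp only: mult_zero_right zero_in)
qed

lemma Laplace_residue:
  assumes "\<And>i j. A j i \<in> R" "\<And>I J. c * Lambda m t A I J \<in> R"
    and "(\<forall>i j. h (A j i) = 0) \<or> (\<forall>I J. h (c * Lambda m t A I J) = 0)"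
  shows "c * Lambda m (Suc t) A I J \<in> R \<and> h (c * Lambda m (Suc t) A I J) = 0"
proof (cases "I \<in> tsub m (Suc t) \<and> finite J")
  case False
  then have "Lambda m (Suc t) A I J = 0" using Lambda_eq_0 Lambda_finite by blast
  then show ?thesis by (simp add: closed homs)
next
  case True
  have eq: "c * Lambda m (Suc t) A I J =
    (\<Sum>j\<in>J. shuffle_sign {j} (J - {j}) * A j (Min I) * (c * Lambda m t A (I - {Min I}) (J - {j})))"
    using True by (simp add: Lambda_Laplace sum_distrib_left mult_ac)
  show ?thesis unfolding eq using assms by (auto simp: h_sum closed homs intro!: sum_in sum.neutral)
qed

text \<open>The divisibility argument for diagonal forms, carried out without one. If all entries
  have residue 0, one Laplace expansion suffices; otherwise eliminating a unit entry lowers the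
  order of the minors, and both terms of the rank-one update have residue 0.\<close>

lemma residue_zero:
  assumes "A \<in> homs m n" "\<And>i j. A j i \<in> R" "c \<notin> R" "\<And>I J. c * Lambda m t A I J \<in> R"
  shows "c * Lambda m (Suc t) A I J \<in> R \<and> h (c * Lambda m (Suc t) A I J) = 0"
  using assms
proof (induction t arbitrary: A I J)
  case 0
  have "Lambda m 0 A {} {} = 1" by (simp add: Lambda_def ext_one_def)
  then have "c \<in> R" using "0.prems"(4)[of "{}" "{}"] by simp
  then show ?case using 0 by blast
next
  case (Suc t)
  show ?case
  proof (cases "\<forall>i j. h (A j i) = 0")
    case True
    then show ?thesis using Laplace_residue[of A c m "Suc t" I J] Suc.prems by blast
  next
    case False
    \<comment> \<open>A pivot of nonzero residue is a unit, so elimination stays inside the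
      valuation ring, and dividing by the pivot keeps the bound from
      \<open>pivot_in\<close>.\<close>
    then obtain i0 j0 where u: "h (A j0 i0) \<noteq> 0" by blast
    then have u0: "A j0 i0 \<noteq> 0" using h_zero by auto
    have iu: "inverse (A j0 i0) \<in> R" using u Suc.prems(2) unit_inverse by blast
    let ?B = "reduce j0 i0 A" and ?y = "\<lambda>j. A j i0 / A j0 i0"
    have y: "?y j \<in> R" for j using mult_in[OF Suc.prems(2) iu] by (simp add: divide_inverse)
    have B: "?B j i \<in> R" for i j unfolding reduce_def by (intro closed Suc.prems y)
    have cB: "c * Lambda m t ?B I J \<in> R" for I J
      using mult_in[OF pivot_in[OF Suc.prems(1) u0 Suc.prems(4), of I J] iu] u0 by (simp add: field_simps)
    have IH: "c * Lambda m (Suc t) ?B I J \<in> R \<and> h (c * Lambda m (Suc t) ?B I J) = 0" for I J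
      by (rule Suc.IH[OF reduce_homs[OF Suc.prems(1)] B Suc.prems(3) cB])
    have 1: "c * Lambda m (Suc (Suc t)) ?B I J \<in> R \<and> h (c * Lambda m (Suc (Suc t)) ?B I J) = 0"
      using Laplace_residue[of ?B c m "Suc t" I J] B IH by blast
    let ?z = "mult2 (tensor (ext_vec (\<lambda>i. A j0 i)) (ext_vec ?y)) (\<lambda>I J. c * Lambda m (Suc t) ?B I J) I J"
    have 2: "?z \<in> R" "h ?z = 0"
      using dyad_mult_in[of "\<lambda>i. A j0 i" ?y "\<lambda>I J. c * Lambda m (Suc t) ?B I J" I J] Suc.prems(2) y IH
      by (simp_all add: mult2_def)
    have "c * Lambda m (Suc (Suc t)) A I J = c * Rep_bialg (Lam m (Suc (Suc t)) A) I J"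
      by (simp add: Lam.rep_eq)
    also have "\<dots> = c * Lambda m (Suc (Suc t)) ?B I J + ?z"
      unfolding Lam_reduce[OF Suc.prems(1), of "Suc t" j0 i0]
      by (simp add: rep_eqs Rep_dyad Lam.rep_eq mult2_def sum_distrib_left algebra_simps)
    finally show ?thesis using 1 2 closed(3) homs(3) by simp
  qed
qed

end

text \<open>Divide \<open>A\<close> by an entry \<open>d\<close> of maximal valuation. If the new scalar \<open>c d\<^sup>t\<^sup>+\<^sup>1\<close> is integral, the
  limit is a compound; otherwise \<open>residue_zero\<close> kills all terms of the rank-one update except
  the multiple of the pivot dyad.\<close>

lemma (in place) scaled_Lambda_residue:
  assumes roots: "\<And>(c::'k) n. n > 0 \<Longrightarrow> \<exists>r. r ^ n = c"
  assumes "A \<in> homs m n" "\<And>I J. c * Lambda m (Suc t) A I J \<in> R"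
  shows "\<exists>z. degenerate m n (Suc t) z \<and> Rep_bialg z = (\<lambda>I J. h (c * Lambda m (Suc t) A I J))"
  using assms(2,3)
proof (induction t arbitrary: A c rule: less_induct)
  case (less t)
  show ?case
  proof (cases "\<exists>j i. A j i \<noteq> 0")
    case False
    then have "A = (\<lambda>j i. 0)" by auto
    then have "Lambda m (Suc t) A I J = 0" for I J
      using Lam_zero[of m t, where 'a = 'l] Lam.rep_eq by (metis zero_bialg.rep_eq)
    then have "Rep_bialg (Lam m (Suc t) (\<lambda>j i. 0)) = (\<lambda>I J. h (c * Lambda m (Suc t) A I J))"
      by (simp add: zero_bialg.rep_eq h_zero)
    moreover have "(\<lambda>j i. 0 :: 'k) \<in> homs m n" by (simp add: homs_def)
    ultimately show ?thesis using degenerate.Lam by blast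
  next
    case True
    let ?S = "{A j i | j i. A j i \<noteq> 0}"
    have "?S \<subseteq> (\<lambda>(j, i). A j i) ` ({..<n} \<times> {..<m})" using less.prems(1) by (auto simp: homs_def)
    then have "finite ?S" by (rule finite_subset) simp
    moreover have "?S \<noteq> {}" "0 \<notin> ?S" using True by auto
    ultimately obtain d where d: "d \<in> ?S" "\<forall>e\<in>?S. e / d \<in> R" using max_valuation by meson
    then obtain j0 i0 where d0: "d = A j0 i0" "d \<noteq> 0" by auto
    define B where "B = (\<lambda>j i. A j i / d)"
    define c' where "c' = c * d ^ Suc t"
    have BR: "B j i \<in> R" for j i using d(2) zero_in by (cases "A j i = 0") (auto simp: B_def)
    have B0: "B j0 i0 = 1" using d0 by (simp add: B_def)
    have Bh: "B \<in> homs m n" using less.prems(1) by (auto simp: homs_def B_def)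
    have "A = (\<lambda>j i. d * B j i)" using d0 by (simp add: B_def)
    then have LA: "Lam m (Suc t) A = scl (d ^ Suc t) (Lam m (Suc t) B)" by (simp only: Lam_scale)
    have cA: "c * Lambda m (Suc t) A I J = c' * Lambda m (Suc t) B I J" for I J
      unfolding Lam.rep_eq[symmetric] LA scl.rep_eq c'_def by (simp only: mult.assoc)
    have cB: "c' * Lambda m (Suc t) B I J \<in> R" for I J using less.prems(2)[of I J] by (simp only: cA)
    show ?thesis
    proof (cases "c' \<in> R")
      case True
      \<comment> \<open>The compound is homogeneous of degree t+1, so the residue of the scalar is
        absorbed into the matrix as a root.\<close>
      obtain r where r: "r ^ Suc t = h c'" using roots by blast
      let ?C = "\<lambda>j i. r * h (B j i)"
      have "?C \<in> homs m n" using Bh h_zero by (auto simp: homs_def) metis+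
      moreover have "Rep_bialg (Lam m (Suc t) ?C) = (\<lambda>I J. h (c * Lambda m (Suc t) A I J))"
        unfolding cA Lam_scale r scl.rep_eq Lam.rep_eq
        using Lambda_in[of B] BR True by (simp add: h_mult)
      ultimately show ?thesis using degenerate.Lam by blast
    next
      case False
      let ?B = "reduce j0 i0 B" and ?a = "\<lambda>i. B j0 i" and ?y = "\<lambda>j. B j i0 / B j0 i0"
      have y: "?y j \<in> R" for j using BR B0 by simp
      have B'R: "?B j i \<in> R" for i j unfolding reduce_def by (intro closed BR y)
      have cB': "c' * Lambda m t ?B I J \<in> R" for I J
        using pivot_in[OF Bh _ cB, of j0 i0 I J] B0 by simp
      \<comment> \<open>At order 0 the compound is 1, and boundedness would put \<open>c'\<close>
        itself into \<open>R\<close>.\<close>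
      have "t \<noteq> 0"
      proof
        assume "t = 0"
        then have "Lambda m t ?B {} {} = 1" by (simp add: Lambda_def ext_one_def)
        then show False using cB'[of "{}" "{}"] False by simp
      qed
      then obtain t' where t': "t = Suc t'" using not0_implies_Suc by blast
      \<comment> \<open>The scalar passes to the lower order unchanged, although it is not finite;
        this is why the induction is over all scalars.\<close>
      obtain z where z: "degenerate m n t z" "Rep_bialg z = (\<lambda>I J. h (c' * Lambda m t ?B I J))"
        using less.IH[of t' ?B c'] reduce_homs[OF Bh] cB' unfolding t' by blast
      have res: "c' * Lambda m (Suc t) ?B I J \<in> R \<and> h (c' * Lambda m (Suc t) ?B I J) = 0" for I J
        by (rule residue_zero[OF reduce_homs[OF Bh] B'R False cB'])
      let ?w = "\<lambda>I J. mult2 (tensor (ext_vec ?a) (ext_vec ?y)) (\<lambda>I J. c' * Lambda m t ?B I J) I J"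
      have w: "?w I J \<in> R" "h (?w I J) = Rep_bialg (dyad (\<lambda>i. h (?a i)) (\<lambda>j. h (?y j)) * z) I J" for I J
        using dyad_mult_in[of ?a ?y "\<lambda>I J. c' * Lambda m t ?B I J" I J] BR y cB' z(2)
        by (simp_all add: times_bialg.rep_eq Rep_dyad)
      have "c * Lambda m (Suc t) A I J = c' * Rep_bialg (Lam m (Suc t) B) I J" for I J
        by (simp add: cA Lam.rep_eq)
      also have "\<dots> I J = c' * Lambda m (Suc t) ?B I J + ?w I J" for I J
        unfolding Lam_reduce[OF Bh, of t j0 i0]
        by (simp add: rep_eqs Rep_dyad Lam.rep_eq mult2_def sum_distrib_left algebra_simps)
      finally have "h (c * Lambda m (Suc t) A I J) = Rep_bialg (dyad (\<lambda>i. h (?a i)) (\<lambda>j. h (?y j)) * z) I J" for I J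
        using res[of I J] w[of I J] by (simp add: h_add)
      moreover have "(\<lambda>i. h (?a i)) \<in> vecs m" "(\<lambda>j. h (?y j)) \<in> vecs n"
        using Bh h_zero B0 by (auto simp: vecs_def homs_def) metis+
      ultimately show ?thesis using degenerate.dyad[OF z(1)] by (metis ext)
    qed
  qed
qed

subsection \<open>Existence of places\<close>

text \<open>A partial ring homomorphism is handled through its graph \<open>G\<close>; the last condition of
  \<open>preplace\<close> says that the graph is single-valued.\<close>

definition preplace :: "('l::field \<times> 'k::field) set \<Rightarrow> bool" where
  "preplace G \<longleftrightarrow> (1, 1) \<in> G \<and> (\<forall>x y x' y'. (x, y) \<in> G \<longrightarrow> (x', y') \<in> G \<longrightarrow>
      (x + x', y + y') \<in> G \<and> (x * x', y * y') \<in> G) \<and> (\<forall>x y. (x, y) \<in> G \<longrightarrow> (- x, - y) \<in> G) \<and>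
      (\<forall>y. (0, y) \<in> G \<longrightarrow> y = 0)"

lemma preplace_Union_chain:
  assumes "C \<noteq> {}" "subset.chain {G'. preplace G' \<and> G \<subseteq> G'} C"
  shows "preplace (\<Union>C) \<and> G \<subseteq> \<Union>C"
proof -
  have C: "\<And>X. X \<in> C \<Longrightarrow> preplace X \<and> G \<subseteq> X"
    using assms(2) by (auto simp: subset.chain_def)
  have lin: "X \<subseteq> Y \<or> Y \<subseteq> X" if "X \<in> C" "Y \<in> C" for X Y
    using assms(2) that unfolding subset.chain_def by blast
  have two: "(x + x', y + y') \<in> \<Union>C \<and> (x * x', y * y') \<in> \<Union>C"
    if "(x, y) \<in> \<Union>C" "(x', y') \<in> \<Union>C" for x y x' y'
  proof -
    obtain X Y where "X \<in> C" "Y \<in> C" "(x, y) \<in> X" "(x', y') \<in> Y" using \<open>(x, y) \<in> \<Union>C\<close> \<open>(x', y') \<in> \<Union>C\<close> by blast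
    then obtain Z where "Z \<in> C" "(x, y) \<in> Z" "(x', y') \<in> Z" using lin[of X Y] by blast
    then show ?thesis using C[of Z] unfolding preplace_def by blast
  qed
  obtain X where "X \<in> C" using assms(1) by blast
  then have "(1, 1) \<in> \<Union>C" "G \<subseteq> \<Union>C" using C[of X] unfolding preplace_def by blast+
  moreover have "(- x, - y) \<in> \<Union>C" if "(x, y) \<in> \<Union>C" for x y
    using that C unfolding preplace_def by blast
  moreover have "y = 0" if "(0, y) \<in> \<Union>C" for y
    using that C unfolding preplace_def by blast
  ultimately show ?thesis using two unfolding preplace_def by blast
qed

locale max_preplace =
  fixes G :: "('l::field \<times> 'k::field) set"
  assumes pre: "preplace G"
    and maximal: "preplace G' \<Longrightarrow> G \<subseteq> G' \<Longrightarrow> G' = G"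
    and surj: "\<exists>l. (l, c) \<in> G"
    and closed_field: "degree (p :: 'k poly) > 0 \<Longrightarrow> \<exists>x. poly p x = 0"
begin

lemma G_one: "(1, 1) \<in> G"
  and G_add: "(x, y) \<in> G \<Longrightarrow> (x', y') \<in> G \<Longrightarrow> (x + x', y + y') \<in> G"
  and G_mult: "(x, y) \<in> G \<Longrightarrow> (x', y') \<in> G \<Longrightarrow> (x * x', y * y') \<in> G"
  and G_uminus: "(x, y) \<in> G \<Longrightarrow> (- x, - y) \<in> G"
  and G_single: "(0, y) \<in> G \<Longrightarrow> y = 0"
  using pre unfolding preplace_def by blast+

lemma G_zero: "(0, 0) \<in> G" using G_add[OF G_one G_uminus[OF G_one]] by simp
lemma G_diff: "(x, y) \<in> G \<Longrightarrow> (x', y') \<in> G \<Longrightarrow> (x - x', y - y') \<in> G"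
  using G_add[OF _ G_uminus, of x y x' y'] by simp
lemma G_unique: "(x, y) \<in> G \<Longrightarrow> (x, y') \<in> G \<Longrightarrow> y = y'"
  using G_single[of "y - y'"] G_diff[of x y x y'] by simp
lemma G_sum: "(\<And>i. i \<in> S \<Longrightarrow> (f i, g i) \<in> G) \<Longrightarrow> (sum f S, sum g S) \<in> G"
  by (induction S rule: infinite_finite_induct) (auto simp: G_zero G_add)

text \<open>Reduction of polynomials coefficient by coefficient. It is a relation because the domain
  of the partial homomorphism is not a type; \<open>surj\<close> guarantees that every polynomial
  over the residue field has a lift.\<close>

definition rel :: "'l poly \<Rightarrow> 'k poly \<Rightarrow> bool" where
  "rel P p \<longleftrightarrow> (\<forall>i. (coeff P i, coeff p i) \<in> G)"

lemma rel_add: "rel P p \<Longrightarrow> rel Q q \<Longrightarrow> rel (P + Q) (p + q)"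
  and rel_uminus: "rel P p \<Longrightarrow> rel (- P) (- p)"
  and rel_diff: "rel P p \<Longrightarrow> rel Q q \<Longrightarrow> rel (P - Q) (p - q)"
  and rel_mult: "rel P p \<Longrightarrow> rel Q q \<Longrightarrow> rel (P * Q) (p * q)"
  by (auto simp: rel_def coeff_mult intro!: G_add G_uminus G_diff G_sum G_mult)

lemma rel_pCons: "(a, b) \<in> G \<Longrightarrow> rel P p \<Longrightarrow> rel (pCons a P) (pCons b p)"
  by (auto simp: rel_def coeff_pCons split: nat.split)

lemma rel_zero: "rel 0 0"
  by (simp add: rel_def G_zero)

lemma rel_lift: "\<exists>Q. rel Q q"
proof (induction q)
  case (pCons c q)
  then show ?case using surj[of c] rel_pCons by blast
qed (use rel_zero in blast)

lemma rel_poly: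
  assumes "(x, y) \<in> G"
  shows "rel P p \<Longrightarrow> (poly P x, poly p y) \<in> G"
proof (induction P arbitrary: p)
  case 0
  then have "p = 0" using G_single by (auto simp: rel_def poly_eq_iff)
  then show ?case by (simp add: G_zero)
next
  case (pCons a P)
  obtain b q where p: "p = pCons b q" by (cases p)
  have "(a, b) \<in> G" "rel P q"
    using pCons.prems unfolding p rel_def by (metis coeff_pCons_0, metis coeff_pCons_Suc)
  then show ?case using pCons.IH assms by (simp add: p G_add G_mult)
qed

text \<open>If the homomorphism does not extend to \<open>x\<close>, then \<open>x\<close> satisfies a polynomial relation whose
  residue is the constant \<open>1\<close>. Such relations for \<open>x\<close> and for its inverse reduce each other's
  degree, so that \<open>x\<close> or its inverse lies in the domain.\<close>

definition obstruction :: "'l \<Rightarrow> 'l poly \<Rightarrow> bool" where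
  "obstruction x P \<longleftrightarrow> rel P 1 \<and> poly P x = 0"

text \<open>The reductions of all polynomial relations satisfied by \<open>x\<close> form an ideal
  \<open>J\<close> over the residue field. Unless 1 lies in \<open>J\<close>, its elements have a
  common root \<open>r\<close>, because the field is algebraically closed; sending \<open>x\<close>
  to \<open>r\<close> is then a single-valued extension, against maximality.\<close>

lemma extension:
  assumes "x \<notin> Domain G" shows "\<exists>P. obstruction x P"
proof (rule ccontr)
  assume no: "\<not> ?thesis"
  define J where "J = {p. \<exists>P. rel P p \<and> poly P x = 0}"
  have J_mult: "q * p \<in> J" if p: "p \<in> J" for p q
  proof -
    obtain P where "rel P p" "poly P x = 0" using p by (auto simp: J_def)
    moreover obtain Q where "rel Q q" using rel_lift by blast
    ultimately
    show ?thesis using rel_mult[of Q q P p] by (auto simp: J_def intro!: exI[of _ "Q * P"])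
  qed
  have J_diff: "p - q \<in> J" if "p \<in> J" "q \<in> J" for p q
  proof -
    obtain P Q where "rel P p" "poly P x = 0" "rel Q q" "poly Q x = 0" using \<open>p \<in> J\<close> \<open>q \<in> J\<close> by (auto simp: J_def)
    then show ?thesis using rel_diff[of P p Q q] by (auto simp: J_def intro!: exI[of _ "P - Q"])
  qed
  have pos: "degree p > 0" if "p \<in> J" "p \<noteq> 0" for p
  proof (rule ccontr)
    assume "\<not> degree p > 0"
    then have "degree p = 0" by simp
    then obtain c where c: "p = [:c:]" by (rule degree_eq_zeroE)
    then have "[:1 / c:] * p = 1" using \<open>p \<noteq> 0\<close> by (simp add: one_pCons)
    then have "1 \<in> J" using J_mult[OF \<open>p \<in> J\<close>, of "[:1 / c:]"] by simp
    then show False using no by (auto simp: J_def obstruction_def)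
  qed
  obtain r where r: "\<And>p. p \<in> J \<Longrightarrow> poly p r = 0"
  proof (cases "J \<subseteq> {0}")
    case True
    then have "\<And>p. p \<in> J \<Longrightarrow> poly p 0 = 0" by auto
    then show ?thesis by (rule that)
  next
    case False
    then obtain p where p: "p \<in> J" "p \<noteq> 0" "\<And>q. q \<in> J \<Longrightarrow> q \<noteq> 0 \<Longrightarrow> degree p \<le> degree q"
      using arg_min_nat_lemma[of "\<lambda>p. p \<in> J \<and> p \<noteq> 0" _ degree] by blast
    obtain r where "poly p r = 0" using closed_field pos[OF p(1,2)] by blast
    moreover have "p dvd q" if "q \<in> J" for q
    proof -
      have "q mod p = q - (q div p) * p" by (simp add: minus_div_mult_eq_mod)
      then have "q mod p \<in> J" using J_diff[OF that J_mult[OF p(1)]] by simp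
      moreover have "q mod p = 0 \<or> degree (q mod p) < degree p" using degree_mod_less[OF p(2)] by blast
      ultimately have "q mod p = 0" using p(3) by (metis not_le)
      then show ?thesis by (simp add: dvd_eq_mod_eq_0)
    qed
    ultimately have "poly q r = 0" if "q \<in> J" for q using that by (metis dvdE mult_zero_left poly_mult)
    then show ?thesis by (rule that)
  qed
  define G' where "G' = {(poly P x, poly p r) | P p. rel P p}"
  have G'I: "rel P p \<Longrightarrow> (poly P x, poly p r) \<in> G'" for P p by (auto simp: G'_def)
  have sub: "G \<subseteq> G'"
  proof (rule subrelI)
    fix a b assume "(a, b) \<in> G"
    then show "(a, b) \<in> G'" using G'I[OF rel_pCons[OF _ rel_zero, of a b]] by simp
  qed
  have "preplace G'"
    unfolding preplace_def
  proof (intro conjI allI impI)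
    show "(1, 1) \<in> G'" using sub G_one by blast
  next
    fix a b a' b' assume "(a, b) \<in> G'" "(a', b') \<in> G'"
    then obtain P p Q q where *: "rel P p" "rel Q q" "a = poly P x" "b = poly p r" "a' = poly Q x" "b' = poly q r"
      by (auto simp: G'_def)
    show "(a + a', b + b') \<in> G'" "(a * a', b * b') \<in> G'"
      using G'I[OF rel_add[OF *(1,2)]] G'I[OF rel_mult[OF *(1,2)]] * by simp_all
  next
    fix a b assume "(a, b) \<in> G'"
    then obtain P p where *: "rel P p" "a = poly P x" "b = poly p r" by (auto simp: G'_def)
    show "(- a, - b) \<in> G'" using G'I[OF rel_uminus[OF *(1)]] * by simp
  next
    fix b assume "(0, b) \<in> G'"
    then show "b = 0" using r by (auto simp: G'_def J_def)
  qed
  then have "G' = G" using maximal sub by blast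
  moreover have "(x, r) \<in> G'"
    using G'I[OF rel_pCons[OF G_zero rel_pCons[OF G_one rel_zero]]] by simp
  ultimately show False using assms by blast
qed

lemma obstruction_coeff: "obstruction x P \<Longrightarrow> (coeff P i, of_bool (i = 0)) \<in> G"
  by (simp add: obstruction_def rel_def)

lemma obstruction_degree: "obstruction x P \<Longrightarrow> degree P > 0"
proof (rule ccontr)
  assume *: "obstruction x P" "\<not> degree P > 0"
  then have "degree P = 0" by simp
  then obtain c where c: "P = [:c:]" by (rule degree_eq_zeroE)
  then have "c = 0" using *(1) by (simp add: obstruction_def)
  then have "(0, 1) \<in> G" using obstruction_coeff[OF *(1), of 0] c by simp
  then show False using G_single by fastforce
qed

text \<open>The domain is a local ring. An obstruction for \<open>inverse b\<close>, with its
  coefficients reversed, is a relation for \<open>b\<close> whose residue is a pure power of the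
  variable, so a power of \<open>y\<close> would vanish.\<close>

lemma inverse_in_Domain:
  assumes "(b, y) \<in> G" "y \<noteq> 0"
  shows "inverse b \<in> Domain G"
proof (rule ccontr)
  assume "inverse b \<notin> Domain G"
  then obtain P where P: "obstruction (inverse b) P" using extension by blast
  have b: "b \<noteq> 0" using assms G_single by auto
  have "(coeff (reflect_poly P) i, coeff (monom 1 (degree P)) i) \<in> G" for i
    using obstruction_coeff[OF P, of "degree P - i"] G_zero by (auto simp: coeff_reflect_poly)
  then have "(poly (reflect_poly P) b, poly (monom 1 (degree P)) y) \<in> G"
    by (intro rel_poly assms(1)) (simp add: rel_def)
  moreover have "poly (reflect_poly P) b = 0"
    using P b by (simp add: poly_reflect_poly_nz obstruction_def)
  ultimately have "y ^ degree P = 0" using G_single[of "y ^ degree P"] by (simp add: poly_monom)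
  then show False using assms(2) by simp
qed

text \<open>Chevalley's elimination step. \<open>S\<close>, the reversed and shifted
  \<open>Q\<close>, vanishes at \<open>x\<close>, has degree at most that of \<open>P\<close>, and
  has coefficient \<open>v\<close> there, so the top terms cancel in \<open>P'\<close>. The residues
  stay right because \<open>v\<close> has residue 1 and the leading coefficient \<open>c\<close> of
  \<open>P\<close> has residue 0.\<close>

lemma obstruction_reduce:
  assumes P: "obstruction x P" and Q: "obstruction (inverse x) Q" and x: "x \<noteq> 0"
    and le: "degree Q \<le> degree P"
  shows "\<exists>P'. obstruction x P' \<and> degree P' < degree P"
proof -
  let ?N = "degree P" and ?M = "degree Q"
  define v c where "v = coeff Q 0" and "c = coeff P ?N"
  define S where "S = monom 1 (?N - ?M) * reflect_poly Q"
  define P' where "P' = smult v P - smult c S"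
  have v: "(v, 1) \<in> G" using obstruction_coeff[OF Q, of 0] by (simp add: v_def)
  have c: "(c, 0) \<in> G" using obstruction_coeff[OF P, of ?N] obstruction_degree[OF P] by (simp add: c_def)
  have cS: "(c * coeff S i, 0) \<in> G" for i
  proof (cases "coeff S i = 0")
    case False
    then obtain k where "coeff S i = coeff Q k"
      by (auto simp: S_def coeff_monom_mult coeff_reflect_poly split: if_splits)
    then show ?thesis using G_mult[OF c obstruction_coeff[OF Q, of k]] by simp
  qed (simp add: G_zero)
  have "(coeff P' i, coeff 1 i) \<in> G" for i
    using G_diff[OF G_mult[OF v obstruction_coeff[OF P, of i]] cS[of i]] by (cases "i = 0") (simp_all add: P'_def)
  then have "rel P' 1" by (simp add: rel_def)
  moreover have "poly P' x = 0"
    using P Q x by (simp add: P'_def S_def obstruction_def poly_reflect_poly_nz)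
  moreover have "degree P' < ?N"
  proof -
    have "degree S \<le> (?N - ?M) + degree (reflect_poly Q)"
      unfolding S_def by (rule order_trans[OF degree_mult_le]) (simp add: degree_monom_eq)
    also have "\<dots> \<le> ?N" using degree_reflect_poly_le[of Q] le by simp
    finally have "degree P' \<le> ?N" unfolding P'_def
      by (intro degree_diff_le) (auto intro: order_trans[OF degree_smult_le])
    moreover have "coeff S ?N = v" using le by (simp add: S_def coeff_monom_mult coeff_reflect_poly v_def)
    then have "coeff P' ?N = 0" by (simp add: P'_def c_def)
    ultimately show ?thesis using obstruction_degree[OF P]
      by (metis le_neq_implies_less leading_coeff_0_iff degree_0 less_numeral_extra(3))
  qed
  ultimately show ?thesis by (auto simp: obstruction_def)
qed

lemma Domain_valuation:
  assumes "x \<notin> Domain G" shows "inverse x \<in> Domain G"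
proof (rule ccontr)
  assume "inverse x \<notin> Domain G"
  have min: "\<exists>P. obstruction z P \<and> (\<forall>Q. obstruction z Q \<longrightarrow> degree P \<le> degree Q)" if z: "z \<notin> Domain G" for z
    using extension[OF z] arg_min_nat_lemma[of "obstruction z" _ degree] by blast
  obtain P where P: "obstruction x P" "\<forall>Q. obstruction x Q \<longrightarrow> degree P \<le> degree Q" using min[OF assms] by blast
  obtain Q where Q: "obstruction (inverse x) Q" "\<forall>P. obstruction (inverse x) P \<longrightarrow> degree Q \<le> degree P"
    using min[OF \<open>inverse x \<notin> Domain G\<close>] by blast
  have x: "x \<noteq> 0" using assms G_zero by auto
  show False
  proof (cases "degree Q \<le> degree P")
    case True
    then show False using obstruction_reduce[OF P(1) Q(1) x] P(2) by (metis not_le)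
  next
    case False
    then show False using obstruction_reduce[of "inverse x" Q P] P(1) Q x by (metis inverse_inverse_eq inverse_nonzero_iff_nonzero linear not_le)
  qed
qed

definition residue :: "'l \<Rightarrow> 'k" where "residue x = (THE y. (x, y) \<in> G)"

lemma residue_eq: "(x, y) \<in> G \<Longrightarrow> residue x = y"
  unfolding residue_def using G_unique by blast

lemma residue_in: "x \<in> Domain G \<Longrightarrow> (x, residue x) \<in> G"
  using residue_eq by blast

lemma place: "place (Domain G) residue"
proof
  show "1 \<in> Domain G" using G_one by blast
  show "residue 1 = 1" using G_one residue_eq by blast
next
  fix x y assume *: "x \<in> Domain G" "y \<in> Domain G"
  note a = residue_in[OF *(1)] and b = residue_in[OF *(2)]
  show "x + y \<in> Domain G" "x * y \<in> Domain G" "residue (x + y) = residue x + residue y" "residue (x * y) = residue x * residue y"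
    using G_add[OF a b] G_mult[OF a b] residue_eq by blast+
next
  fix x assume "x \<in> Domain G"
  then show "- x \<in> Domain G" using G_uminus residue_in by blast
next
  fix x assume x: "x \<notin> Domain G"
  have "residue (inverse x) = 0"
    using inverse_in_Domain[OF residue_in[OF Domain_valuation[OF x]]] x by auto
  then show "inverse x \<in> Domain G \<and> residue (inverse x) = 0" using Domain_valuation[OF x] by blast
qed

end

lemma place_exists:
  fixes G :: "('l::field \<times> 'k::alg_closed_field) set"
  assumes "preplace G" "\<And>c. \<exists>l. (l, c) \<in> G"
  shows "\<exists>R h. place R h \<and> (\<forall>(x, y)\<in>G. x \<in> R \<and> h x = y)"
proof -
  let ?A = "{G'. preplace G' \<and> G \<subseteq> G'}"
  have "\<exists>M\<in>?A. \<forall>X\<in>?A. M \<subseteq> X \<longrightarrow> X = M"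
    by (rule subset_Zorn_nonempty) (use assms(1) preplace_Union_chain in blast)+
  then obtain M where M: "preplace M" "G \<subseteq> M" "\<And>X. preplace X \<Longrightarrow> M \<subseteq> X \<Longrightarrow> X = M"
    by (auto intro: order_trans)
  interpret max_preplace M
  proof
    show "preplace M" by (rule M)
    show "G' = M" if "preplace G'" "M \<subseteq> G'" for G' using that by (rule M)
    show "\<exists>l. (l, c) \<in> M" for c using M(2) assms(2)[of c] by blast
    show "\<exists>x. poly p x = 0" if "degree p > 0" for p :: "'k poly" using that by (rule alg_closed_imp_poly_has_root)
  qed
  have "\<forall>(x, y)\<in>G. x \<in> Domain M \<and> residue x = y" using M(2) residue_eq by blast
  then show ?thesis using place by blast
qed

subsection \<open>Points of the closure are degenerate\<close>

lift_definition cst :: "'a::comm_ring_1 \<Rightarrow> 'a pfun" is "\<lambda>c _. c" by (rule pconst)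
lift_definition coord :: "nat set \<Rightarrow> nat set \<Rightarrow> 'a::comm_ring_1 pfun" is "\<lambda>I J z. z I J" by (rule pcoord)

text \<open>The matrix entries are encoded as the coordinates indexed by pairs of singletons.\<close>

definition generic :: "nat \<Rightarrow> nat \<Rightarrow> nat \<Rightarrow> nat \<Rightarrow> 'a::comm_ring_1 pfun" where
  "generic m n = (\<lambda>j i. if j < n \<and> i < m then coord {i} {j} else 0)"

definition point :: "(nat \<Rightarrow> nat \<Rightarrow> 'a) \<Rightarrow> 'a ext2" where
  "point A = (\<lambda>I J. A (the_elem J) (the_elem I))"

lemma generic_point:
  assumes "A \<in> homs m n" shows "(\<lambda>j i. Rep_pfun (generic m n j i) (point A)) = A"
proof (intro ext)
  fix j i
  show "Rep_pfun (generic m n j i) (point A) = A j i"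
    using assms by (auto simp: generic_def coord.rep_eq zero_pfun.rep_eq point_def homs_def)
qed

lemma ring_hom_on_eval: "ring_hom_on UNIV (\<lambda>P. Rep_pfun P z)"
  by standard (simp_all add: one_pfun.rep_eq plus_pfun.rep_eq times_pfun.rep_eq)

lemma ring_hom_on_Fract: "ring_hom_on UNIV (\<lambda>P::'a::idom. Fract P 1)"
  by standard (simp_all add: One_fract_def)

lemma Xcomp_degenerate:
  fixes x :: "'a::{alg_closed_field, field_char_0} ext2"
  assumes x: "x \<in> Xcomp m n t"
  shows "\<exists>z. degenerate m n t z \<and> Rep_bialg z = x"
proof -
  \<comment> \<open>The graph sends \<open>f\<close>, evaluated at the generic compound, to
    \<open>f x\<close>. The element \<open>P\<close> representing the former is specified only by
    its values at matrices.\<close>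
  define G where "G = {(Fract P 1, f x) | P f. polyfun f \<and> (\<forall>A\<in>homs m n. Rep_pfun P (point A) = f (Lambda m t A))}"
  have GI: "(Fract P 1, f x) \<in> G" if "polyfun f" "\<And>A. A \<in> homs m n \<Longrightarrow> Rep_pfun P (point A) = f (Lambda m t A)" for P f
    using that by (auto simp: G_def)
  have const: "(Fract (cst c) 1, c) \<in> G" for c
    by (rule GI[OF pconst]) (simp add: cst.rep_eq)
  have "preplace G"
    unfolding preplace_def
  proof (intro conjI allI impI)
    have "cst 1 = (1 :: 'a pfun)" by transfer simp
    then show "(1, 1) \<in> G" using const[of 1] by (simp add: One_fract_def)
  next
    fix a b a' b' assume "(a, b) \<in> G" "(a', b') \<in> G"
    then obtain P f Q g where *: "polyfun f" "polyfun g" "a = Fract P 1" "b = f x" "a' = Fract Q 1" "b' = g x"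
      "\<And>A. A \<in> homs m n \<Longrightarrow> Rep_pfun P (point A) = f (Lambda m t A)"
      "\<And>A. A \<in> homs m n \<Longrightarrow> Rep_pfun Q (point A) = g (Lambda m t A)"
      unfolding G_def by blast
    have "(Fract (P + Q) 1, f x + g x) \<in> G" by (rule GI[OF padd[OF *(1,2)]]) (simp add: * plus_pfun.rep_eq)
    then show "(a + a', b + b') \<in> G" using * by simp
    have "(Fract (P * Q) 1, f x * g x) \<in> G" by (rule GI[OF pmult[OF *(1,2)]]) (simp add: * times_pfun.rep_eq)
    then show "(a * a', b * b') \<in> G" using * by simp
  next
    fix a b assume "(a, b) \<in> G"
    then obtain P f where *: "polyfun f" "a = Fract P 1" "b = f x"
      "\<And>A. A \<in> homs m n \<Longrightarrow> Rep_pfun P (point A) = f (Lambda m t A)"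
      unfolding G_def by blast
    have "(Fract (- P) 1, - f x) \<in> G" by (rule GI[OF polyfun_uminus[OF *(1)]]) (simp add: * uminus_pfun.rep_eq)
    then show "(- a, - b) \<in> G" using * by simp
  next
    fix b assume "(0, b) \<in> G"
    then obtain P f where *: "polyfun f" "0 = Fract P 1" "b = f x"
      "\<And>A. A \<in> homs m n \<Longrightarrow> Rep_pfun P (point A) = f (Lambda m t A)"
      unfolding G_def by blast
    \<comment> \<open>Single-valuedness is where membership in the closure enters: if
      \<open>P\<close> is 0, then \<open>f\<close> vanishes on all compounds and hence at
      \<open>x\<close>.\<close>
    have "P = 0" using *(2) by (simp add: Zero_fract_def eq_fract)
    then have "f (Lambda m t A) = 0" if "A \<in> homs m n" for A using *(4)[OF that] by (simp add: zero_pfun.rep_eq)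
    then show "b = 0" using x * unfolding Xcomp_def zariski_closure_def Ycomp_def by blast
  qed
  moreover have "\<exists>l. (l, c) \<in> G" for c using const by blast
  ultimately have "\<exists>R h. place R h \<and> (\<forall>(a, b)\<in>G. a \<in> R \<and> h a = b)" by (rule place_exists)
  then obtain R h where "place R h" and Rh: "\<forall>(a, b)\<in>G. a \<in> R \<and> h a = b" by blast
  interpret place R h by fact
  let ?X = "\<lambda>j i. Fract (generic m n j i) (1 :: 'a pfun)"
  have X: "?X \<in> homs m n" by (auto simp: homs_def generic_def Zero_fract_def)
  have gen: "(Fract (Lambda m t (generic m n) I J) 1, x I J) \<in> G" for I J
  proof (rule GI[OF pcoord])
    fix A :: "nat \<Rightarrow> nat \<Rightarrow> 'a" assume A: "A \<in> homs m n"
    show "Rep_pfun (Lambda m t (generic m n) I J) (point A) = Lambda m t A I J"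
      using ring_hom_on.Lambda_in(2)[OF ring_hom_on_eval[of "point A"], of "generic m n" m t I J]
      by (simp add: generic_point[OF A])
  qed
  have eq: "Fract (Lambda m t (generic m n) I J) 1 = Lambda m t ?X I J" for I J
    by (rule ring_hom_on.Lambda_in(2)[OF ring_hom_on_Fract]) simp
  have L: "Lambda m t ?X I J \<in> R" "h (Lambda m t ?X I J) = x I J" for I J
    using bspec[OF Rh gen[of I J]] unfolding eq by simp_all
  show ?thesis
  proof (cases t)
    \<comment> \<open>\<open>scaled_Lambda_residue\<close> starts at order 1; at order 0 the generic
      compound is the constant 1.\<close>
    case 0
    have "Rep_bialg (Lam m 0 (\<lambda>j i. 0 :: 'a)) I J = x I J" for I J
      using L[of I J] unfolding 0 Lam.rep_eq[symmetric] Lam_0 one_bialg.rep_eq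
      by (auto simp: tensor_apply ext_one_def h_one h_zero split: if_splits)
    moreover have "(\<lambda>j i. 0 :: 'a) \<in> homs m n" by (simp add: homs_def)
    ultimately show ?thesis unfolding 0 using degenerate.Lam[of _ m n 0] by (metis ext)
  next
    case (Suc t')
    have "\<exists>z. degenerate m n (Suc t') z \<and> Rep_bialg z = (\<lambda>I J. h (1 * Lambda m (Suc t') ?X I J))"
      by (rule scaled_Lambda_residue[OF _ X]) (use L nth_root_exists in \<open>auto simp: Suc\<close>)
    then show ?thesis using L by (simp add: Suc)
  qed
qed

subsection \<open>The closure is stable under multiplication by dyads\<close>

lemma polyfun_sum: "(\<And>i. i \<in> S \<Longrightarrow> polyfun (f i)) \<Longrightarrow> polyfun (\<lambda>z. \<Sum>i\<in>S. f i z)"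
  by (induction S rule: infinite_finite_induct) (auto intro: pconst padd)

lemma polyfun_compose:
  assumes "polyfun f" "\<And>I J. polyfun (\<lambda>z. T z I J)"
  shows "polyfun (\<lambda>z. f (T z))"
  using assms(1) by induction (auto intro: assms(2) pconst padd pmult)

lemma polyfun_mult2: "polyfun (\<lambda>z. mult2 w z I J)"
  unfolding mult2_def by (intro polyfun_sum pmult[OF pconst pcoord])

lemma card_wedge_list: "wedge_list vs J \<noteq> 0 \<Longrightarrow> card J = length vs"
proof (induction vs arbitrary: J)
  case (Cons v vs)
  have f: "finite J" using Cons.prems wedge_list_infinite by blast
  obtain i where i: "i \<in> J" "wedge_list vs (J - {i}) \<noteq> 0"
    using Cons.prems unfolding wedge_list_Cons wedge_ext_vec[OF f]
    by (metis (no_types, lifting) mult_zero_right sum.neutral)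
  then show ?case using Cons.IH[OF i(2)] card_Suc_Diff1[OF f i(1)] by simp
qed (simp add: ext_one_def split: if_splits)

lemma Lambda_hom_space:
  assumes "A \<in> homs m n" shows "Lambda m t A \<in> hom_space m n t"
proof -
  have "I \<in> tsub m t \<and> J \<in> tsub n t" if nz: "Lambda m t A I J \<noteq> 0" for I J
  proof -
    have I: "I \<in> tsub m t" using nz Lambda_eq_0 by blast
    then have "card J = card I" using nz card_wedge_list by (fastforce simp: Lambda_def)
    moreover have "j < n" if "j \<in> J" for j
      using Lambda_zero_row[of A j J m t I] nz that assms by (auto simp: homs_def)
    ultimately show ?thesis using I by (auto simp: tsub_def)
  qed
  then show ?thesis by (auto simp: hom_space_def)
qed

lemma Ycomp_subset_Xcomp: "Ycomp m n t \<subseteq> Xcomp m n t"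
  using Lambda_hom_space by (auto simp: Xcomp_def zariski_closure_def Ycomp_def)

lemma dyad_hom_space:
  assumes "a \<in> vecs m" "y \<in> vecs n" "z \<in> hom_space m n t"
  shows "mult2 (tensor (ext_vec a) (ext_vec y)) z \<in> hom_space m n (Suc t)"
proof -
  have "I \<in> tsub m (Suc t) \<and> J \<in> tsub n (Suc t)" if nz: "mult2 (tensor (ext_vec a) (ext_vec y)) z I J \<noteq> 0" for I J
  proof -
    have f: "finite I" "finite J" using nz mult2_infinite by blast+
    obtain i j where ij: "i \<in> I" "j \<in> J" "a i \<noteq> 0" "y j \<noteq> 0" "z (I - {i}) (J - {j}) \<noteq> 0"
      using nz unfolding mult2_dyad[OF f]
      by (smt (verit, best) mult_eq_0_iff mult_zero_left mult_zero_right sum.neutral)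
    then have "I - {i} \<in> tsub m t" "J - {j} \<in> tsub n t" "i < m" "j < n"
      using assms by (auto simp: hom_space_def vecs_def)
    then show ?thesis using ij f card_Suc_Diff1[OF f(1) ij(1)] card_Suc_Diff1[OF f(2) ij(2)]
      by (auto simp: tsub_def)
  qed
  then show ?thesis by (auto simp: hom_space_def)
qed

text \<open>Multiplication by a dyad is a polynomial map, so \<open>f\<close> composed with it is
  again a polynomial function and vanishes on the closure once it vanishes on compounds. Only these
  need the limit argument.\<close>

lemma Xcomp_dyad:
  fixes x :: "'a::field_char_0 ext2"
  assumes a: "a \<in> vecs m" and y: "y \<in> vecs n" and x: "x \<in> Xcomp m n t"
  shows "mult2 (tensor (ext_vec a) (ext_vec y)) x \<in> Xcomp m n (Suc t)"
proof -
  let ?T = "mult2 (tensor (ext_vec a) (ext_vec y))"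
  have "f (?T x) = 0" if f: "polyfun f" and van: "\<forall>z\<in>Ycomp m n (Suc t). f z = 0" for f
  proof -
    have "f (?T (Lambda m t A)) = 0" if A: "A \<in> homs m n" for A
    proof -
      obtain p where p: "\<And>e. f (\<lambda>I J. ?T (Lambda m t A) I J + e * Lambda m (Suc t) A I J) = poly p e"
        using polyfun_on_line[OF f] by metis
      \<comment> \<open>The deformation exists for nonzero \<open>e\<close> only and moves along the
        line with parameter \<open>e ^ Suc t\<close>. The field being infinite, a polynomial in
        \<open>e\<close> that vanishes at all nonzero scalars is zero, so it vanishes at 0 as
        well.\<close>
      have "poly (pcompose p (monom 1 (Suc t))) e = 0" if e: "e \<noteq> 0" for e
      proof -
        let ?A = "\<lambda>j i. e * A j i + (inverse e ^ t * a i) * y j"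
        have "a i = 0" if "\<not> i < m" for i using a that by (auto simp: vecs_def)
        moreover have "y j = 0" if "\<not> j < n" for j using y that by (auto simp: vecs_def)
        ultimately have "?A \<in> homs m n" using A by (fastforce simp: homs_def)
        then have "f (Lambda m (Suc t) ?A) = 0" using van by (auto simp: Ycomp_def)
        moreover have "(\<lambda>i. inverse e ^ t * a i) \<in> vecs m" using a by (auto simp: vecs_def)
        then have "Lam m (Suc t) ?A = scl (e ^ Suc t) (Lam m (Suc t) A) + dyad a y * Lam m t A"
          using e by (simp add: Lam_rank_one_update Lam_scale dyad_scale_left scl_mult_left scl_mult_right
              scl_scl power_mult_distrib[symmetric] del: power_inverse)
        then have "Lambda m (Suc t) ?A = (\<lambda>I J. ?T (Lambda m t A) I J + e ^ Suc t * Lambda m (Suc t) A I J)"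
          by (simp add: Lam.rep_eq[symmetric] rep_eqs Rep_dyad fun_eq_iff)
        ultimately show ?thesis using p[of "e ^ Suc t"] by (simp add: poly_pcompose poly_monom)
      qed
      then have "pcompose p (monom 1 (Suc t)) = 0" by (rule poly_infinite_zero)
      then have "poly (pcompose p (monom 1 (Suc t))) 0 = 0" by simp
      then show ?thesis using p[of 0] by (simp add: poly_pcompose poly_monom)
    qed
    moreover have "polyfun (\<lambda>z. f (?T z))" by (rule polyfun_compose[OF f polyfun_mult2])
    ultimately show ?thesis using x unfolding Xcomp_def zariski_closure_def Ycomp_def by blast
  qed
  moreover have "?T x \<in> hom_space m n (Suc t)"
    using dyad_hom_space[OF a y] x by (auto simp: Xcomp_def zariski_closure_def)
  ultimately show ?thesis by (auto simp: Xcomp_def zariski_closure_def)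
qed

lemma Xall_eq:
  "(Xall m n :: 'a::{alg_closed_field, field_char_0} ext2 set) =
   \<Inter>{S. Yall m n \<subseteq> S \<and> (\<forall>\<alpha>\<in>vecs m. \<forall>y\<in>vecs n. \<forall>z\<in>S. mult2 (tensor (ext_vec \<alpha>) (ext_vec y)) z \<in> S)}"
proof (rule equalityI[OF Inter_greatest Inter_lower])
  show "Xall m n \<in> {S. Yall m n \<subseteq> S \<and>
     (\<forall>\<alpha>\<in>vecs m. \<forall>y\<in>vecs n. \<forall>z\<in>S. mult2 (tensor (ext_vec \<alpha>) (ext_vec y)) (z :: 'a ext2) \<in> S)}"
  proof (intro CollectI conjI ballI)
    show "Yall m n \<subseteq> Xall m n" unfolding Xall_def Yall_def by (rule UN_mono) (use Ycomp_subset_Xcomp in auto)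
    fix \<alpha> y :: "nat \<Rightarrow> 'a" and z :: "'a ext2" assume "\<alpha> \<in> vecs m" "y \<in> vecs n" "z \<in> Xall m n"
    then show "mult2 (tensor (ext_vec \<alpha>) (ext_vec y)) z \<in> Xall m n"
      using Xcomp_dyad[of \<alpha> m y n z] unfolding Xall_def by blast
  qed
next
  fix S :: "'a ext2 set"
  assume "S \<in> {S. Yall m n \<subseteq> S \<and>
     (\<forall>\<alpha>\<in>vecs m. \<forall>y\<in>vecs n. \<forall>z\<in>S. mult2 (tensor (ext_vec \<alpha>) (ext_vec y)) z \<in> S)}"
  then have S: "Yall m n \<subseteq> S" "\<And>\<alpha> y z. \<alpha> \<in> vecs m \<Longrightarrow> y \<in> vecs n \<Longrightarrow> z \<in> S \<Longrightarrow>
     mult2 (tensor (ext_vec \<alpha>) (ext_vec y)) z \<in> S" by auto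
  have "Rep_bialg z \<in> S" if "degenerate m n t z" for t z
    using that
  proof induction
    case (Lam A t)
    then show ?case using S(1) by (auto simp: Yall_def Ycomp_def Lam.rep_eq)
  next
    case (dyad t z a y)
    then show ?case using S(2) by (simp add: times_bialg.rep_eq Rep_dyad)
  qed
  then show "Xall m n \<subseteq> S" using Xcomp_degenerate unfolding Xall_def by blast
qed

section \<open>Ranks: contraction, normal form, upper and lower bounds\<close>

subsection \<open>Contraction\<close>

definition pair :: "nat \<Rightarrow> (nat \<Rightarrow> 'a::comm_ring_1) \<Rightarrow> (nat \<Rightarrow> 'a) \<Rightarrow> 'a" where
  "pair m a u = (\<Sum>i<m. a i * u i)"

text \<open>Contraction of the left factor by \<open>u\<close>, written as the adjoint of wedging
  with \<open>u\<close> from the left (\<open>pairing_contr\<close>); the sign is the one that sorts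
  e_i wedge e_I.\<close>

lift_definition contr :: "nat \<Rightarrow> (nat \<Rightarrow> 'a::comm_ring_1) \<Rightarrow> 'a bialg \<Rightarrow> 'a bialg" is
  "\<lambda>m u z I J. \<Sum>i\<in>{..<m} - I. shuffle_sign {i} I * u i * z (insert i I) J"
  by (metis (no_types, lifting) finite_insert mult_zero_right sum.neutral)

lemma contr_add: "contr m u (x + y) = contr m u x + contr m u y"
  and contr_scl: "contr m u (scl c x) = scl c (contr m u x)"
  and contr_zero [simp]: "contr m u 0 = 0"
  by - (rule bialg_eqI, simp add: contr.rep_eq rep_eqs algebra_simps sum.distrib sum_subtractf sum_distrib_left)+

lemma contr_one [simp]: "contr m u 1 = 0"
  by (rule bialg_eqI) (simp add: contr.rep_eq rep_eqs tensor_apply ext_one_def)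

lemma Rep_lft_mult:
  assumes "finite I" "finite J"
  shows "Rep_bialg (lft a * z) I J = (\<Sum>k\<in>I. shuffle_sign {k} (I - {k}) * a k * Rep_bialg z (I - {k}) J)"
proof -
  have "Rep_bialg (lft a * z) I J = (\<Sum>I1\<in>Pow I. \<Sum>J1\<in>Pow J. if J1 = {} then
      shuffle_sign I1 (I - I1) * ext_vec a I1 * Rep_bialg z (I - I1) J else 0)"
    unfolding times_bialg.rep_eq lft.rep_eq mult2_def
    by (intro sum.cong refl) (auto simp: tensor_apply ext_one_def)
  also have "\<dots> = (\<Sum>I1\<in>Pow I. shuffle_sign I1 (I - I1) * ext_vec a I1 * Rep_bialg z (I - I1) J)"
    using assms by simp
  also have "\<dots> = (\<Sum>k\<in>I. shuffle_sign {k} (I - {k}) * a k * Rep_bialg z (I - {k}) J)"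
    by (subst sum_Pow_singletons[OF assms(1)]) (simp_all add: ext_vec_eq_0)
  finally show ?thesis .
qed

lemma Rep_rgt_mult:
  assumes "finite I" "finite J"
  shows "Rep_bialg (rgt y * z) I J = (\<Sum>k\<in>J. shuffle_sign {k} (J - {k}) * y k * Rep_bialg z I (J - {k}))"
proof -
  have "Rep_bialg (rgt y * z) I J = (\<Sum>I1\<in>Pow I. if I1 = {} then \<Sum>J1\<in>Pow J.
      shuffle_sign J1 (J - J1) * ext_vec y J1 * Rep_bialg z I (J - J1) else 0)"
    unfolding times_bialg.rep_eq rgt.rep_eq mult2_def
    by (intro sum.cong refl) (auto simp: tensor_apply ext_one_def)
  also have "\<dots> = (\<Sum>J1\<in>Pow J. shuffle_sign J1 (J - J1) * ext_vec y J1 * Rep_bialg z I (J - J1))"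
    using assms by simp
  also have "\<dots> = (\<Sum>k\<in>J. shuffle_sign {k} (J - {k}) * y k * Rep_bialg z I (J - {k}))"
    by (subst sum_Pow_singletons[OF assms(2)]) (simp_all add: ext_vec_eq_0)
  finally show ?thesis .
qed

lemma contr_rgt: "contr m u (rgt y * z) = rgt y * contr m u z"
proof (rule bialg_eqI)
  fix I J :: "nat set"
  show "Rep_bialg (contr m u (rgt y * z)) I J = Rep_bialg (rgt y * contr m u z) I J"
  proof (cases "finite I \<and> finite J")
    case False then show ?thesis by (metis Rep_bialg_infinite)
  next
    case True
    then have f: "finite I" "finite J" by auto
    have g: "finite (insert i I)" for i using f by simp
    show ?thesis unfolding Rep_rgt_mult[OF f] contr.rep_eq Rep_rgt_mult[OF g f(2)] sum_distrib_left
      by (subst sum.swap) (simp only: mult_ac)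
  qed
qed

lemma sign_exchange:
  assumes "finite I" "i \<notin> I" "k \<in> I"
  shows "shuffle_sign {i} I * shuffle_sign {k} (insert i (I - {k})) =
    - (shuffle_sign {k} (I - {k}) * shuffle_sign {i} (I - {k}) :: 'a::comm_ring_1)"
proof -
  have ik: "i \<noteq> k" using assms by auto
  have "shuffle_sign {i} ((I - {k}) \<union> {k}) = (shuffle_sign {i} (I - {k}) * shuffle_sign {i} {k} :: 'a)"
    by (rule shuffle_sign_Un_right) (use assms in auto)
  moreover have "(I - {k}) \<union> {k} = I" using assms by auto
  moreover have "shuffle_sign {k} ((I - {k}) \<union> {i}) = (shuffle_sign {k} (I - {k}) * shuffle_sign {k} {i} :: 'a)"
    by (rule shuffle_sign_Un_right) (use assms in auto)
  ultimately have "shuffle_sign {i} I * shuffle_sign {k} (insert i (I - {k})) =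
     (shuffle_sign {i} {k} * shuffle_sign {k} {i}) * (shuffle_sign {k} (I - {k}) * shuffle_sign {i} (I - {k}) :: 'a)"
    by (simp add: mult_ac)
  also have "shuffle_sign {i} {k} * shuffle_sign {k} {i} = (- 1 :: 'a)"
    by (subst shuffle_sign_swap_singletons[OF ik]) simp
  finally show ?thesis by simp
qed

text \<open>The antiderivation rule. The scalar \<open>pair m a u\<close> has two sources: indices
  outside \<open>I\<close> come from contracting the product, those in \<open>I\<close> from the
  subtracted term. The remaining double sums \<open>X\<close> cancel by
  \<open>sign_exchange\<close>.\<close>

lemma contr_lft: "contr m u (lft a * z) = scl (pair m a u) z - lft a * contr m u z"
proof (rule bialg_eqI)
  fix I J :: "nat set"
  show "Rep_bialg (contr m u (lft a * z)) I J = Rep_bialg (scl (pair m a u) z - lft a * contr m u z) I J"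
  proof (cases "finite I \<and> finite J")
    case False then show ?thesis by (metis Rep_bialg_infinite)
  next
    case True
    then have f: "finite I" "finite J" by auto
    let ?z = "\<lambda>I. Rep_bialg z I J"
    let ?N = "{..<m} - I"
    define X where "X = (\<Sum>i\<in>?N. \<Sum>k\<in>I. shuffle_sign {k} (I - {k}) * shuffle_sign {i} (I - {k}) * (u i * a k) * ?z (insert i (I - {k})))"
    have "Rep_bialg (contr m u (lft a * z)) I J = (\<Sum>i\<in>?N. shuffle_sign {i} I * u i *
        (\<Sum>k\<in>insert i I. shuffle_sign {k} (insert i I - {k}) * a k * ?z (insert i I - {k})))"
      unfolding contr.rep_eq by (intro sum.cong refl arg_cong2[of _ _ _ _ "(*)"] Rep_lft_mult) (use f in auto)
    also have "\<dots> = (\<Sum>i\<in>?N. a i * u i * ?z I -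
        (\<Sum>k\<in>I. shuffle_sign {k} (I - {k}) * shuffle_sign {i} (I - {k}) * (u i * a k) * ?z (insert i (I - {k}))))"
    proof (rule sum.cong[OF refl])
      fix i assume i: "i \<in> ?N"
      have "(\<Sum>k\<in>insert i I. shuffle_sign {k} (insert i I - {k}) * a k * ?z (insert i I - {k})) =
        shuffle_sign {i} I * a i * ?z I +
        (\<Sum>k\<in>I. shuffle_sign {k} (insert i (I - {k})) * a k * ?z (insert i (I - {k})))"
      proof -
        have "insert i I - {k} = insert i (I - {k})" if "k \<in> I" for k using i that by auto
        moreover have "insert i I - {i} = I" using i by auto
        ultimately show ?thesis using i f by simp
      qed
      moreover have "(\<Sum>k\<in>I. shuffle_sign {i} I * u i * (shuffle_sign {k} (insert i (I - {k})) * a k * ?z (insert i (I - {k})))) =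
        - (\<Sum>k\<in>I. shuffle_sign {k} (I - {k}) * shuffle_sign {i} (I - {k}) * (u i * a k) * ?z (insert i (I - {k})))"
        unfolding sum_negf[symmetric]
      proof (rule sum.cong[OF refl])
        fix k assume k: "k \<in> I"
        have "shuffle_sign {i} I * u i * (shuffle_sign {k} (insert i (I - {k})) * a k * ?z (insert i (I - {k}))) =
          (shuffle_sign {i} I * shuffle_sign {k} (insert i (I - {k}))) * ((u i * a k) * ?z (insert i (I - {k})))"
          by (simp only: mult_ac)
        also have "\<dots> = - (shuffle_sign {k} (I - {k}) * shuffle_sign {i} (I - {k}) * (u i * a k) * ?z (insert i (I - {k})))"
          by (subst sign_exchange[OF f(1) _ k]) (use i in \<open>simp_all add: mult_ac\<close>)
        finally show "shuffle_sign {i} I * u i * (shuffle_sign {k} (insert i (I - {k})) * a k * ?z (insert i (I - {k}))) =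
          - (shuffle_sign {k} (I - {k}) * shuffle_sign {i} (I - {k}) * (u i * a k) * ?z (insert i (I - {k})))" .
      qed
      moreover have "shuffle_sign {i} I * u i * (shuffle_sign {i} I * a i * ?z I) =
        (shuffle_sign {i} I * shuffle_sign {i} I) * (a i * u i * ?z I)" by (simp only: mult_ac)
      ultimately show "shuffle_sign {i} I * u i *
        (\<Sum>k\<in>insert i I. shuffle_sign {k} (insert i I - {k}) * a k * ?z (insert i I - {k})) = a i * u i * ?z I -
        (\<Sum>k\<in>I. shuffle_sign {k} (I - {k}) * shuffle_sign {i} (I - {k}) * (u i * a k) * ?z (insert i (I - {k})))"
        by (simp add: distrib_left sum_distrib_left)
    qed
    also have "\<dots> = (\<Sum>i\<in>?N. a i * u i) * ?z I - X"
      by (simp add: sum_subtractf sum_distrib_right X_def)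
    finally have L: "Rep_bialg (contr m u (lft a * z)) I J = (\<Sum>i\<in>?N. a i * u i) * ?z I - X" .
    have "Rep_bialg (lft a * contr m u z) I J = (\<Sum>k\<in>I. shuffle_sign {k} (I - {k}) * a k *
        (\<Sum>i\<in>{..<m} - (I - {k}). shuffle_sign {i} (I - {k}) * u i * ?z (insert i (I - {k}))))"
      unfolding Rep_lft_mult[OF f] contr.rep_eq ..
    also have "\<dots> = (\<Sum>k\<in>I. (if k < m then a k * u k * ?z I else 0) +
        (\<Sum>i\<in>?N. shuffle_sign {k} (I - {k}) * shuffle_sign {i} (I - {k}) * (u i * a k) * ?z (insert i (I - {k}))))"
    proof (rule sum.cong[OF refl])
      fix k assume k: "k \<in> I"
      let ?g = "\<lambda>i. shuffle_sign {i} (I - {k}) * u i * ?z (insert i (I - {k}))"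
      have "{..<m} - (I - {k}) = (if k < m then insert k ?N else ?N)" using k by auto
      then have "sum ?g ({..<m} - (I - {k})) = (if k < m then ?g k else 0) + sum ?g ?N" using k by simp
      moreover have "insert k (I - {k}) = I" using k by auto
      moreover have "shuffle_sign {k} (I - {k}) * a k * (shuffle_sign {k} (I - {k}) * u k * ?z I) =
        (shuffle_sign {k} (I - {k}) * shuffle_sign {k} (I - {k})) * (a k * u k * ?z I)" by (simp only: mult_ac)
      ultimately show "shuffle_sign {k} (I - {k}) * a k * sum ?g ({..<m} - (I - {k})) =
        (if k < m then a k * u k * ?z I else 0) +
        (\<Sum>i\<in>?N. shuffle_sign {k} (I - {k}) * shuffle_sign {i} (I - {k}) * (u i * a k) * ?z (insert i (I - {k})))"
        by (simp add: distrib_left sum_distrib_left mult_ac)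
    qed
    also have "\<dots> = (\<Sum>i\<in>{..<m} \<inter> I. a i * u i) * ?z I + X"
    proof -
      have "(\<Sum>k\<in>I. if k < m then a k * u k * ?z I else 0) = (\<Sum>i\<in>{..<m} \<inter> I. a i * u i) * ?z I"
        using f by (simp add: sum.inter_restrict[of I, symmetric] sum_distrib_right Int_commute sum.If_cases lessThan_def)
      then show ?thesis unfolding sum.distrib X_def by (subst sum.swap) simp
    qed
    finally have R: "Rep_bialg (lft a * contr m u z) I J = (\<Sum>i\<in>{..<m} \<inter> I. a i * u i) * ?z I + X" .
    have "pair m a u = (\<Sum>i\<in>?N. a i * u i) + (\<Sum>i\<in>{..<m} \<inter> I. a i * u i)"
      unfolding pair_def using sum.Int_Diff[of "{..<m}" "\<lambda>i. a i * u i" I] by (simp add: add.commute)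
    then show ?thesis unfolding minus_bialg.rep_eq scl.rep_eq L R by (simp add: algebra_simps)
  qed
qed

primrec contrs :: "nat \<Rightarrow> (nat \<Rightarrow> 'a::comm_ring_1) list \<Rightarrow> 'a bialg \<Rightarrow> 'a bialg" where
  "contrs m [] z = z"
| "contrs m (u # us) z = contrs m us (contr m u z)"

lemma contrs_append: "contrs m (us @ vs) z = contrs m vs (contrs m us z)"
  by (induction us arbitrary: z) simp_all

lemma pairing_contr:
  "(\<Sum>I\<in>Pow {..<m}. wedge (ext_vec u) w I * Rep_bialg z I J) =
   (\<Sum>I\<in>Pow {..<m}. w I * Rep_bialg (contr m u z) I J)"
proof -
  have fin: "finite I" if "I \<in> Pow {..<m}" for I using that finite_subset by blast
  have "(\<Sum>I\<in>Pow {..<m}. wedge (ext_vec u) w I * Rep_bialg z I J) =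
    (\<Sum>I\<in>Pow {..<m}. \<Sum>i\<in>I. shuffle_sign {i} (I - {i}) * u i * w (I - {i}) * Rep_bialg z I J)"
    by (intro sum.cong refl) (simp add: wedge_ext_vec fin sum_distrib_right)
  also have "\<dots> = (\<Sum>(I, i)\<in>Sigma (Pow {..<m}) (\<lambda>I. I). shuffle_sign {i} (I - {i}) * u i * w (I - {i}) * Rep_bialg z I J)"
    by (rule sum.Sigma) (use fin in auto)
  also have "\<dots> = (\<Sum>(I, i)\<in>Sigma (Pow {..<m}) (\<lambda>I. {..<m} - I). w I * (shuffle_sign {i} I * u i * Rep_bialg z (insert i I) J))"
    by (rule sum.reindex_bij_witness[of _ "\<lambda>(I, i). (insert i I, i)" "\<lambda>(I, i). (I - {i}, i)"])
       (auto simp: insert_absorb mult_ac)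
  also have "\<dots> = (\<Sum>I\<in>Pow {..<m}. \<Sum>i\<in>{..<m} - I. w I * (shuffle_sign {i} I * u i * Rep_bialg z (insert i I) J))"
    by (rule sum.Sigma[symmetric]) auto
  finally show ?thesis by (simp add: contr.rep_eq sum_distrib_left)
qed

lemma pairing_contrs:
  "(\<Sum>I\<in>Pow {..<m}. wedge_list us I * Rep_bialg z I J) = Rep_bialg (contrs m us z) {} J"
proof (induction us arbitrary: z)
  case Nil
  have "(\<Sum>I\<in>Pow {..<m}. ext_one I * Rep_bialg z I J) = (\<Sum>I\<in>Pow {..<m}. if I = {} then Rep_bialg z {} J else 0)"
    by (intro sum.cong refl) (auto simp: ext_one_def)
  then show ?case by simp
next
  case (Cons u us)
  then show ?case by (simp add: pairing_contr)
qed

text \<open>Evaluation at a decomposable vector is iterated contraction, so images can be computed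
  with the product rules of the ring.\<close>

lemma apply_hom_wedge_list:
  assumes "length us = t"
  shows "apply_hom m t (Rep_bialg z) (wedge_list us) = Rep_bialg (contrs m us z) {}"
proof
  fix J
  have "apply_hom m t (Rep_bialg z) (wedge_list us) J = (\<Sum>I\<in>Pow {..<m}. wedge_list us I * Rep_bialg z I J)"
    unfolding apply_hom_def
  proof (rule sum.mono_neutral_left)
    show "tsub m t \<subseteq> Pow {..<m}" by (auto simp: tsub_def)
    show "\<forall>I\<in>Pow {..<m} - tsub m t. wedge_list us I * Rep_bialg z I J = 0"
    proof
      fix I assume "I \<in> Pow {..<m} - tsub m t"
      then have "card I \<noteq> length us" using assms by (auto simp: tsub_def)
      then have "wedge_list us I = 0" using card_wedge_list by blast
      then show "wedge_list us I * Rep_bialg z I J = 0" by simp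
    qed
  qed simp
  then show "apply_hom m t (Rep_bialg z) (wedge_list us) J = Rep_bialg (contrs m us z) {} J"
    by (simp add: pairing_contrs)
qed

subsection \<open>Linear algebra in function spaces\<close>

interpretation fv: vector_space "fscale :: 'a::field \<Rightarrow> ('b \<Rightarrow> 'a) \<Rightarrow> ('b \<Rightarrow> 'a)"
  by standard (simp_all add: fscale_def fun_eq_iff algebra_simps)

text \<open>The ambient function space may be infinite-dimensional; the finite set \<open>F\<close>
  makes comparison with \<open>fv.dim\<close> meaningful.\<close>

lemma fv_card_le_dim:
  fixes B :: "('b \<Rightarrow> 'a::field) set"
  assumes "fv.independent B" "B \<subseteq> V" "V \<subseteq> fv.span F" "finite F"
  shows "card B \<le> fv.dim V"
proof -
  obtain B' where B': "B' \<subseteq> V" "fv.independent B'" "V \<subseteq> fv.span B'" "card B' = fv.dim V"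
    using fv.basis_exists by blast
  have "finite B'" using fv.independent_span_bound[OF assms(4) B'(2)] B'(1) assms(3) by blast
  then show ?thesis using fv.independent_span_bound[OF _ assms(1), of B'] B' assms(2) by auto
qed

lemma fv_dim_mono:
  fixes V :: "('b \<Rightarrow> 'a::field) set"
  assumes "V \<subseteq> W" "W \<subseteq> fv.span F" "finite F"
  shows "fv.dim V \<le> fv.dim W"
proof -
  obtain B where B: "B \<subseteq> V" "fv.independent B" "V \<subseteq> fv.span B" "card B = fv.dim V"
    using fv.basis_exists by blast
  then show ?thesis using fv_card_le_dim[OF B(2) _ assms(2,3)] assms(1) by auto
qed

lemma sum_fun_apply: "(\<Sum>i\<in>S. f i) x = (\<Sum>i\<in>S. f i x)" for f :: "'c \<Rightarrow> 'b \<Rightarrow> 'a::comm_monoid_add"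
  by (induction S rule: infinite_finite_induct) simp_all

lemma vecs_expansion:
  fixes v :: "nat \<Rightarrow> 'a::field"
  assumes "v \<in> vecs m" shows "v = (\<Sum>i<m. fscale (v i) (basis_vec i))"
proof
  fix j
  have "(\<Sum>i<m. fscale (v i) (basis_vec i)) j = (\<Sum>i<m. if i = j then v i else 0)"
    unfolding sum_fun_apply by (intro sum.cong) (auto simp: fscale_def basis_vec_def)
  also have "\<dots> = v j" using assms by (auto simp: vecs_def)
  finally show "v j = (\<Sum>i<m. fscale (v i) (basis_vec i)) j" ..
qed

lemma vecs_span: "vecs m \<subseteq> fv.span ((basis_vec :: nat \<Rightarrow> nat \<Rightarrow> 'a::field) ` {..<m})"
proof
  fix v :: "nat \<Rightarrow> 'a" assume "v \<in> vecs m"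
  then have "v = (\<Sum>i<m. fscale (v i) (basis_vec i))" by (rule vecs_expansion)
  also have "\<dots> \<in> fv.span (basis_vec ` {..<m})"
    by (intro fv.span_sum fv.span_scale fv.span_base) auto
  finally show "v \<in> fv.span (basis_vec ` {..<m})" .
qed

lemma vecs_subspace: "fv.subspace (vecs m)"
proof (rule fv.subspaceI)
  show "0 \<in> vecs m" by (simp add: vecs_def)
  show "x + y \<in> vecs m" if "x \<in> vecs m" "y \<in> vecs m" for x y :: "nat \<Rightarrow> 'a"
    using that by (auto simp: vecs_def) (metis add.right_neutral)
  show "fscale c x \<in> vecs m" if "x \<in> vecs m" for c and x :: "nat \<Rightarrow> 'a"
    using that by (auto simp: vecs_def fscale_def)
qed

lemma dual_vector:
  fixes S :: "(nat \<Rightarrow> 'a::field) set"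
  assumes "fv.independent S" "S \<subseteq> vecs m" "v \<in> S"
  shows "\<exists>g\<in>vecs m. pair m v g = 1 \<and> (\<forall>w\<in>S - {v}. pair m w g = 0)"
proof -
  interpret p: vector_space_pair "fscale :: 'a \<Rightarrow> (nat \<Rightarrow> 'a) \<Rightarrow> (nat \<Rightarrow> 'a)" "(*) :: 'a \<Rightarrow> 'a \<Rightarrow> 'a"
    by standard (simp_all add: algebra_simps)
  obtain f where f: "Vector_Spaces.linear fscale (*) f" "\<forall>x\<in>S. f x = (if x = v then 1 else 0)"
    using p.linear_independent_extend[OF assms(1), of "\<lambda>x. if x = v then 1 else 0"] by blast
  define g where "g i = (if i < m then f (basis_vec i) else 0)" for i
  have eq: "pair m w g = f w" if "w \<in> vecs m" for w
  proof -
    have "f w = f (\<Sum>i<m. fscale (w i) (basis_vec i))" using vecs_expansion[OF that] by simp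
    also have "\<dots> = (\<Sum>i<m. w i * f (basis_vec i))"
      by (simp add: p.linear_sum[OF f(1)] p.linear_scale[OF f(1)])
    finally show ?thesis by (simp add: pair_def g_def)
  qed
  have "pair m v g = 1" using eq[of v] f(2) assms by auto
  moreover have "pair m w g = 0" if "w \<in> S - {v}" for w using eq[of w] f(2) assms that by auto
  moreover have "g \<in> vecs m" by (simp add: g_def vecs_def)
  ultimately show ?thesis by blast
qed

subsection \<open>Products of vectors\<close>

lemma lprod_mem: "a \<in> set as \<Longrightarrow> lft a * lprod as = 0"
proof (induction as)
  case (Cons b bs)
  show ?case
  proof (cases "a = b")
    case True
    then have "lft a * lprod (b # bs) = lft a * lft a * lprod bs" by (simp add: mult.assoc)
    then show ?thesis by (simp add: lft_square)
  next
    case False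
    have "lft a * lprod (b # bs) = lft a * lft b * lprod bs" by (simp add: mult.assoc)
    also have "\<dots> = - (lft b * (lft a * lprod bs))" by (subst lft_anti) (simp add: mult.assoc)
    finally show ?thesis using Cons False by simp
  qed
qed simp

lemma lprod_span:
  fixes a :: "nat \<Rightarrow> 'a::field"
  assumes "a \<in> fv.span (set as)" shows "lft a * lprod as = 0"
proof -
  have "fv.subspace {a :: nat \<Rightarrow> 'a. lft a * lprod as = 0}"
    by (rule fv.subspaceI)
       (simp_all add: plus_fun_def zero_fun_def fscale_def lft_add lft_scale scl_mult_left distrib_right)
  moreover have "set as \<subseteq> {a. lft a * lprod as = 0}" using lprod_mem by auto
  ultimately show ?thesis using fv.span_minimal assms by blast
qed

lemma lprod_move: "\<exists>c. lft a * lprod (xs @ ys) = scl c (lprod (xs @ a # ys))"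
proof (induction xs)
  case Nil
  show ?case by (rule exI[of _ 1]) simp
next
  case (Cons x xs)
  then obtain c where c: "lft a * lprod (xs @ ys) = scl c (lprod (xs @ a # ys))" by blast
  have "lft a * lprod ((x # xs) @ ys) = lft a * lft x * lprod (xs @ ys)" by (simp add: mult.assoc)
  also have "\<dots> = - (lft x * (lft a * lprod (xs @ ys)))" by (subst lft_anti) (simp add: mult.assoc)
  also have "\<dots> = scl (- c) (lprod ((x # xs) @ a # ys))" by (simp add: c scl_mult_right scl_minus_left del: map_append prod_list.append)
  finally show ?case by blast
qed

text \<open>The scalar produced here is a sign. It is left unspecified because only spans matter
  later.\<close>

lemma lprod_perm: "mset l = mset l' \<Longrightarrow> \<exists>c. lprod l = scl c (lprod l')"
proof (induction l arbitrary: l')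
  case Nil
  then show ?case by (intro exI[of _ 1]) simp
next
  case (Cons a l)
  then have "a \<in> set l'" by (metis list.set_intros(1) mset_eq_setD)
  then obtain xs ys where l': "l' = xs @ a # ys" by (meson split_list)
  then have "mset l = mset (xs @ ys)" using Cons.prems by simp
  from Cons.IH[OF this] obtain c where c: "lprod l = scl c (lprod (xs @ ys))" by blast
  obtain d where d: "lft a * lprod (xs @ ys) = scl d (lprod (xs @ a # ys))" using lprod_move by blast
  have "lprod (a # l) = scl c (lft a * lprod (xs @ ys))" by (simp add: c scl_mult_right del: map_append prod_list.append)
  then show ?case unfolding d scl_scl l' by blast
qed

lemma lprod_not_distinct: "\<not> distinct l \<Longrightarrow> lprod l = 0"
proof -
  assume "\<not> distinct l"
  then obtain xs y ys zs where l: "l = xs @ [y] @ ys @ [y] @ zs" using not_distinct_decomp by blast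
  have "lft y * lprod (ys @ [y] @ zs) = 0" by (rule lprod_mem) simp
  then show ?thesis unfolding l by (simp add: mult.assoc)
qed

lemma wedge_list_eq: "wedge_list l I = Rep_bialg (lprod l) I {}"
  by (simp add: Rep_lprod tensor_apply ext_one_def)

lemma wedge_list_perm:
  fixes l :: "(nat \<Rightarrow> 'a::field) list"
  assumes "mset l = mset l'" shows "\<exists>c. wedge_list l = fscale c (wedge_list l')"
proof -
  obtain c where "lprod l = scl c (lprod l')" using lprod_perm[OF assms] by blast
  then have "wedge_list l = fscale c (wedge_list l')"
    by (simp add: wedge_list_eq fscale_def fun_eq_iff scl.rep_eq)
  then show ?thesis by blast
qed

lemma wedge_list_not_distinct: "\<not> distinct l \<Longrightarrow> wedge_list l = 0"
  by (simp add: wedge_list_eq fun_eq_iff lprod_not_distinct zero_bialg.rep_eq)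

lemma wedge_add_right: "wedge u (v + w) = wedge u v + wedge u w"
  and wedge_add_left: "wedge (u + v) w = wedge u w + wedge v w"
  and wedge_fscale_right: "wedge u (fscale c v) = fscale c (wedge u v)"
  and wedge_fscale_left: "wedge (fscale c u) v = fscale c (wedge u v)"
  and wedge_zero_right [simp]: "wedge u 0 = 0"
  and wedge_zero_left [simp]: "wedge 0 u = 0"
  by (simp_all add: wedge_def fun_eq_iff fscale_def algebra_simps sum.distrib sum_distrib_left)

lemma ext_vec_plus: "ext_vec (u + v) = ext_vec u + ext_vec v" for u :: "nat \<Rightarrow> 'a::comm_ring_1"
  by (simp add: ext_vec_def fun_eq_iff)
lemma ext_vec_fscale: "ext_vec (fscale c v) = fscale c (ext_vec v)" for v :: "nat \<Rightarrow> 'a::comm_ring_1"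
  by (simp add: ext_vec_def fscale_def fun_eq_iff)
lemma ext_vec_0 [simp]: "ext_vec 0 = (0 :: nat set \<Rightarrow> 'a::comm_ring_1)"
  by (simp add: ext_vec_def fun_eq_iff)

lemma wedge_list_span:
  fixes D :: "(nat \<Rightarrow> 'a::field) set"
  assumes "set us \<subseteq> fv.span D"
  shows "wedge_list us \<in> fv.span {wedge_list l | l. set l \<subseteq> D \<and> length l = length us}"
  using assms
proof (induction us)
  case Nil
  then show ?case by (intro fv.span_base) auto
next
  case (Cons u us)
  let ?X = "{wedge_list l | l. set l \<subseteq> D \<and> length l = length us}"
  let ?Y = "{wedge_list l | l. set l \<subseteq> D \<and> length l = length (u # us)}"
  have "wedge (ext_vec d) w \<in> fv.span ?Y" if d: "d \<in> D" and w: "w \<in> fv.span ?X" for d w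
  proof -
    have "fv.subspace {w. wedge (ext_vec d) w \<in> fv.span ?Y}"
      by (rule fv.subspaceI) (simp_all add: wedge_add_right wedge_fscale_right fv.span_add fv.span_scale fv.span_zero)
    moreover have "wedge (ext_vec d) w \<in> fv.span ?Y" if "w \<in> ?X" for w
    proof -
      obtain l where "w = wedge_list l" "set l \<subseteq> D" "length l = length us" using \<open>w \<in> ?X\<close> by blast
      then have "wedge (ext_vec d) w = wedge_list (d # l)" "set (d # l) \<subseteq> D" "length (d # l) = length (u # us)"
        using d by auto
      then show ?thesis by (intro fv.span_base) blast
    qed
    ultimately show ?thesis using fv.span_minimal[of ?X "{w. wedge (ext_vec d) w \<in> fv.span ?Y}"] w by blast
  qed
  note D = this
  have "fv.subspace {x. wedge (ext_vec x) (wedge_list us) \<in> fv.span ?Y}"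
    by (rule fv.subspaceI)
       (simp_all add: ext_vec_plus ext_vec_fscale wedge_add_left wedge_fscale_left fv.span_add fv.span_scale fv.span_zero)
  moreover have "D \<subseteq> {x. wedge (ext_vec x) (wedge_list us) \<in> fv.span ?Y}" using D Cons by auto
  ultimately have "fv.span D \<subseteq> {x. wedge (ext_vec x) (wedge_list us) \<in> fv.span ?Y}" by (intro fv.span_minimal)
  then show ?case using Cons.prems by auto
qed

subsection \<open>Upper bound for the small rank\<close>

text \<open>Each contraction lowers the exponent \<open>k\<close> by at most one, and not at all if the vector is
  killed by \<open>A\<close>; a positive exponent forces the scalar part to vanish.\<close>

inductive divis :: "(nat \<Rightarrow> 'a::comm_ring_1) set \<Rightarrow> nat \<Rightarrow> 'a bialg \<Rightarrow> bool" for A where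
  any: "divis A 0 z"
| mult: "a \<in> A \<Longrightarrow> divis A k z \<Longrightarrow> divis A (Suc k) (lft a * z)"
| add: "divis A k x \<Longrightarrow> divis A k y \<Longrightarrow> divis A k (x + y)"
| scl: "divis A k x \<Longrightarrow> divis A k (scl c x)"

lemma divis_uminus: "divis A k x \<Longrightarrow> divis A k (- x)"
  using divis.scl[of A k x "- 1"] by (simp add: scl_minus_left)

lemma divis_diff: "divis A k x \<Longrightarrow> divis A k y \<Longrightarrow> divis A k (x - y)"
  using divis.add[OF _ divis_uminus, of A k x y] by simp

lemma divis_contr: "divis A k z \<Longrightarrow> divis A (k - 1) (contr m u z)"
proof (induction rule: divis.induct)
  case (mult a k z)
  have "divis A k (lft a * contr m u z)" using mult by (cases k) (auto intro: divis.intros)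
  then show ?case using mult by (simp add: contr_lft divis_diff divis.scl)
qed (auto simp: contr_add contr_scl intro: divis.intros)

lemma divis_contr_annihilated: "divis A k z \<Longrightarrow> \<forall>a\<in>A. pair m a u = 0 \<Longrightarrow> divis A k (contr m u z)"
proof (induction rule: divis.induct)
  case (mult a k z)
  then show ?case by (simp add: contr_lft divis_uminus divis.mult)
qed (auto simp: contr_add contr_scl intro: divis.intros)

lemma divis_contrs:
  assumes "\<forall>b\<in>B. \<forall>a\<in>A. pair m a b = 0"
  shows "divis A k z \<Longrightarrow> divis A (k - length (filter (\<lambda>u. u \<notin> B) us)) (contrs m us z)"
proof (induction us arbitrary: k z)
  case (Cons u us)
  show ?case
  proof (cases "u \<in> B")
    case True
    then show ?thesis using Cons.IH[OF divis_contr_annihilated[OF Cons.prems]] assms by auto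
  next
    case False
    then show ?thesis using Cons.IH[OF divis_contr[OF Cons.prems]] by auto
  qed
qed simp

lemma divis_Rep: "divis A k z \<Longrightarrow> k > 0 \<Longrightarrow> Rep_bialg z {} J = 0"
proof (induction rule: divis.induct)
  case (mult a k z)
  then show ?case by (cases "finite J") (simp_all add: Rep_lft_mult Rep_bialg_infinite)
qed (simp_all add: rep_eqs)

lemma divis_lprod: "divis (set as) (length as) (lprod as * z)"
proof -
  have "set as \<subseteq> A \<Longrightarrow> divis A (length as) (lprod as * z)" for A
    by (induction as) (auto simp: mult.assoc intro: divis.intros)
  then show ?thesis by blast
qed

lemma pair_diff_right: "pair m a (u - v) = pair m a u - pair m a v"
  and pair_fscale_right: "pair m a (fscale c u) = c * pair m a u"
  by (simp_all add: pair_def fscale_def algebra_simps sum_subtractf sum_distrib_left)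

text \<open>Each functional costs at most one vector of the spanning set.\<close>

lemma adapted_spanning_set:
  fixes U :: "(nat \<Rightarrow> 'a::field) set"
  assumes "finite B0" "U \<subseteq> fv.span B0"
  shows "\<exists>B us. finite B \<and> U \<subseteq> fv.span (B \<union> set us) \<and> card B + length us \<le> card B0 \<and>
    length us \<le> length as \<and> (\<forall>b\<in>B. \<forall>a\<in>set as. pair m a b = 0)"
proof (induction as)
  case Nil
  show ?case using assms by (intro exI[of _ B0] exI[of _ "[]"]) simp
next
  case (Cons a as)
  then obtain B us where B: "finite B" "U \<subseteq> fv.span (B \<union> set us)" "card B + length us \<le> card B0"
    "length us \<le> length as" "\<And>b a. b \<in> B \<Longrightarrow> a \<in> set as \<Longrightarrow> pair m a b = 0" by blast
  show ?case
  proof (cases "\<forall>b\<in>B. pair m a b = 0")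
    case True
    then show ?thesis using B by (intro exI[of _ B] exI[of _ us]) auto
  next
    case False
    then obtain b0 where b0: "b0 \<in> B" "pair m a b0 \<noteq> 0" by blast
    define f where "f b = b - fscale (pair m a b / pair m a b0) b0" for b
    let ?B = "f ` (B - {b0})"
    have "card ?B \<le> card (B - {b0})" using B(1) by (intro card_image_le) simp
    moreover have "card B = Suc (card (B - {b0}))" using card.remove[OF B(1) b0(1)] .
    ultimately have card: "card ?B + length (b0 # us) \<le> card B0" using B(3) by simp
    have ann: "pair m a' b = 0" if b: "b \<in> ?B" and a': "a' \<in> set (a # as)" for a' b
    proof -
      obtain c where c: "c \<in> B" "b = f c" using b by blast
      show ?thesis
      proof (cases "a' = a")
        case True
        then show ?thesis using b0 c by (simp add: f_def pair_diff_right pair_fscale_right)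
      next
        case False
        then show ?thesis using a' B(5)[OF c(1)] B(5)[OF b0(1)] c(2)
          by (simp add: f_def pair_diff_right pair_fscale_right)
      qed
    qed
    have "B \<union> set us \<subseteq> fv.span (?B \<union> set (b0 # us))"
    proof
      fix x assume x: "x \<in> B \<union> set us"
      show "x \<in> fv.span (?B \<union> set (b0 # us))"
      proof (cases "x \<in> insert b0 (set us)")
        case True
        then show ?thesis by (intro fv.span_base) auto
      next
        case False
        then have "f x \<in> ?B" using x by auto
        then have "f x + fscale (pair m a x / pair m a b0) b0 \<in> fv.span (?B \<union> set (b0 # us))"
          by (intro fv.span_add fv.span_scale fv.span_base) auto
        then show ?thesis by (simp add: f_def)
      qed
    qed
    then have "fv.span (B \<union> set us) \<subseteq> fv.span (?B \<union> set (b0 # us))"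
      by (intro fv.span_minimal) auto
    then have "U \<subseteq> fv.span (?B \<union> set (b0 # us))" using B(2) by blast
    then show ?thesis using card ann B(1,4)
      by (intro exI[of _ ?B] exI[of _ "b0 # us"]) auto
  qed
qed

lemma apply_hom_add: "apply_hom m t psi (v + w) = apply_hom m t psi v + apply_hom m t psi w"
  and apply_hom_fscale: "apply_hom m t psi (fscale c v) = fscale c (apply_hom m t psi v)"
  and apply_hom_zero [simp]: "apply_hom m t psi 0 = 0"
  by (simp_all add: apply_hom_def fscale_def fun_eq_iff algebra_simps sum.distrib sum_distrib_left)

lemma apply_hom_span:
  fixes psi :: "'a::field ext2"
  assumes "\<And>v. v \<in> X \<Longrightarrow> apply_hom m t psi v \<in> fv.span Y"
  shows "v \<in> fv.span X \<Longrightarrow> apply_hom m t psi v \<in> fv.span Y"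
proof -
  have "fv.subspace {v. apply_hom m t psi v \<in> fv.span Y}"
    by (rule fv.subspaceI) (simp_all add: apply_hom_add apply_hom_fscale fv.span_add fv.span_scale fv.span_zero)
  then have "fv.span X \<subseteq> {v. apply_hom m t psi v \<in> fv.span Y}" using assms by (intro fv.span_minimal) auto
  then show "v \<in> fv.span X \<Longrightarrow> apply_hom m t psi v \<in> fv.span Y" by blast
qed

lemma choose_le_Suc:
  assumes "k \<le> Suc s" shows "k choose s \<le> Suc s"
proof -
  consider "k < s" | "k = s" | "k = Suc s" using assms by linarith
  then show ?thesis by cases (simp_all add: binomial_eq_0)
qed

lemma fv_basis_vecs:
  fixes U :: "(nat \<Rightarrow> 'a::field) set"
  assumes "U \<subseteq> vecs m"
  obtains B where "finite B" "B \<subseteq> U" "fv.independent B" "U \<subseteq> fv.span B" "card B = fv.dim U"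
proof -
  obtain B where B: "B \<subseteq> U" "fv.independent B" "U \<subseteq> fv.span B" "card B = fv.dim U"
    using fv.basis_exists by blast
  moreover have "B \<subseteq> fv.span (basis_vec ` {..<m})" using B(1) assms vecs_span by blast
  then have "finite B" using fv.independent_span_bound[OF _ B(2)] by blast
  ultimately show ?thesis using that by blast
qed

text \<open>Only divisibility by \<open>lprod as\<close> matters, so \<open>z\<close> is arbitrary.
  A surviving wedge needs at least \<open>length as\<close> factors outside \<open>B\<close>, hence
  uses all of \<open>us\<close>, and \<open>s\<close> further factors from \<open>B\<close>. In that
  case \<open>card B\<close> is at most s+1, and there are at most s+1 choices.\<close>

lemma restricted_rank_le:
  fixes z :: "'a::field bialg"
  assumes t: "length as + s = t" and U: "U \<subseteq> vecs m" "fv.dim U \<le> t + 1"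
  shows "fv.dim (apply_hom m t (Rep_bialg (lprod as * z)) ` ext_pow_sub t U) \<le> s + 1"
proof -
  let ?F = "apply_hom m t (Rep_bialg (lprod as * z))"
  obtain B0 where B0: "finite B0" "U \<subseteq> fv.span B0" "card B0 = fv.dim U" using fv_basis_vecs[OF U(1)] by metis
  obtain B us where B: "finite B" "U \<subseteq> fv.span (B \<union> set us)" "card B + length us \<le> t + 1"
    "length us \<le> length as" "\<forall>b\<in>B. \<forall>a\<in>set as. pair m a b = 0"
    using adapted_spanning_set[OF B0(1,2), of as m] B0(3) U(2) by (metis order_trans)
  \<comment> \<open>If \<open>us\<close> is shorter than \<open>as\<close>, every wedge is killed
    and no index set is needed.\<close>
  define T where "T = (if length us = length as then (\<lambda>C. set us \<union> C) ` {C. C \<subseteq> B \<and> card C = s} else {})"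
  \<comment> \<open>One ordering is chosen for each set of factors; any other gives a scalar
    multiple.\<close>
  define g where "g S = ?F (wedge_list (SOME l. distinct l \<and> set l = S))" for S
  have basis: "?F (wedge_list l) \<in> fv.span (g ` T)" if l: "set l \<subseteq> B \<union> set us" "length l = t" for l
  proof (cases "distinct l")
    case False
    then show ?thesis by (simp add: wedge_list_not_distinct fv.span_zero)
  next
    case True
    let ?k = "length (filter (\<lambda>u. u \<notin> B) l)"
    show ?thesis
    proof (cases "?k < length as")
      case True
      have "divis (set as) (length as - ?k) (contrs m l (lprod as * z))"
        by (rule divis_contrs[OF B(5) divis_lprod])
      then have "Rep_bialg (contrs m l (lprod as * z)) {} J = 0" for J
        using True by (intro divis_Rep) auto
      then have "?F (wedge_list l) = 0"
        by (simp add: apply_hom_wedge_list l fun_eq_iff)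
      then show ?thesis by (simp add: fv.span_zero)
    next
      case False
      have set_filter: "set (filter (\<lambda>u. u \<notin> B) l) = set l - B" by auto
      have k: "?k = card (set l - B)" using \<open>distinct l\<close> set_filter by (metis distinct_card distinct_filter)
      have sub: "set l - B \<subseteq> set us" using l by auto
      have "card (set l - B) \<le> card (set us)" using sub by (intro card_mono) auto
      moreover have "card (set us) \<le> length us" by (rule card_length)
      ultimately have eq: "length us = length as" "card (set l - B) = length as" "card (set l - B) = card (set us)"
        using k False B(4) by linarith+
      then have us: "set l - B = set us" using sub by (intro card_subset_eq) auto
      have "card (set l) = card (set l \<inter> B) + card (set l - B)" by (subst card_Int_Diff[of "set l" B]) auto
      then have "card (set l \<inter> B) = s" using eq(2) t l(2) distinct_card[OF \<open>distinct l\<close>] by linarith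
      then have "set l \<in> T" unfolding T_def using eq(1) us by (auto intro!: image_eqI[of _ _ "set l \<inter> B"])
      define l0 where "l0 = (SOME l'. distinct l' \<and> set l' = set l)"
      have "distinct l0 \<and> set l0 = set l" unfolding l0_def by (rule someI[of _ l]) (use \<open>distinct l\<close> in simp)
      then have "mset l = mset l0" using \<open>distinct l\<close> set_eq_iff_mset_eq_distinct by metis
      then obtain c where "wedge_list l = fscale c (wedge_list l0)" using wedge_list_perm by blast
      then have "?F (wedge_list l) = fscale c (g (set l))" by (simp add: apply_hom_fscale g_def l0_def)
      then show ?thesis using \<open>set l \<in> T\<close> by (simp add: fv.span_scale fv.span_base)
    qed
  qed
  have "?F (wedge_list vs) \<in> fv.span (g ` T)" if "set vs \<subseteq> U" "length vs = t" for vs :: "(nat \<Rightarrow> 'a) list"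
  proof (rule apply_hom_span[OF _ wedge_list_span[of vs "B \<union> set us"]])
    show "set vs \<subseteq> fv.span (B \<union> set us)" using that B(2) by blast
    show "?F v \<in> fv.span (g ` T)" if "v \<in> {wedge_list l |l. set l \<subseteq> B \<union> set us \<and> length l = length vs}" for v
      using that basis \<open>length vs = t\<close> by auto
  qed
  then have "?F v \<in> fv.span (g ` T)" if "v \<in> {wedge_list us | us. set us \<subseteq> U \<and> length us = t}" for v
    using that by blast
  then have "?F v \<in> fv.span (g ` T)" if "v \<in> ext_pow_sub t U" for v
    using that unfolding ext_pow_sub_def by (rule apply_hom_span)
  then have "?F ` ext_pow_sub t U \<subseteq> fv.span (g ` T)" by blast
  moreover have T: "finite T \<and> card T \<le> s + 1"
  proof (cases "length us = length as")
    case True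
    let ?C = "{C. C \<subseteq> B \<and> card C = s}"
    have f: "finite ?C" using B(1) by simp
    have "card T \<le> card ?C" using True f by (simp add: T_def card_image_le)
    also have "\<dots> = card B choose s" using B(1) by (rule n_subsets)
    also have "\<dots> \<le> Suc s" using True B(3) t by (intro choose_le_Suc) linarith
    finally show ?thesis using True f by (simp add: T_def)
  qed (simp add: T_def)
  ultimately have "fv.dim (?F ` ext_pow_sub t U) \<le> card (g ` T)" by (intro fv.dim_le_card) auto
  also have "\<dots> \<le> card T" using T by (intro card_image_le) auto
  finally show ?thesis using T by linarith
qed

subsection \<open>Interchanging the two factors\<close>

text \<open>Carries facts about left factors over to right factors; it reverses no products and
  introduces no signs.\<close>

lift_definition swp :: "'a::comm_ring_1 bialg \<Rightarrow> 'a bialg" is "\<lambda>z I J. z J I" by blast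

lemma swp_swp [simp]: "swp (swp z) = z"
  by transfer simp

lemma swp_zero [simp]: "swp 0 = 0" and swp_one [simp]: "swp 1 = 1"
  and swp_add: "swp (x + y) = swp x + swp y"
  by - (rule bialg_eqI, simp add: swp.rep_eq rep_eqs tensor_apply mult.commute)+

lemma swp_mult: "swp (x * y) = swp x * swp y"
  by (rule bialg_eqI, unfold swp.rep_eq times_bialg.rep_eq mult2_def, subst sum.swap) (simp only: mult_ac)

lemma swp_lft [simp]: "swp (lft v) = rgt v" and swp_rgt [simp]: "swp (rgt v) = lft v"
  by - (rule bialg_eqI, simp add: swp.rep_eq rep_eqs tensor_apply mult.commute)+

lemma swp_dyad: "swp (dyad v y) = dyad y v"
  by (simp add: dyad_def swp_mult rgt_lft)

lemma swp_lprod: "swp (lprod vs) = rprod vs"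
  by (induction vs) (simp_all add: swp_mult)

lemma swp_rprod: "swp (rprod vs) = lprod vs"
  by (induction vs) (simp_all add: swp_mult)

lemma swp_esym: "swp (esym s bs) = esym s (map swp bs)"
  by (induction s bs rule: esym.induct) (simp_all add: swp_add swp_mult)

lemma rprod_mem: "y \<in> set ys \<Longrightarrow> rgt y * rprod ys = 0"
  using arg_cong[OF lprod_mem[of y ys], of swp] by (simp add: swp_mult swp_lprod)

subsection \<open>Normal form\<close>

lemma esym_move:
  assumes "\<And>b. b \<in> set p1 \<Longrightarrow> c * b = b * c"
  shows "esym s (p1 @ c # p2) = esym s (c # p1 @ p2)"
  using assms
proof (induction p1 arbitrary: s)
  case (Cons b p1)
  have IH: "esym s (p1 @ c # p2) = esym s (c # p1 @ p2)" for s using Cons by simp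
  have bc: "b * (c * x) = c * (b * x)" for x using Cons.prems[of b] by (simp add: mult.assoc[symmetric])
  show ?case
  proof (cases s)
    case (Suc s')
    then show ?thesis by (cases s') (simp_all add: IH algebra_simps bc)
  qed simp
qed simp

text \<open>Splitting a summand would add just the terms that contain both parts, and these
  vanish.\<close>

lemma esym_merge:
  assumes "b * b' = 0" shows "esym s ((b + b') # X) = esym s (b # b' # X)"
proof -
  have bb: "b * (b' * x) = 0" for x using assms by (simp add: mult.assoc[symmetric])
  show ?thesis
  proof (cases s)
    case (Suc s')
    then show ?thesis by (cases s') (simp_all add: algebra_simps bb)
  qed simp
qed

lemma esym_short: "length X < s \<Longrightarrow> esym s X = 0"
  by (induction s X rule: esym.induct) auto

lemma esym_length: "esym (length X) X = prod_list X"
  by (induction X) (simp_all add: esym_short)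

abbreviation dyads :: "((nat \<Rightarrow> 'a::comm_ring_1) \<times> (nat \<Rightarrow> 'a)) list \<Rightarrow> 'a bialg list" where
  "dyads ps \<equiv> map (\<lambda>(v, w). dyad v w) ps"

text \<open>All degrees are compared at once because the recursion of \<open>esym\<close> mixes two
  consecutive ones.\<close>

definition eqv :: "'r::ring_1 \<Rightarrow> 'r list \<Rightarrow> 'r list \<Rightarrow> bool" where
  "eqv P X Y \<longleftrightarrow> (\<forall>s. P * esym s X = P * esym s Y)"

lemma eqv_Cons:
  assumes "P * b = b * P" "eqv P X Y" shows "eqv P (b # X) (b # Y)"
proof -
  have "P * (b * x) = b * (P * x)" for x using assms(1) by (simp add: mult.assoc[symmetric])
  then have "P * esym s (b # X) = P * esym s (b # Y)" for s
    using assms(2) by (cases s) (simp_all add: eqv_def distrib_left)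
  then show ?thesis by (simp add: eqv_def)
qed

lemma dyads_move: "esym s (dyads (p1 @ (v, w) # p2)) = esym s (dyads ((v, w) # p1 @ p2))"
proof -
  have "esym s (dyads p1 @ dyad v w # dyads p2) = esym s (dyad v w # dyads p1 @ dyads p2)"
    by (rule esym_move) (auto simp: dyad_commute[of v w])
  then show ?thesis by simp
qed

context
  fixes P :: "'a::field bialg" and A :: "(nat \<Rightarrow> 'a) set"
  assumes comm: "\<And>v w. P * dyad v w = dyad v w * P"
    and kill: "\<And>a w. a \<in> A \<Longrightarrow> P * dyad a w = 0"
begin

lemma eqv_absorb_generator:
  assumes "x \<in> fst ` set ps \<union> A" "w \<in> vecs n" "snd ` set ps \<subseteq> vecs n"
  shows "\<exists>ps'. map fst ps' = map fst ps \<and> snd ` set ps' \<subseteq> vecs n \<and> eqv P (dyads ((x, w) # ps)) (dyads ps')"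
proof (cases "x \<in> A")
  case True
  have "P * (dyad x w * y) = 0" for y using kill[OF True] by (simp add: mult.assoc[symmetric])
  then have "P * esym s (dyads ((x, w) # ps)) = P * esym s (dyads ps)" for s
    by (cases s) (simp_all add: distrib_left)
  then show ?thesis using assms(3) by (intro exI[of _ ps]) (simp add: eqv_def)
next
  case False
  then obtain w0 where "(x, w0) \<in> set ps" using assms(1) by auto
  then obtain p1 p2 where ps: "ps = p1 @ (x, w0) # p2" by (meson split_list)
  let ?ps' = "p1 @ (x, w0 + w) # p2"
  have "esym s (dyads ((x, w) # ps)) = esym s (dyads ?ps')" for s
  proof -
    have "esym s (dyads ((x, w) # ps)) = esym s (dyad x w0 # dyad x w # dyads (p1 @ p2))"
      using dyads_move[of s "(x, w) # p1" x w0 p2] by (simp add: ps)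
    also have "\<dots> = esym s ((dyad x w0 + dyad x w) # dyads (p1 @ p2))"
      by (rule esym_merge[symmetric]) simp
    also have "\<dots> = esym s (dyads ((x, w0 + w) # p1 @ p2))"
      by (simp add: dyad_add_right plus_fun_def)
    also have "\<dots> = esym s (dyads ?ps')" by (rule dyads_move[symmetric])
    finally show ?thesis .
  qed
  moreover have "w0 + w \<in> vecs n"
    using assms(2,3) by (intro fv.subspace_add[OF vecs_subspace]) (auto simp: ps)
  ultimately show ?thesis using assms(3)
    by (intro exI[of _ ?ps']) (auto simp: ps eqv_def)
qed

text \<open>If \<open>v\<close> is a combination of first components and elements of
  \<open>A\<close>, then \<open>dyad v w\<close> can be distributed: multiples of \<open>w\<close>
  are added to the existing second components, and the part in \<open>A\<close> is killed by
  \<open>P\<close>. The first components do not change.\<close>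

lemma eqv_absorb:
  assumes "v \<in> fv.span (fst ` set ps \<union> A)" "w \<in> vecs n" "snd ` set ps \<subseteq> vecs n"
  shows "\<exists>ps'. map fst ps' = map fst ps \<and> snd ` set ps' \<subseteq> vecs n \<and> eqv P (dyads ((v, w) # ps)) (dyads ps')"
  using assms
proof (induction v rule: fv.span_induct_alt)
  case base
  have "esym s (0 # X) = esym s X" for s and X :: "'a bialg list" by (cases s) simp_all
  then show ?case using base by (intro exI[of _ ps]) (simp add: eqv_def zero_fun_def)
next
  case (step c x y)
  then obtain ps' where ps': "map fst ps' = map fst ps" "snd ` set ps' \<subseteq> vecs n"
    "eqv P (dyads ((y, w) # ps)) (dyads ps')" by blast
  have cw: "fscale c w \<in> vecs n" using step by (intro fv.subspace_scale[OF vecs_subspace])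
  have "fst ` set ps' = fst ` set ps" using ps'(1) by (metis list.set_map)
  then obtain ps'' where ps'': "map fst ps'' = map fst ps'" "snd ` set ps'' \<subseteq> vecs n"
    "eqv P (dyads ((x, fscale c w) # ps')) (dyads ps'')"
    using eqv_absorb_generator[OF _ cw ps'(2), of x] step(1) by auto
  have "dyad (fscale c x + y) w = dyad x (fscale c w) + dyad y w"
    by (simp add: plus_fun_def fscale_def dyad_add_left dyad_scale_left dyad_scale_right)
  moreover have "dyad x (fscale c w) * dyad y w = 0"
    by (simp add: fscale_def dyad_scale_right scl_mult_left)
  ultimately have "esym s (dyads ((fscale c x + y, w) # ps)) = esym s (dyad x (fscale c w) # dyads ((y, w) # ps))" for s
    by (simp add: esym_merge)
  moreover have "eqv P (dyad x (fscale c w) # dyads ((y, w) # ps)) (dyad x (fscale c w) # dyads ps')"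
    by (rule eqv_Cons[OF comm ps'(3)])
  ultimately have "eqv P (dyads ((fscale c x + y, w) # ps)) (dyads ps'')"
    using ps''(3) by (simp add: eqv_def)
  then show ?case using ps'' ps'(1) by (intro exI[of _ ps'']) (simp add: plus_fun_def)
qed

lemma eqv_shorten:
  assumes "v \<in> fv.span (fst ` set p2 \<union> A)" "snd ` set (p1 @ (v, w) # p2) \<subseteq> vecs n"
  shows "\<exists>ps'. length ps' < length (p1 @ (v, w) # p2) \<and> fst ` set ps' \<subseteq> fst ` set (p1 @ (v, w) # p2) \<and>
    snd ` set ps' \<subseteq> vecs n \<and> eqv P (dyads (p1 @ (v, w) # p2)) (dyads ps')"
proof -
  obtain q where q: "map fst q = map fst p2" "snd ` set q \<subseteq> vecs n" "eqv P (dyads ((v, w) # p2)) (dyads q)"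
    using eqv_absorb[OF assms(1), of w n] assms(2) by auto
  have "eqv P (dyads (p1 @ (v, w) # p2)) (dyads (p1 @ q))"
  proof (induction p1)
    case Nil
    then show ?case using q(3) by simp
  next
    case (Cons p p1)
    obtain a b where "p = (a, b)" by (cases p)
    then show ?case using eqv_Cons[OF comm Cons] by simp
  qed
  moreover have "length q = length p2" using q(1) by (metis length_map)
  moreover have "fst ` set q = fst ` set p2" using q(1) by (metis list.set_map)
  ultimately show ?thesis using q(2) assms(2) by (intro exI[of _ "p1 @ q"]) auto
qed

end

text \<open>Independence in triangular form. Its failure singles out a vector in the span of its
  successors, which is what \<open>eqv_shorten\<close> consumes.\<close>

primrec tindep :: "(nat \<Rightarrow> 'a::field) list \<Rightarrow> bool" where
  "tindep [] = True"
| "tindep (v # vs) = (v \<notin> fv.span (set vs) \<and> tindep vs)"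

lemma tindep_independent: "tindep vs \<Longrightarrow> distinct vs \<and> fv.independent (set vs)"
proof (induction vs)
  case (Cons v vs)
  then have "fv.independent (insert v (set vs))" by (intro fv.independent_insertI) auto
  moreover have "v \<notin> set vs" using Cons.prems fv.span_base by auto
  ultimately show ?case using Cons by simp
qed (simp add: fv.dependent_def)

lemma not_tindep_append:
  "\<not> tindep (us @ as) \<Longrightarrow> \<not> tindep as \<or> (\<exists>xs v ys. us = xs @ v # ys \<and> v \<in> fv.span (set ys \<union> set as))"
proof (induction us)
  case (Cons u us)
  show ?case
  proof (cases "u \<in> fv.span (set us \<union> set as)")
    case True
    then show ?thesis by (metis append_Nil)
  next
    case False
    then have "\<not> tindep (us @ as)" using Cons.prems by simp
    then show ?thesis using Cons.IH by (metis append_Cons)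
  qed
qed simp

lemma lprod_not_tindep: "\<not> tindep as \<Longrightarrow> lprod as = 0"
  by (induction as) (auto simp: lprod_span)

lemma rprod_not_tindep: "\<not> tindep ys \<Longrightarrow> rprod ys = 0"
  using lprod_not_tindep[of ys] swp_lprod by (metis swp_zero)

text \<open>A dependence would let \<open>eqv_shorten\<close> drop a summand. No new first
  components arise, so minimality is demanded only among lists built from the old ones.\<close>

lemma minimal_tindep:
  fixes P :: "'a::field bialg"
  assumes comm: "\<And>v w. P * dyad v w = dyad v w * P"
    and kill: "\<And>a w. a \<in> set as \<Longrightarrow> P * dyad a w = 0"
    and vecs: "snd ` set ps \<subseteq> vecs n" and as: "tindep as"
    and min: "\<And>ps'. fst ` set ps' \<subseteq> fst ` set ps \<Longrightarrow> snd ` set ps' \<subseteq> vecs n \<Longrightarrow>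
      P * esym s (dyads ps) = P * esym s (dyads ps') \<Longrightarrow> length ps \<le> length ps'"
  shows "tindep (map fst ps @ as)"
proof (rule ccontr)
  assume "\<not> ?thesis"
  then obtain xs v ys where "map fst ps = xs @ v # ys" "v \<in> fv.span (set ys \<union> set as)"
    using not_tindep_append as by blast
  then obtain p1 w p2 where ps: "ps = p1 @ (v, w) # p2" and v: "v \<in> fv.span (fst ` set p2 \<union> set as)"
    by (auto simp: map_eq_append_conv map_eq_Cons_conv)
  show False
    using eqv_shorten[OF comm kill v, of p1 w n] vecs min unfolding ps eqv_def by (metis not_le)
qed

lemma dyads_commute_prod:
  "prod_list (map2 dyad vs ys) * dyad a w = dyad a w * prod_list (map2 dyad vs ys)"
proof -
  have "prod_list bs * dyad a w = dyad a w * prod_list bs" if "\<forall>b\<in>set bs. \<exists>v y. b = dyad v y" for bs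
    using that
  proof (induction bs)
    case (Cons b bs)
    then obtain v y where b: "b = dyad v y" by auto
    have "prod_list (b # bs) * dyad a w = b * (dyad a w * prod_list bs)" using Cons by (simp add: mult.assoc)
    also have "\<dots> = dyad a w * prod_list (b # bs)"
      unfolding b by (simp add: mult.assoc[symmetric] dyad_commute)
    finally show ?case .
  qed simp
  moreover have "\<forall>b\<in>set (map2 dyad vs ys). \<exists>v y. b = dyad v y" by auto
  ultimately show ?thesis by blast
qed

lemma lprod_rgt: "rgt y * lprod as = lprod as * rgt y"
  using arg_cong[OF rprod_lft[of as y], of swp] by (simp add: swp_mult swp_rprod)

text \<open>Interchanging the factors preserves the length of \<open>ps\<close>, so one list of
  minimal length is independent on both sides at once.\<close>

lemma normal_form:
  fixes z :: "'a::field bialg"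
  assumes z: "z = lprod as * rprod ys * Lam m s B" "z \<noteq> 0" and len: "length as = length ys"
    and B: "B \<in> homs m n"
  shows "\<exists>ps. fst ` set ps \<subseteq> vecs m \<and> snd ` set ps \<subseteq> vecs n \<and> z = lprod as * rprod ys * esym s (dyads ps) \<and>
    tindep (map fst ps @ as) \<and> tindep (map snd ps @ ys)"
proof -
  let ?P = "lprod as * rprod ys"
  have P: "?P = prod_list (map2 dyad as ys)" using prod_dyads[OF len] by simp
  have comm: "?P * dyad v w = dyad v w * ?P" for v w unfolding P by (rule dyads_commute_prod)
  have killl: "?P * dyad a w = 0" if "a \<in> set as" for a w
  proof -
    have "dyad a w * ?P = rgt w * (lft a * lprod as) * rprod ys" by (simp add: dyad_def mult.assoc rgt_lft_left)
    then show ?thesis using lprod_mem[OF that] by (simp add: comm)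
  qed
  have killr: "?P * dyad v y = 0" if "y \<in> set ys" for v y
  proof -
    have "dyad v y * ?P = lft v * (rgt y * lprod as) * rprod ys" by (simp add: dyad_def mult.assoc)
    also have "\<dots> = lft v * lprod as * (rgt y * rprod ys)" by (simp only: lprod_rgt mult.assoc)
    finally show ?thesis using rprod_mem[OF that] by (simp add: comm)
  qed
  define Q where "Q ps \<longleftrightarrow> fst ` set ps \<subseteq> vecs m \<and> snd ` set ps \<subseteq> vecs n \<and> z = ?P * esym s (dyads ps)" for ps
  let ?ps0 = "map (\<lambda>i. (basis_vec i, \<lambda>j. B j i)) (rev [0..<m])"
  have d0: "dyads ?ps0 = map (\<lambda>i. dyad (basis_vec i) (\<lambda>j. B j i)) (rev [0..<m])" by simp
  have "z = ?P * esym s (dyads ?ps0)" unfolding z(1) Lam_eq_esym d0 by (rule refl)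
  moreover have "fst ` set ?ps0 \<subseteq> vecs m" by (auto simp: vecs_def basis_vec_def split: if_splits)
  moreover have "snd ` set ?ps0 \<subseteq> vecs n" using B by (auto simp: vecs_def homs_def)
  ultimately have "Q ?ps0" by (simp only: Q_def)
  then obtain ps where ps: "Q ps" "\<And>ps'. Q ps' \<Longrightarrow> length ps \<le> length ps'"
    using arg_min_nat_lemma[of Q ?ps0 length] by blast
  have "lprod as \<noteq> 0" "rprod ys \<noteq> 0" using z by auto
  then have ind: "tindep as" "tindep ys" using lprod_not_tindep rprod_not_tindep by blast+
  have "tindep (map fst ps @ as)"
    by (rule minimal_tindep[OF comm killl _ ind(1), of ps n s]) (use ps in \<open>auto simp: Q_def\<close>)
  moreover have "tindep (map snd ps @ ys)"
  proof -
    let ?ps = "map prod.swap ps"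
    have sw: "swp (?P * esym s (dyads qs)) = swp ?P * esym s (dyads (map prod.swap qs))" for qs
    proof -
      have "map swp (dyads qs) = dyads (map prod.swap qs)" by (auto simp: swp_dyad)
      then show ?thesis by (simp only: swp_mult swp_esym)
    qed
    have "tindep (map fst ?ps @ ys)"
    proof (rule minimal_tindep[of "swp ?P" ys ?ps m s])
      show "swp ?P * dyad v w = dyad v w * swp ?P" for v w
        using arg_cong[OF comm[of w v], of swp] by (simp only: swp_mult swp_dyad)
      show "swp ?P * dyad y v = 0" if "y \<in> set ys" for y v
        using arg_cong[OF killr[OF that, of v], of swp] by (simp only: swp_mult swp_dyad swp_zero)
      show "snd ` set ?ps \<subseteq> vecs m" using ps(1) by (auto simp: Q_def)
      show "tindep ys" by (rule ind)
      fix ps' assume *: "fst ` set ps' \<subseteq> fst ` set ?ps" "snd ` set ps' \<subseteq> vecs m"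
        "swp ?P * esym s (dyads ?ps) = swp ?P * esym s (dyads ps')"
      let ?qs = "map prod.swap ps'"
      have "map prod.swap ?qs = ps'" by (simp add: comp_def)
      then have "swp (?P * esym s (dyads ps)) = swp (?P * esym s (dyads ?qs))" using *(3) by (simp only: sw)
      then have "?P * esym s (dyads ps) = ?P * esym s (dyads ?qs)" by (metis swp_swp)
      moreover have "fst ` set ?qs = snd ` set ps'" "snd ` set ?qs = fst ` set ps'" "fst ` set ?ps = snd ` set ps"
        by (auto simp: image_image)
      then have "fst ` set ?qs \<subseteq> vecs m" "snd ` set ?qs \<subseteq> vecs n"
        using *(1,2) ps(1) unfolding Q_def by (metis order_trans)+
      ultimately have "Q ?qs" using ps(1) unfolding Q_def by metis
      then show "length ?ps \<le> length ps'" using ps(2)[of ?qs] by simp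
    qed
    then show ?thesis by (simp add: comp_def)
  qed
  ultimately show ?thesis using ps(1) by (auto simp: Q_def)
qed

subsection \<open>Lower bound for the small rank\<close>

lemma contr_lprod_annihilated:
  "(\<And>v. v \<in> set vs \<Longrightarrow> pair m v g = 0) \<Longrightarrow> contr m g z = 0 \<Longrightarrow> contr m g (lprod vs * z) = 0"
  by (induction vs) (simp_all add: mult.assoc contr_lft)

lemma contr_rprod: "contr m g (rprod ys * z) = rprod ys * contr m g z"
  by (induction ys) (simp_all add: mult.assoc contr_rgt)

lemma contr_dyad: "contr m g (dyad v w * z) = scl (pair m v g) (rgt w * z) - dyad v w * contr m g z"
  by (simp add: dyad_def mult.assoc contr_lft contr_rgt)

lemma contr_esym_annihilated:
  "(\<And>v. v \<in> fst ` set ps \<Longrightarrow> pair m v g = 0) \<Longrightarrow> contr m g (esym s (dyads ps)) = 0"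
proof (induction ps arbitrary: s)
  case Nil
  then show ?case by (cases s) simp_all
next
  case (Cons p ps)
  obtain v w where p: "p = (v, w)" by (cases p)
  have "contr m g (esym s (dyads ps)) = 0" for s using Cons by auto
  moreover have "pair m v g = 0" using Cons.prems p by auto
  ultimately show ?case by (cases s) (simp_all add: p contr_add contr_dyad)
qed

lemma contrs_lprod:
  assumes "\<And>v w. v \<in> set vs \<Longrightarrow> w \<in> set vs \<Longrightarrow> pair m w (G v) = (if w = v then 1 else 0)"
    and "distinct vs" "\<And>v. v \<in> set vs \<Longrightarrow> contr m (G v) z = 0"
  shows "contrs m (map G vs) (lprod vs * z) = z"
  using assms
proof (induction vs)
  case (Cons v vs)
  have "contr m (G v) (lprod vs * z) = 0"
    by (rule contr_lprod_annihilated) (use Cons.prems in auto)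
  then have "contr m (G v) (lprod (v # vs) * z) = lprod vs * z"
    using Cons.prems(1)[of v v] by (simp add: mult.assoc contr_lft)
  then show ?case using Cons by simp
qed simp

text \<open>Contraction by the dual vector of a first component selects the terms containing its
  dyad and leaves the second component. As the degree is \<open>length T\<close>, all of it is used
  up by \<open>T\<close>, and nothing from \<open>R\<close> remains.\<close>

lemma contrs_esym:
  assumes "\<And>v w. v \<in> fst ` set (T @ R) \<Longrightarrow> w \<in> fst ` set (T @ R) \<Longrightarrow> pair m w (G v) = (if w = v then 1 else 0)"
    and "distinct (map fst (T @ R))"
  shows "contrs m (map G (map fst T)) (rprod ys * esym (length T) (dyads (T @ R))) = rprod (ys @ map snd T)"
  using assms
proof (induction T arbitrary: ys)
  case (Cons p T)
  obtain v w where p: "p = (v, w)" by (cases p)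
  have z: "contr m (G v) (esym s (dyads (T @ R))) = 0" for s
  proof (rule contr_esym_annihilated)
    fix x assume x: "x \<in> fst ` set (T @ R)"
    then have "x \<in> set (map fst (T @ R))" by (simp only: set_map)
    then have "x \<noteq> v" using Cons.prems(2) p by auto
    then show "pair m x (G v) = 0" using Cons.prems(1)[of v x] x p by auto
  qed
  have "pair m v (G v) = 1" using Cons.prems(1)[of v v] by (simp add: p)
  then have "contr m (G v) (esym (Suc (length T)) (dyads ((v, w) # T @ R))) = rgt w * esym (length T) (dyads (T @ R))"
    using z by (simp add: contr_add contr_dyad)
  then have "contrs m (map G (map fst (p # T))) (rprod ys * esym (length (p # T)) (dyads ((p # T) @ R))) =
    contrs m (map G (map fst T)) (rprod (ys @ [w]) * esym (length T) (dyads (T @ R)))"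
    by (simp add: p contr_rprod mult.assoc del: esym.simps)
  also have "\<dots> = rprod ((ys @ [w]) @ map snd T)" by (rule Cons.IH, rule Cons.prems(1)) (use Cons.prems(2) in auto)
  finally show ?case by (simp add: p)
qed simp

lemma dual_vectors:
  fixes vs :: "(nat \<Rightarrow> 'a::field) list"
  assumes "tindep vs" "set vs \<subseteq> vecs m"
  obtains G where "\<And>v. v \<in> set vs \<Longrightarrow> G v \<in> vecs m"
    "\<And>v w. v \<in> set vs \<Longrightarrow> w \<in> set vs \<Longrightarrow> pair m w (G v) = (if w = v then 1 else 0)"
proof -
  have "\<forall>v\<in>set vs. \<exists>g. g \<in> vecs m \<and> pair m v g = 1 \<and> (\<forall>w\<in>set vs - {v}. pair m w g = 0)"
    using dual_vector[OF _ assms(2)] tindep_independent[OF assms(1)] by blast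
  then obtain G where G: "\<forall>v\<in>set vs. G v \<in> vecs m \<and> pair m v (G v) = 1 \<and> (\<forall>w\<in>set vs - {v}. pair m w (G v) = 0)"
    by (rule bchoice[THEN exE])
  show ?thesis by (rule that[of G]) (use G in auto)
qed

lemma lprod_nonzero:
  fixes vs :: "(nat \<Rightarrow> 'a::field) list"
  shows "distinct vs \<Longrightarrow> fv.independent (set vs) \<Longrightarrow> set vs \<subseteq> vecs m \<Longrightarrow> lprod vs \<noteq> 0"
proof (induction vs)
  case (Cons v vs)
  obtain g where g: "pair m v g = 1" "\<forall>w\<in>set (v # vs) - {v}. pair m w g = 0"
    using dual_vector[OF Cons.prems(2,3), of v] by auto
  have "contr m g (lprod vs * 1) = 0"
    by (rule contr_lprod_annihilated) (use g Cons.prems in auto)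
  then have "contr m g (lprod (v # vs)) = lprod vs" using g by (simp add: contr_lft)
  moreover have "lprod vs \<noteq> 0" using Cons fv.independent_mono[OF Cons.prems(2)] by auto
  ultimately show ?case by (metis contr_zero)
qed simp

lemma wedge_list_nonzero:
  fixes vs :: "(nat \<Rightarrow> 'a::field) list"
  assumes "distinct vs" "fv.independent (set vs)" "set vs \<subseteq> vecs m"
  shows "wedge_list vs \<noteq> 0"
proof
  assume "wedge_list vs = 0"
  then have "lprod vs = 0"
    by (intro bialg_eqI) (simp add: Rep_lprod tensor_apply zero_bialg.rep_eq)
  then show False using lprod_nonzero[OF assms] by simp
qed

lemma finite_tsub: "finite (tsub m t)"
  by (rule finite_subset[of _ "Pow {..<m}"]) (auto simp: tsub_def)

lemma apply_hom_in_span: "apply_hom m t psi v \<in> fv.span (psi ` tsub m t)"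
proof -
  have "apply_hom m t psi v = (\<Sum>I\<in>tsub m t. fscale (v I) (psi I))"
    by (simp add: apply_hom_def fun_eq_iff sum_fun_apply fscale_def)
  also have "\<dots> \<in> fv.span (psi ` tsub m t)" by (intro fv.span_sum fv.span_scale fv.span_base) auto
  finally show ?thesis .
qed

lemma dim_span_list_le: "fv.dim (fv.span (set us)) \<le> length us"
  using fv.dim_le_card[of "fv.span (set us)" "set us"] card_length[of us] by simp

lemma wedge_list_in_ext_pow_sub: "set us \<subseteq> U \<Longrightarrow> length us = t \<Longrightarrow> wedge_list us \<in> ext_pow_sub t U"
  unfolding ext_pow_sub_def by (intro fv.span_base) blast

text \<open>Among s+1 summands, omit one and contract by the vectors dual to the others and to
  \<open>as\<close>: the image is the wedge \<open>ob k\<close> of \<open>ys\<close> with the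
  remaining second components. All these vectors lie in one space \<open>U\<close> spanned by
  \<open>length as\<close> + s + 1 = t + 1 dual vectors.\<close>

lemma many_images:
  fixes ps :: "((nat \<Rightarrow> 'a::field) \<times> (nat \<Rightarrow> 'a)) list"
  assumes z: "z = lprod as * rprod ys * esym s (dyads ps)"
    and ind: "tindep (map fst ps @ as)" "tindep (map snd ps @ ys)"
    and vecs: "set (map fst ps @ as) \<subseteq> vecs m" "set (map snd ps @ ys) \<subseteq> vecs n"
    and len: "length as + s = t" "s < length ps"
  shows "\<exists>U \<subseteq> vecs m. fv.subspace U \<and> fv.dim U \<le> t + 1 \<and>
    s + 1 \<le> fv.dim (apply_hom m t (Rep_bialg z) ` ext_pow_sub t U)"
proof -
  obtain G where G: "\<And>v. v \<in> set (map fst ps @ as) \<Longrightarrow> G v \<in> vecs m"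
    "\<And>v w. v \<in> set (map fst ps @ as) \<Longrightarrow> w \<in> set (map fst ps @ as) \<Longrightarrow> pair m w (G v) = (if w = v then 1 else 0)"
    using dual_vectors[OF ind(1) vecs(1)] by metis
  have dist: "distinct (map fst ps @ as)" "distinct (map snd ps @ ys)" using ind tindep_independent by blast+
  define qs rs where "qs = take (s + 1) ps" and "rs = drop (s + 1) ps"
  have ps: "ps = qs @ rs" and lq: "length qs = s + 1" using len by (simp_all add: qs_def rs_def)
  define T where "T k = take k qs @ drop (Suc k) qs" for k
  have qk: "qs = take k qs @ qs ! k # drop (Suc k) qs" if "k \<le> s" for k
    using that lq by (intro id_take_nth_drop) simp
  define us where "us k = map G (as @ map fst (T k))" for k
  define ob where "ob k = wedge_list (ys @ map snd (T k))" for k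
  define U where "U = fv.span (set (map G (as @ map fst qs)))"
  have Uv: "U \<subseteq> vecs m" unfolding U_def
    by (rule fv.span_minimal[OF _ vecs_subspace]) (use G(1) in \<open>auto simp: ps\<close>)
  have Ud: "fv.dim U \<le> t + 1" unfolding U_def using dim_span_list_le[of "map G (as @ map fst qs)"] lq len by simp
  have TS: "set (T k) \<subseteq> set qs" for k by (auto simp: T_def dest: in_set_takeD in_set_dropD)
  have lT: "length (T k) = s" if "k \<le> s" for k using that lq by (simp add: T_def)
  have ob: "ob k = apply_hom m t (Rep_bialg z) (wedge_list (us k))" if k: "k \<le> s" for k
  proof -
    obtain v w where vw: "qs ! k = (v, w)" by (cases "qs ! k")
    \<comment> \<open>The omitted summand is moved behind \<open>T k\<close>, so that
      \<open>contrs_esym\<close> sees it as part of the rest.\<close>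
    let ?R = "(v, w) # rs" and ?E = "esym s (dyads (T k @ (v, w) # rs))"
    have psk: "ps = take k qs @ (v, w) # drop (Suc k) qs @ rs" using ps qk[OF k] vw by simp
    have "esym s (dyads ps) = esym s (dyads ((v, w) # take k qs @ drop (Suc k) qs @ rs))"
      unfolding psk by (rule dyads_move)
    also have "\<dots> = ?E" using dyads_move[of s "T k" v w rs] by (simp add: T_def)
    finally have E: "esym s (dyads ps) = ?E" .
    have set: "set (T k @ ?R) = set ps" using psk by (auto simp: T_def)
    have d: "distinct (map fst (T k @ ?R))" using dist(1) unfolding psk by (auto simp: T_def)
    have "contr m (G a) (rprod ys * ?E) = 0" if a: "a \<in> set as" for a
    proof -
      have "pair m x (G a) = 0" if "x \<in> fst ` set (T k @ ?R)" for x
        using G(2)[of a x] a that dist(1) unfolding set by auto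
      then show ?thesis by (simp only: contr_rprod contr_esym_annihilated mult_zero_right)
    qed
    then have "contrs m (map G as) (lprod as * (rprod ys * ?E)) = rprod ys * ?E"
      by (intro contrs_lprod) (use G(2) dist in auto)
    then have "contrs m (us k) z = contrs m (map G (map fst (T k))) (rprod ys * ?E)"
      unfolding z us_def E by (simp add: contrs_append mult.assoc)
    also have "?E = esym (length (T k)) (dyads (T k @ ?R))" using lT[OF k] by simp
    also have "contrs m (map G (map fst (T k))) (rprod ys * \<dots>) = rprod (ys @ map snd (T k))"
      by (rule contrs_esym[OF _ d], rule G(2)) (unfold set, auto)
    finally have "Rep_bialg (contrs m (us k) z) {} = ob k"
      by (simp add: Rep_rprod ob_def tensor_apply ext_one_def fun_eq_iff del: map_append prod_list.append)
    moreover have "length (us k) = t" using lT[OF k] len by (simp add: us_def)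
    ultimately show ?thesis by (simp add: apply_hom_wedge_list)
  qed
  \<comment> \<open>Wedging with the k-th second component separates the images: it kills every
    \<open>ob l\<close> with l different from k, where it occurs already, but not
    \<open>ob k\<close>.\<close>
  define N where "N k = {x. wedge (ext_vec (snd (qs ! k))) x = 0}" for k
  have N: "fv.subspace (N k)" for k
    unfolding N_def by (rule fv.subspaceI) (simp_all add: wedge_add_right wedge_fscale_right fv.scale_zero_right)
  have in_N: "ob l \<in> N k" if "l \<noteq> k" "k \<le> s" "l \<le> s" for k l
  proof -
    have "qs ! k \<in> set (T l)"
    proof (cases "k < l")
      case True
      then have "take l qs ! k = qs ! k" "k < length (take l qs)" using that lq by auto
      then show ?thesis unfolding T_def by (metis UnI1 nth_mem set_append)
    next
      case False
      then have "drop (Suc l) qs ! (k - Suc l) = qs ! k" "k - Suc l < length (drop (Suc l) qs)" using that lq by auto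
      then show ?thesis unfolding T_def by (metis UnI2 nth_mem set_append)
    qed
    then have "\<not> distinct (snd (qs ! k) # ys @ map snd (T l))" by auto
    then have "wedge_list (snd (qs ! k) # ys @ map snd (T l)) = 0" by (rule wedge_list_not_distinct)
    then show ?thesis by (simp add: N_def ob_def)
  qed
  have not_in_N: "ob k \<notin> N k" if k: "k \<le> s" for k
  proof -
    let ?l = "snd (qs ! k) # ys @ map snd (T k)"
    have psk: "ps = take k qs @ qs ! k # drop (Suc k) qs @ rs" using ps qk[OF k] by simp
    have "distinct ?l" using dist(2) by (subst (asm) psk) (auto simp: T_def)
    moreover have sub: "set ?l \<subseteq> set (map snd ps @ ys)" using TS[of k] k lq by (auto simp: ps)
    then have "fv.independent (set ?l)" using fv.independent_mono tindep_independent[OF ind(2)] by blast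
    ultimately have "wedge_list ?l \<noteq> 0" using sub vecs(2) by (intro wedge_list_nonzero) auto
    then show ?thesis by (simp add: N_def ob_def)
  qed
  have "inj_on ob {..s}"
  proof (rule inj_onI, rule ccontr)
    fix k l assume *: "k \<in> {..s}" "l \<in> {..s}" "ob k = ob l" "k \<noteq> l"
    then have "ob l \<in> N k" by (intro in_N) auto
    then show False using not_in_N[of k] * by auto
  qed
  then have card: "card (ob ` {..s}) = s + 1" by (simp add: card_image)
  have "fv.independent (ob ` {..s})"
    unfolding fv.dependent_def
  proof
    assume "\<exists>a\<in>ob ` {..s}. a \<in> fv.span (ob ` {..s} - {a})"
    then obtain k where k: "k \<le> s" "ob k \<in> fv.span (ob ` {..s} - {ob k})" by auto
    have "ob ` {..s} - {ob k} \<subseteq> N k"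
    proof
      fix x assume "x \<in> ob ` {..s} - {ob k}"
      then obtain l where "l \<le> s" "x = ob l" "l \<noteq> k" by auto
      then show "x \<in> N k" using in_N k(1) by simp
    qed
    then have "fv.span (ob ` {..s} - {ob k}) \<subseteq> N k" using N by (intro fv.span_minimal)
    then show False using k not_in_N by blast
  qed
  moreover have "ob ` {..s} \<subseteq> apply_hom m t (Rep_bialg z) ` ext_pow_sub t U"
  proof
    fix x assume "x \<in> ob ` {..s}"
    then obtain k where k: "k \<le> s" "x = ob k" by auto
    have "set (us k) \<subseteq> U" unfolding U_def us_def using TS[of k] by (intro order_trans[OF _ fv.span_superset]) auto
    moreover have "length (us k) = t" using lT[OF k(1)] len by (simp add: us_def)
    ultimately show "x \<in> apply_hom m t (Rep_bialg z) ` ext_pow_sub t U"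
      using ob k wedge_list_in_ext_pow_sub by blast
  qed
  moreover have "apply_hom m t (Rep_bialg z) ` ext_pow_sub t U \<subseteq> fv.span (Rep_bialg z ` tsub m t)"
    using apply_hom_in_span by blast
  ultimately have "card (ob ` {..s}) \<le> fv.dim (apply_hom m t (Rep_bialg z) ` ext_pow_sub t U)"
    using finite_tsub by (intro fv_card_le_dim) auto
  then show ?thesis unfolding card using Uv Ud U_def by auto
qed

subsection \<open>Ranks of degenerate points\<close>

lemma single_rank_le:
  "hom_rank m t (Rep_bialg (lprod as * rprod ys :: 'a::field bialg)) \<le> 1"
proof -
  have "apply_hom m t (Rep_bialg (lprod as * rprod ys)) v \<in> fv.span {wedge_list ys}" for v :: "'a ext1"
  proof -
    have "apply_hom m t (Rep_bialg (lprod as * rprod ys)) v =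
      fscale (\<Sum>I\<in>tsub m t. v I * wedge_list as I) (wedge_list ys)"
      by (simp add: apply_hom_def Rep_lprod_rprod tensor_apply fscale_def fun_eq_iff sum_distrib_left mult_ac)
    then show ?thesis by (simp add: fv.span_scale fv.span_base)
  qed
  then have "hom_rank m t (Rep_bialg (lprod as * rprod ys :: 'a bialg)) \<le> card {wedge_list ys :: 'a ext1}"
    unfolding hom_rank_def by (intro fv.dim_le_card) auto
  then show ?thesis by simp
qed

lemma single_image:
  fixes z :: "'a::field bialg"
  assumes z: "z = lprod as * rprod ys" "z \<noteq> 0" and as: "set as \<subseteq> vecs m" "length as = t"
  shows "\<exists>U \<subseteq> vecs m. fv.subspace U \<and> fv.dim U \<le> t + 1 \<and>
    1 \<le> fv.dim (apply_hom m t (Rep_bialg z) ` ext_pow_sub t U)"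
proof -
  have "lprod as \<noteq> 0" using z by auto
  then have ind: "tindep as" using lprod_not_tindep by blast
  obtain G where G: "\<And>v. v \<in> set as \<Longrightarrow> G v \<in> vecs m"
    "\<And>v w. v \<in> set as \<Longrightarrow> w \<in> set as \<Longrightarrow> pair m w (G v) = (if w = v then 1 else 0)"
    using dual_vectors[OF ind as(1)] by metis
  let ?us = "map G as"
  have "contr m g (rprod ys) = 0" for g using contr_rprod[of m g ys 1] by simp
  then have "contrs m ?us z = rprod ys"
    unfolding z(1) using ind tindep_independent by (intro contrs_lprod G(2)) auto
  then have eq: "apply_hom m t (Rep_bialg z) (wedge_list ?us) = wedge_list ys"
    using as by (simp add: apply_hom_wedge_list Rep_rprod tensor_apply ext_one_def fun_eq_iff)
  have nz: "wedge_list ys \<noteq> 0"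
  proof
    assume "wedge_list ys = 0"
    then have "z = 0" unfolding z(1)
      by (intro bialg_eqI) (simp add: Rep_lprod_rprod tensor_apply zero_bialg.rep_eq)
    then show False using z by simp
  qed
  let ?U = "fv.span (set ?us)"
  have "?U \<subseteq> vecs m" by (rule fv.span_minimal[OF _ vecs_subspace]) (use G(1) in auto)
  moreover have "fv.dim ?U \<le> t + 1" using dim_span_list_le[of ?us] as(2) by simp
  moreover have "card {wedge_list ys} \<le> fv.dim (apply_hom m t (Rep_bialg z) ` ext_pow_sub t ?U)"
  proof (rule fv_card_le_dim)
    show "fv.independent {wedge_list ys}" using nz by simp
    have "wedge_list ?us \<in> ext_pow_sub t ?U"
      using as(2) by (intro wedge_list_in_ext_pow_sub fv.span_superset) simp
    then show "{wedge_list ys} \<subseteq> apply_hom m t (Rep_bialg z) ` ext_pow_sub t ?U"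
      using eq by (metis empty_subsetI image_eqI insert_subset)
    show "apply_hom m t (Rep_bialg z) ` ext_pow_sub t ?U \<subseteq> fv.span (Rep_bialg z ` tsub m t)"
      using apply_hom_in_span by blast
    show "finite (Rep_bialg z ` tsub m t)" using finite_tsub by simp
  qed
  ultimately show ?thesis by (intro exI[of _ ?U]) simp
qed

text \<open>Compare the number of independent summands with \<open>s\<close>. Fewer give 0; exactly
  \<open>s\<close> give the product of all of them, and \<open>s = 0\<close> is a single product
  anyway; only a surplus with \<open>s\<close> positive leaves a genuine compound.\<close>

lemma rank_dichotomy:
  fixes z :: "'a::field bialg"
  assumes z: "z = lprod as * rprod ys * Lam m s B" "z \<noteq> 0" and len: "length as = length ys"
    and B: "B \<in> homs m n" and vecs: "set as \<subseteq> vecs m" "set ys \<subseteq> vecs n" and t: "length as + s = t"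
  obtains as' ys' where "length as' = t" "length ys' = t" "set as' \<subseteq> vecs m" "set ys' \<subseteq> vecs n"
      "z = lprod as' * rprod ys'"
  | U where "s \<ge> 1" "U \<subseteq> vecs m" "fv.subspace U" "fv.dim U \<le> t + 1"
      "s + 1 \<le> fv.dim (apply_hom m t (Rep_bialg z) ` ext_pow_sub t U)"
proof -
  obtain ps where ps: "fst ` set ps \<subseteq> vecs m" "snd ` set ps \<subseteq> vecs n"
    "z = lprod as * rprod ys * esym s (dyads ps)" "tindep (map fst ps @ as)" "tindep (map snd ps @ ys)"
    using normal_form[OF z len B] by blast
  consider "s = 0" | "length ps < s" | "length ps = s" | "s \<ge> 1" "s < length ps" by linarith
  then show thesis
  proof cases
    case 1
    then show thesis using that(1)[of as ys] ps(3) vecs len t by simp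
  next
    case 2
    then have "esym s (dyads ps) = 0" by (intro esym_short) simp
    then show thesis using ps(3) z(2) by simp
  next
    case 3
    have "esym s (dyads ps) = prod_list (dyads ps)" using esym_length[of "dyads ps"] 3 by simp
    then have "z = prod_list (map2 dyad as ys) * prod_list (dyads ps)" using ps(3) prod_dyads[OF len] by simp
    also have "\<dots> = prod_list (map2 dyad (as @ map fst ps) (ys @ map snd ps))"
      using len by (simp add: zip_map_fst_snd)
    also have "\<dots> = lprod (as @ map fst ps) * rprod (ys @ map snd ps)" using len by (intro prod_dyads) simp
    finally show thesis
      by (intro that(1)[of "as @ map fst ps" "ys @ map snd ps"]) (use ps vecs len t 3 in auto)
  next
    case 4
    obtain U where "U \<subseteq> vecs m" "fv.subspace U" "fv.dim U \<le> t + 1"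
      "s + 1 \<le> fv.dim (apply_hom m t (Rep_bialg z) ` ext_pow_sub t U)"
      using many_images[OF ps(3-5) _ _ t 4(2), of m n] ps(1,2) vecs by auto
    then show thesis using that(2) 4(1) by blast
  qed
qed

lemma ext_pow_sub_subset:
  fixes U :: "(nat \<Rightarrow> 'a::field) set"
  assumes "U \<subseteq> vecs m" shows "ext_pow_sub t U \<subseteq> ext_pow_space m t"
  unfolding ext_pow_sub_def
proof (rule fv.span_minimal)
  show "fv.subspace (ext_pow_space m t :: 'a ext1 set)"
    by (rule fv.subspaceI) (auto simp: ext_pow_space_def fscale_def, metis add.right_neutral)
  show "{wedge_list us |us. set us \<subseteq> U \<and> length us = t} \<subseteq> ext_pow_space m t"
  proof clarify
    fix us assume us: "set us \<subseteq> U" "t = length us"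
    have "I \<in> tsub m (length us)" if nz: "wedge_list us I \<noteq> 0" for I
    proof -
      have "i < m" if "i \<in> I" for i
        using wedge_list_support[OF nz that] us(1) assms by (auto simp: vecs_def)
      then show ?thesis using card_wedge_list[OF nz] by (auto simp: tsub_def)
    qed
    then show "wedge_list us \<in> ext_pow_space m (length us)" by (auto simp: ext_pow_space_def)
  qed
qed

lemma restricted_rank_le_hom_rank:
  fixes psi :: "'a::field ext2"
  assumes "U \<subseteq> vecs m"
  shows "fv.dim (apply_hom m t psi ` ext_pow_sub t U) \<le> hom_rank m t psi"
  unfolding hom_rank_def
  by (rule fv_dim_mono[of _ _ "psi ` tsub m t"])
     (use ext_pow_sub_subset[OF assms] apply_hom_in_span finite_tsub in auto)

text \<open>The upper bound also supplies the finiteness on which \<open>Max\<close> relies.\<close>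

lemma small_rank_eqI:
  fixes psi :: "'a::field ext2"
  assumes "\<And>U. U \<subseteq> vecs m \<Longrightarrow> fv.subspace U \<Longrightarrow> fv.dim U \<le> t + 1 \<Longrightarrow>
      fv.dim (apply_hom m t psi ` ext_pow_sub t U) \<le> k"
    and "U \<subseteq> vecs m" "fv.subspace U" "fv.dim U \<le> t + 1" "k \<le> fv.dim (apply_hom m t psi ` ext_pow_sub t U)"
  shows "small_rank m t psi = k"
proof -
  let ?S = "{fv.dim (apply_hom m t psi ` ext_pow_sub t U) | U.
      U \<subseteq> vecs m \<and> fv.subspace U \<and> fv.dim U \<le> t + 1}"
  have "?S \<subseteq> {..k}" using assms(1) by auto
  then have "finite ?S" by (rule finite_subset) simp
  moreover have "k \<in> ?S" using assms by (auto intro!: exI[of _ U] antisym)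
  ultimately show ?thesis unfolding small_rank_def using assms(1) by (intro Max_eqI) auto
qed

lemma zero_hom_rank: "hom_rank m t (Rep_bialg (0 :: 'a::field bialg)) = 0"
proof -
  have "apply_hom m t (Rep_bialg 0) v \<in> fv.span {}" for v :: "'a ext1"
    by (simp add: apply_hom_def zero_bialg.rep_eq zero_fun_def)
  then have "hom_rank m t (Rep_bialg (0 :: 'a bialg)) \<le> card ({} :: 'a ext1 set)"
    unfolding hom_rank_def by (intro fv.dim_le_card) auto
  then show ?thesis by simp
qed

text \<open>The rank condition rules out a single product, so upper and lower bound meet. Since the
  representation is arbitrary, this makes \<open>s\<close> unique.\<close>

lemma small_rank_product:
  fixes z :: "'a::field bialg"
  assumes z: "z = lprod as * rprod ys * Lam m s B" and len: "length as = length ys"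
    and B: "B \<in> homs m n" and vecs: "set as \<subseteq> vecs m" "set ys \<subseteq> vecs n" and t: "length as + s = t"
    and rank: "hom_rank m t (Rep_bialg z) > 1"
  shows "small_rank m t (Rep_bialg z) = s + 1"
proof -
  have "z \<noteq> 0" using rank by (auto simp: zero_hom_rank)
  from z this len B vecs t show ?thesis
  proof (cases rule: rank_dichotomy)
    case (1 as' ys')
    then show ?thesis using rank single_rank_le[of m t as' ys'] by simp
  next
    case (2 U)
    show ?thesis
    proof (rule small_rank_eqI[OF _ 2(2-5)])
      show "fv.dim (apply_hom m t (Rep_bialg z) ` ext_pow_sub t V) \<le> s + 1"
        if "V \<subseteq> vecs m" "fv.dim V \<le> t + 1" for V
        unfolding z mult.assoc by (rule restricted_rank_le[OF t that])
    qed
  qed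
qed

text \<open>The surplus case would give rank at least s+1 with \<open>s\<close> positive, so only
  the single product is left.\<close>

lemma rank_one_product:
  fixes z :: "'a::field bialg"
  assumes z: "z = lprod as * rprod ys * Lam m s B" and len: "length as = length ys"
    and B: "B \<in> homs m n" and vecs: "set as \<subseteq> vecs m" "set ys \<subseteq> vecs n" and t: "length as + s = t"
    and rank: "hom_rank m t (Rep_bialg z) = 1"
  shows "small_rank m t (Rep_bialg z) = 1 \<and>
    (\<exists>as ys. length as = t \<and> length ys = t \<and> set as \<subseteq> vecs m \<and> set ys \<subseteq> vecs n \<and> z = lprod as * rprod ys)"
proof -
  have nz: "z \<noteq> 0" using rank by (auto simp: zero_hom_rank)
  from z nz len B vecs t show ?thesis
  proof (cases rule: rank_dichotomy)
    case (1 as' ys')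
    obtain U where U: "U \<subseteq> vecs m" "fv.subspace U" "fv.dim U \<le> t + 1"
      "1 \<le> fv.dim (apply_hom m t (Rep_bialg z) ` ext_pow_sub t U)"
      using single_image[OF 1(5) nz 1(3,1)] by blast
    have "small_rank m t (Rep_bialg z) = 1"
      by (rule small_rank_eqI[OF _ U]) (use restricted_rank_le_hom_rank[of _ m t "Rep_bialg z"] rank in auto)
    then show ?thesis using 1 by blast
  next
    case (2 U)
    then show ?thesis using restricted_rank_le_hom_rank[of U m t "Rep_bialg z"] rank by linarith
  qed
qed

lemma degenerate_product:
  "degenerate m n t z \<Longrightarrow> \<exists>s as ys B. s \<le> t \<and> length as = t - s \<and> length ys = t - s \<and>
    set as \<subseteq> vecs m \<and> set ys \<subseteq> vecs n \<and> B \<in> homs m n \<and> z = lprod as * rprod ys * Lam m s B"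
proof (induction rule: degenerate.induct)
  case (Lam A t)
  then show ?case by (intro exI[of _ t] exI[of _ "[]"] exI[of _ A]) simp
next
  case (dyad t z a y)
  then obtain s as ys B where *: "s \<le> t" "length as = t - s" "length ys = t - s"
    "set as \<subseteq> vecs m" "set ys \<subseteq> vecs n" "B \<in> homs m n" "z = lprod as * rprod ys * Lam m s B" by blast
  have "dyad a y * z = prod_list (map2 dyad (a # as) (y # ys)) * Lam m s B"
    using * prod_dyads[of as ys] by (simp add: mult.assoc)
  also have "\<dots> = lprod (a # as) * rprod (y # ys) * Lam m s B"
    using * prod_dyads[of "a # as" "y # ys"] by simp
  finally show ?case using * dyad.hyps
    by (intro exI[of _ s] exI[of _ "a # as"] exI[of _ "y # ys"] exI[of _ B]) auto
qed

lemma mult2_tensor_Lambda: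
  "mult2 (tensor (wedge_list as) (wedge_list ys)) (Lambda m s B) = Rep_bialg (lprod as * rprod ys * Lam m s B)"
  by (simp add: times_bialg.rep_eq[of _ "Lam m s B"] Rep_lprod_rprod Lam.rep_eq)

lemma Xcomp_product:
  fixes x :: "'a::{alg_closed_field, field_char_0} ext2"
  assumes "x \<in> Xcomp m n t"
  obtains s as ys B where "s \<le> t" "length as = t - s" "length ys = t - s"
    "set as \<subseteq> vecs m" "set ys \<subseteq> vecs n" "B \<in> homs m n" "x = Rep_bialg (lprod as * rprod ys * Lam m s B)"
  using Xcomp_degenerate[OF assms] degenerate_product by metis

text \<open>Some representation exists for every point of the closure, and by
  \<open>small_rank_product\<close> each one reveals its own \<open>s\<close>; both directions
  follow.\<close>

lemma Xcomp_product_iff: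
  fixes x :: "'a::{alg_closed_field, field_char_0} ext2"
  assumes x: "x \<in> Xcomp m n t" and rank: "hom_rank m t x > 1" and st: "s \<le> t"
  shows "(\<exists>x'\<in>Ycomp m n s. \<exists>\<alpha>s ys. length \<alpha>s = t - s \<and> length ys = t - s \<and>
      set \<alpha>s \<subseteq> vecs m \<and> set ys \<subseteq> vecs n \<and> x = mult2 (tensor (wedge_list \<alpha>s) (wedge_list ys)) x')
    \<longleftrightarrow> s + 1 = small_rank m t x" (is "?L \<longleftrightarrow> ?R")
proof -
  have sr: "small_rank m t x = s' + 1"
    if "s' \<le> t" "length as = t - s'" "length ys = t - s'" "set as \<subseteq> vecs m" "set ys \<subseteq> vecs n"
      "B \<in> homs m n" "x = Rep_bialg (lprod as * rprod ys * Lam m s' B)" for s' as ys B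
    using small_rank_product[OF refl, of as ys B m n s' t] that rank by simp
  show ?thesis
  proof
    assume ?L
    then show ?R using sr[OF st] by (auto simp: Ycomp_def mult2_tensor_Lambda)
  next
    assume R: ?R
    obtain s' as ys B where *: "s' \<le> t" "length as = t - s'" "length ys = t - s'"
      "set as \<subseteq> vecs m" "set ys \<subseteq> vecs n" "B \<in> homs m n" "x = Rep_bialg (lprod as * rprod ys * Lam m s' B)"
      using Xcomp_product[OF x] by metis
    have "s' = s" using sr[OF *] R by simp
    then have "x = mult2 (tensor (wedge_list as) (wedge_list ys)) (Lambda m s B)"
      using *(7) by (simp add: mult2_tensor_Lambda)
    moreover have "Lambda m s B \<in> Ycomp m n s" using *(6) by (simp add: Ycomp_def)
    ultimately show ?L using *(2-5) \<open>s' = s\<close> by blast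
  qed
qed

lemma Xcomp_rank_one:
  fixes x :: "'a::{alg_closed_field, field_char_0} ext2"
  assumes x: "x \<in> Xcomp m n t" and rank: "hom_rank m t x = 1"
  shows "small_rank m t x = 1 \<and> (\<exists>x'\<in>Ycomp m n 0. \<exists>\<alpha>s ys. length \<alpha>s = t \<and> length ys = t \<and>
      set \<alpha>s \<subseteq> vecs m \<and> set ys \<subseteq> vecs n \<and> x = mult2 (tensor (wedge_list \<alpha>s) (wedge_list ys)) x')"
proof -
  obtain s as ys B where *: "s \<le> t" "length as = t - s" "length ys = t - s"
    "set as \<subseteq> vecs m" "set ys \<subseteq> vecs n" "B \<in> homs m n" "x = Rep_bialg (lprod as * rprod ys * Lam m s B)"
    using Xcomp_product[OF x] by metis
  then obtain as' ys' where sr: "small_rank m t x = 1" and r: "length as' = t" "length ys' = t"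
    "set as' \<subseteq> vecs m" "set ys' \<subseteq> vecs n" "lprod as * rprod ys * Lam m s B = lprod as' * rprod ys'"
    using rank_one_product[OF refl, of as ys B m n s t] rank by auto
  have "x = mult2 (tensor (wedge_list as') (wedge_list ys')) (Lambda m 0 B)"
    using *(7) r(5) by (simp add: mult2_tensor_Lambda)
  moreover have "Lambda m 0 B \<in> Ycomp m n 0" using *(6) by (simp add: Ycomp_def)
  ultimately show ?thesis using sr r(1-4) by blast
qed

theorem theorem5p5:
  fixes m n :: nat
  assumes "m \<le> n"
  shows "(Xall m n :: 'a::{alg_closed_field, field_char_0} ext2 set) =
           \<Inter>{S. Yall m n \<subseteq> S \<and>
                 (\<forall>\<alpha>\<in>vecs m. \<forall>y\<in>vecs n. \<forall>z\<in>S.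
                     mult2 (tensor (ext_vec \<alpha>) (ext_vec y)) z \<in> S)}
       \<and> (\<forall>t s (x :: 'a ext2). x \<in> Xcomp m n t \<longrightarrow> hom_rank m t x > 1 \<longrightarrow> s \<le> t \<longrightarrow>
           ((\<exists>x'\<in>Ycomp m n s. \<exists>\<alpha>s ys. length \<alpha>s = t - s \<and> length ys = t - s \<and>
               set \<alpha>s \<subseteq> vecs m \<and> set ys \<subseteq> vecs n \<and>
               x = mult2 (tensor (wedge_list \<alpha>s) (wedge_list ys)) x')
           \<longleftrightarrow> s + 1 = small_rank m t x))
       \<and> (\<forall>t (x :: 'a ext2). x \<in> Xcomp m n t \<longrightarrow> hom_rank m t x = 1 \<longrightarrow>
           small_rank m t x = 1 \<and>
           (\<exists>x'\<in>Ycomp m n 0. \<exists>\<alpha>s ys. length \<alpha>s = t \<and> length ys = t \<and>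
               set \<alpha>s \<subseteq> vecs m \<and> set ys \<subseteq> vecs n \<and>
               x = mult2 (tensor (wedge_list \<alpha>s) (wedge_list ys)) x'))"
  by (rule conjI[OF Xall_eq conjI]; intro allI impI; rule Xcomp_product_iff Xcomp_rank_one; assumption)

end
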